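(* Let $d\ge1$ and let $\phi: x_i \mapsto (-1)^iq^{a_i},\ y_j \mapsto (-1)^jq^{b_j},\ z_k \mapsto \zeta_d^kq^{c_k}$ $(a_i,b_j,c_k\in\mathbb{Z})$ be a cyclotomic specialization for $\mathcal{H}_d$. If the irreducible characters $\chi_\phi$ and $\psi_\phi$ belong to the same Rouquier block of $(\mathcal{H}_{d})_\phi$, then $$a_{\chi_\phi}=a_{\psi_\phi}\quad\text{and}\quad A_{\chi_\phi}=A_{\psi_\phi}.$$
   Context: Let $\zeta_n:=\exp(2\pi i/n)$, $K:=\mathbb{Q}(\zeta_{2d})$ with ring of integers $\mathbb{Z}_K$, $\mu(K)$ the group of roots of unity of $K$, $y$ an indeterminate, $q:=y^{|\mu(K)|}$, and $\mathcal{R}_K(y):=\mathbb{Z}_K[y,y^{-1},(y^n-1)^{-1}_{n\geq 1}]$. The generic Hecke algebra $\mathcal{H}_d$ of $G(2d,2,2)$ is the algebra over $\mathbb{Z}[x_0^{\pm1},x_1^{\pm1},y_0^{\pm1},y_1^{\pm1},z_0^{\pm1},\ldots,z_{d-1}^{\pm1}]$ generated by $s,t,u$ with relations $stu=tus=ust$ and $(s-x_0)(s-x_1)=(t-y_0)(t-y_1)=\prod_{k=0}^{d-1}(u-z_k)=0$; it is free of rank $4d^2$. Its irreducible characters (over a splitting field) are: the linear characters $\chi_{ijk}$ ($0\le i,j\le1$, $0\le k<d$), $s\mapsto x_i,t\mapsto y_j,u\mapsto z_k$; and, for each pair $k\neq l$ in $\{0,\ldots,d-1\}$, two characters $\chi_{kl}^{1}=\chi_{lk}^1$,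 $\chi_{kl}^{2}=\chi_{lk}^2$ of degree $2$ (on which $s,t,u$ have eigenvalues $x_0,x_1$; $y_0,y_1$; $z_k,z_l$; the two are distinguished by the scalar $\pm\sqrt{x_0x_1y_0y_1z_kz_l}$ by which the central element $stu$ acts). With respect to the canonical symmetrizing form $t=\sum_\chi\frac1{s_\chi}\chi$, the generic Schur elements are (Malle), with $\Phi_1(w)=w-1$: for $\chi_{ijk}$, $$s_{\chi_{ijk}}=\Phi_1(x_ix_{1-i}^{-1})\,\Phi_1(y_jy_{1-j}^{-1})\prod_{l\neq k}\Phi_1(z_kz_l^{-1})\,\Phi_1(x_ix_{1-i}^{-1}y_jy_{1-j}^{-1}z_kz_l^{-1}),$$ and for $\chi_{kl}^{1,2}$, $$-2\prod_{m\neq k,l}\Phi_1(z_kz_m^{-1})\Phi_1(z_lz_m^{-1})\prod_{i=0}^1\Phi_1(X_iX_{1-i}^{-1}Y_iY_{1-i}^{-1}Z_kZ_l^{-1})\,\Phi_1(X_iX_{1-i}^{-1}Y_{1-i}Y_i^{-1}Z_lZ_k^{-1}),$$ with $X_i^2=x_i$, $Y_j^2=y_j$, $Z_k^2=z_k$ (the two characters corresponding to the two choices of sign of the square roots). For $\phi$ as in the claim, $(\mathcal{H}_d)_\phi$ is the specialized $\mathbb{Z}_K[y,y^{-1}]$-algebra; $K(y)(\mathcal{H}_d)_\phi$ is split semisimple, the irreducible characters $\chi$ specialize bijectively to the irreducible characters $\chi_\phi$ of $K(y)(\mathcal{H}_d)_\phi$, and the Schur element $s_{\chi_\phi}(y)$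 of $\chi_\phi$ is the specialization of $s_\chi$. One sets $a_{\chi_\phi}:=\mathrm{val}_y(s_{\chi_\phi}(y))/|\mu(K)|$ and $A_{\chi_\phi}:=\deg_y(s_{\chi_\phi}(y))/|\mu(K)|$, where $\mathrm{val}_y(P)$ is the order of $P$ at $y=0$ and $\deg_y(P)$ is the opposite of the valuation of $P(1/y)$. The Rouquier blocks of $(\mathcal{H}_d)_\phi$ are the blocks of $\mathcal{R}_K(y)(\mathcal{H}_d)_\phi$: $\chi_\phi,\psi_\phi$ are in the same one iff their central primitive idempotents occur in the same primitive idempotent of the center of $\mathcal{R}_K(y)(\mathcal{H}_d)_\phi$. *)

theory Defs
  imports
    Complex_Main
    "HOL-Library.Poly_Mapping"
    "HOL-Computational_Algebra.Computational_Algebra"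
    "HOL-Algebra.QuotRing"
    "HOL-Algebra.Generated_Rings"
    "HOL-Algebra.Generated_Fields"
    "Jordan_Normal_Form.VS_Connect"
    "Jordan_Normal_Form.Char_Poly"
begin

section \<open>The base rings\<close>

definition zeta :: "nat \<Rightarrow> complex" where
  "zeta n = exp (2 * of_real pi * \<i> / of_nat n)"

text \<open>Number fields are realised inside the complex numbers, and \<open>K(y)\<close> inside the field
  \<^typ>\<open>complex poly fract\<close> of complex rational functions in \<open>y\<close>.\<close>

definition cyc_field :: "nat \<Rightarrow> complex set" where
  "cyc_field d = generate_field class_ring {zeta (2 * d)}"

definition cyc_integers :: "nat \<Rightarrow> complex set" where
  "cyc_integers d = {w \<in> cyc_field d. algebraic_int w}"

definition cyc_mu :: "nat \<Rightarrow> complex set" where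
  "cyc_mu d = {w \<in> cyc_field d. \<exists>n\<ge>1. w ^ n = 1}"

type_synonym ratfun = "complex poly fract"

definition rconst :: "complex \<Rightarrow> ratfun" where
  "rconst w = to_fract [:w:]"

definition rvar :: ratfun where
  "rvar = to_fract [:0, 1:]"

definition qpar :: "nat \<Rightarrow> ratfun" where
  "qpar d = rvar ^ card (cyc_mu d)"

definition Ky :: "nat \<Rightarrow> ratfun set" where
  "Ky d = generate_field class_ring (rconst ` cyc_field d \<union> {rvar})"

definition rouquier_ring :: "nat \<Rightarrow> ratfun set" where
  "rouquier_ring d = generate_ring class_ring
     (rconst ` cyc_integers d \<union> {rvar, inverse rvar} \<union> {inverse (rvar ^ n - 1) | n. n \<ge> 1})"

definition val_y :: "ratfun \<Rightarrow> int" where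
  "val_y P = (THE v. \<exists>p r. p \<noteq> 0 \<and> r \<noteq> 0 \<and> P = Fract p r \<and>
     v = int (Polynomial.order 0 p) - int (Polynomial.order 0 r))"

lemma val_y_Fract:
  assumes "p \<noteq> 0" "r \<noteq> 0"
  shows "val_y (Fract p r) = int (Polynomial.order 0 p) - int (Polynomial.order 0 r)"
  unfolding val_y_def
proof (rule the_equality)
  show "\<exists>p' r'. p' \<noteq> 0 \<and> r' \<noteq> 0 \<and> Fract p r = Fract p' r' \<and>
    int (Polynomial.order 0 p) - int (Polynomial.order 0 r) = int (Polynomial.order 0 p') - int (Polynomial.order 0 r')"
    using assms by blast
next
  fix v assume "\<exists>p' r'. p' \<noteq> 0 \<and> r' \<noteq> 0 \<and> Fract p r = Fract p' r' \<and>
    v = int (Polynomial.order 0 p') - int (Polynomial.order 0 r')"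
  then obtain p' r' where h: "p' \<noteq> 0" "r' \<noteq> 0" "Fract p r = Fract p' r'"
    "v = int (Polynomial.order 0 p') - int (Polynomial.order 0 r')" by blast
  have "p * r' = p' * r" using h(1-3) assms by (simp add: eq_fract)
  then have "Polynomial.order 0 (p * r') = Polynomial.order 0 (p' * r)" by simp
  then have "Polynomial.order 0 p + Polynomial.order 0 r' = Polynomial.order 0 p' + Polynomial.order 0 r"
    using assms h by (simp add: Polynomial.order_mult)
  then show "v = int (Polynomial.order 0 p) - int (Polynomial.order 0 r)" using h(4) by linarith
qed

text \<open>The substitution \<open>P(y) \<mapsto> P(1/y)\<close>.\<close>

definition subst_inv :: "ratfun \<Rightarrow> ratfun" where
  "subst_inv P = (THE Q. \<exists>p r. r \<noteq> 0 \<and> P = Fract p r \<and>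
     Q = poly (map_poly rconst p) (inverse rvar) / poly (map_poly rconst r) (inverse rvar))"

definition deg_y :: "ratfun \<Rightarrow> int" where
  "deg_y P = - val_y (subst_inv P)"


section \<open>Hecke algebras of \<open>G(2d,2,2)\<close>\<close>

text \<open>With concatenation of words as addition, \<open>gen list \<Rightarrow>\<^sub>0 'f\<close> is the free associative
  algebra on the generators; its product is noncommutative.\<close>

instantiation list :: (type) monoid_add
begin
definition zero_list :: "'a list" where "zero_list = []"
definition plus_list :: "'a list \<Rightarrow> 'a list \<Rightarrow> 'a list" where "plus_list = (@)"
instance by standard (simp_all add: zero_list_def plus_list_def)
end

datatype gen = GS | GT | GU

type_synonym 'f free = "gen list \<Rightarrow>\<^sub>0 'f"

definition fgen :: "gen \<Rightarrow> 'f::comm_ring_1 free" where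
  "fgen g = Poly_Mapping.single [g] 1"

definition fconst :: "'f \<Rightarrow> 'f::comm_ring_1 free" where
  "fconst w = Poly_Mapping.single [] w"

definition free_alg :: "'f set \<Rightarrow> 'f::comm_ring_1 free ring" where
  "free_alg R = \<lparr>carrier = {f. \<forall>w. Poly_Mapping.lookup f w \<in> R},
     monoid.mult = (*), one = 1, ring.zero = 0, add = (+)\<rparr>"

definition hecke_relations ::
  "nat \<Rightarrow> (nat \<Rightarrow> 'f) \<Rightarrow> (nat \<Rightarrow> 'f) \<Rightarrow> (nat \<Rightarrow> 'f) \<Rightarrow> 'f::comm_ring_1 free set" where
  "hecke_relations d x y z =
     {fgen GS * fgen GT * fgen GU - fgen GT * fgen GU * fgen GS,
      fgen GT * fgen GU * fgen GS - fgen GU * fgen GS * fgen GT,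
      (fgen GS - fconst (x 0)) * (fgen GS - fconst (x 1)),
      (fgen GT - fconst (y 0)) * (fgen GT - fconst (y 1)),
      prod_list (map (\<lambda>k. fgen GU - fconst (z k)) [0..<d])}"

definition hecke_ideal ::
  "'f set \<Rightarrow> nat \<Rightarrow> (nat \<Rightarrow> 'f) \<Rightarrow> (nat \<Rightarrow> 'f) \<Rightarrow> (nat \<Rightarrow> 'f) \<Rightarrow> 'f::comm_ring_1 free set" where
  "hecke_ideal R d x y z = genideal (free_alg R) (hecke_relations d x y z)"

text \<open>The Hecke algebra over the subring \<open>R\<close> with parameters \<open>x\<^sub>i, y\<^sub>j, z\<^sub>k\<close> in \<open>R\<close>. Indeterminate
  parameters give the generic algebra; as a presentation is compatible with base change, a
  specialization of it is obtained by inserting the images of the indeterminates.\<close>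

definition hecke_algebra ::
  "'f set \<Rightarrow> nat \<Rightarrow> (nat \<Rightarrow> 'f) \<Rightarrow> (nat \<Rightarrow> 'f) \<Rightarrow> (nat \<Rightarrow> 'f) \<Rightarrow> 'f::comm_ring_1 free set ring" where
  "hecke_algebra R d x y z = free_alg R Quot hecke_ideal R d x y z"

definition hecke_class ::
  "'f set \<Rightarrow> nat \<Rightarrow> (nat \<Rightarrow> 'f) \<Rightarrow> (nat \<Rightarrow> 'f) \<Rightarrow> (nat \<Rightarrow> 'f) \<Rightarrow> 'f free \<Rightarrow> 'f::comm_ring_1 free set" where
  "hecke_class R d x y z f = hecke_ideal R d x y z +>\<^bsub>free_alg R\<^esub> f"

text \<open>The natural map to the algebra over a larger ring \<open>L\<close>, \<open>f + I\<^sub>R \<mapsto> f + I\<^sub>L\<close>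
  (\<open>I\<^sub>R \<subseteq> I\<^sub>L\<close>).\<close>

definition hecke_extend ::
  "'f set \<Rightarrow> nat \<Rightarrow> (nat \<Rightarrow> 'f) \<Rightarrow> (nat \<Rightarrow> 'f) \<Rightarrow> (nat \<Rightarrow> 'f) \<Rightarrow> 'f free set \<Rightarrow> 'f::comm_ring_1 free set" where
  "hecke_extend L d x y z C = hecke_ideal L d x y z <+>\<^bsub>free_alg L\<^esub> C"


section \<open>Central idempotents\<close>

definition ring_center :: "('a, 'b) ring_scheme \<Rightarrow> 'a set" where
  "ring_center A = {w \<in> carrier A. \<forall>h\<in>carrier A. w \<otimes>\<^bsub>A\<^esub> h = h \<otimes>\<^bsub>A\<^esub> w}"

definition central_idem :: "('a, 'b) ring_scheme \<Rightarrow> 'a \<Rightarrow> bool" where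
  "central_idem A e \<longleftrightarrow> e \<in> ring_center A \<and> e \<otimes>\<^bsub>A\<^esub> e = e"

definition central_primitive_idem :: "('a, 'b) ring_scheme \<Rightarrow> 'a \<Rightarrow> bool" where
  "central_primitive_idem A e \<longleftrightarrow> central_idem A e \<and> e \<noteq> \<zero>\<^bsub>A\<^esub> \<and>
     (\<forall>f g. central_idem A f \<and> central_idem A g \<and> f \<otimes>\<^bsub>A\<^esub> g = \<zero>\<^bsub>A\<^esub> \<and> e = f \<oplus>\<^bsub>A\<^esub> g
        \<longrightarrow> f = \<zero>\<^bsub>A\<^esub> \<or> g = \<zero>\<^bsub>A\<^esub>)"


section \<open>Irreducible characters and Schur elements\<close>

text \<open>\<open>L\<close>-linear representations of the algebra over the subfield \<open>L\<close> of \<open>'f\<close>, by matrices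
  with entries in \<open>L\<close>.\<close>

definition mat_alg :: "'f set \<Rightarrow> nat \<Rightarrow> 'f::field mat ring" where
  "mat_alg L n = (ring_mat TYPE('f) n ())
     \<lparr>carrier := {M \<in> carrier_mat n n. elements_mat M \<subseteq> L}\<rparr>"

definition hecke_rep ::
  "'f set \<Rightarrow> nat \<Rightarrow> (nat \<Rightarrow> 'f) \<Rightarrow> (nat \<Rightarrow> 'f) \<Rightarrow> (nat \<Rightarrow> 'f) \<Rightarrow> nat
     \<Rightarrow> ('f free set \<Rightarrow> 'f::field mat) \<Rightarrow> bool" where
  "hecke_rep L d x y z n \<rho> \<longleftrightarrow>
     \<rho> \<in> Ring.ring_hom (hecke_algebra L d x y z) (mat_alg L n) \<and>
     (\<forall>w\<in>L. \<rho> (hecke_class L d x y z (fconst w)) = w \<cdot>\<^sub>m 1\<^sub>m n)"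

definition vec_space_over :: "'f set \<Rightarrow> nat \<Rightarrow> 'f::field vec set" where
  "vec_space_over L n = {v \<in> carrier_vec n. vec_set v \<subseteq> L}"

definition irreducible_hecke_rep ::
  "'f set \<Rightarrow> nat \<Rightarrow> (nat \<Rightarrow> 'f) \<Rightarrow> (nat \<Rightarrow> 'f) \<Rightarrow> (nat \<Rightarrow> 'f) \<Rightarrow> nat
     \<Rightarrow> ('f free set \<Rightarrow> 'f::field mat) \<Rightarrow> bool" where
  "irreducible_hecke_rep L d x y z n \<rho> \<longleftrightarrow>
     hecke_rep L d x y z n \<rho> \<and> n \<ge> 1 \<and>
     (\<forall>W \<subseteq> vec_space_over L n.
        0\<^sub>v n \<in> W \<and> (\<forall>v\<in>W. \<forall>v'\<in>W. v + v' \<in> W) \<and> (\<forall>w\<in>L. \<forall>v\<in>W. w \<cdot>\<^sub>v v \<in> W) \<and>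
        (\<forall>h\<in>carrier (hecke_algebra L d x y z). \<forall>v\<in>W. \<rho> h *\<^sub>v v \<in> W)
        \<longrightarrow> W = {0\<^sub>v n} \<or> W = vec_space_over L n)"

definition mat_tr :: "'f::field mat \<Rightarrow> 'f" where
  "mat_tr M = (\<Sum>i<dim_row M. M $$ (i, i))"

text \<open>The generic irreducible characters: \<open>Lin i j k\<close> is \<open>\<chi>\<^sub>i\<^sub>j\<^sub>k\<close>, and \<open>Quad k l \<epsilon>\<close> with
  \<open>\<epsilon> = 1, -1\<close> are the two characters attached to \<open>{k, l}\<close> (\<open>Quad k l \<epsilon>\<close> and \<open>Quad l k \<epsilon>\<close> name the
  same character).\<close>

datatype hecke_char = Lin nat nat nat | Quad nat nat int

fun hecke_irr :: "nat \<Rightarrow> hecke_char \<Rightarrow> bool" where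
  "hecke_irr d (Lin i j k) \<longleftrightarrow> i \<le> 1 \<and> j \<le> 1 \<and> k < d"
| "hecke_irr d (Quad k l \<epsilon>) \<longleftrightarrow> k < d \<and> l < d \<and> k \<noteq> l \<and> \<epsilon> \<in> {1, -1}"

text \<open>Let \<open>X\<^sub>i, Y\<^sub>j, Z\<^sub>k\<close> be square roots of the parameters. On \<open>Quad k l \<epsilon>\<close> the central element
  \<open>stu\<close> acts as \<open>\<epsilon> X\<^sub>0 X\<^sub>1 Y\<^sub>0 Y\<^sub>1 Z\<^sub>k Z\<^sub>l\<close>, and its Schur element is the generic formula with \<open>X\<^sub>0\<close>
  replaced by \<open>\<epsilon> X\<^sub>0\<close>. The two signs have to match: with \<open>r\<close> the scalar of \<open>stu\<close>, the
  factors are \<open>r / (x\<^sub>1\<^sub>-\<^sub>i y\<^sub>1\<^sub>-\<^sub>i z\<^sub>l) - 1\<close> and \<open>r / (x\<^sub>1\<^sub>-\<^sub>i y\<^sub>i z\<^sub>k) - 1\<close>, and they vanish exactly where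
  \<open>r\<close> equals the scalar of a linear character, so that the representation becomes reducible.\<close>

fun affords ::
  "'f set \<Rightarrow> nat \<Rightarrow> (nat \<Rightarrow> 'f) \<Rightarrow> (nat \<Rightarrow> 'f) \<Rightarrow> (nat \<Rightarrow> 'f)
     \<Rightarrow> (nat \<Rightarrow> 'f) \<Rightarrow> (nat \<Rightarrow> 'f) \<Rightarrow> (nat \<Rightarrow> 'f)
     \<Rightarrow> nat \<Rightarrow> ('f free set \<Rightarrow> 'f::field mat) \<Rightarrow> hecke_char \<Rightarrow> bool" where
  "affords L d x y z X Y Z n \<rho> (Lin i j k) \<longleftrightarrow>
     n = 1 \<and>
     \<rho> (hecke_class L d x y z (fgen GS)) = x i \<cdot>\<^sub>m 1\<^sub>m 1 \<and>
     \<rho> (hecke_class L d x y z (fgen GT)) = y j \<cdot>\<^sub>m 1\<^sub>m 1 \<and>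
     \<rho> (hecke_class L d x y z (fgen GU)) = z k \<cdot>\<^sub>m 1\<^sub>m 1"
| "affords L d x y z X Y Z n \<rho> (Quad k l \<epsilon>) \<longleftrightarrow>
     n = 2 \<and>
     char_poly (\<rho> (hecke_class L d x y z (fgen GS))) = [:- x 0, 1:] * [:- x 1, 1:] \<and>
     char_poly (\<rho> (hecke_class L d x y z (fgen GT))) = [:- y 0, 1:] * [:- y 1, 1:] \<and>
     char_poly (\<rho> (hecke_class L d x y z (fgen GU))) = [:- z k, 1:] * [:- z l, 1:] \<and>
     \<rho> (hecke_class L d x y z (fgen GS * fgen GT * fgen GU))
       = (of_int \<epsilon> * X 0 * X 1 * Y 0 * Y 1 * Z k * Z l) \<cdot>\<^sub>m 1\<^sub>m 2"

definition Phi1 :: "'f::field \<Rightarrow> 'f" where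
  "Phi1 w = w - 1"

fun schur_element ::
  "nat \<Rightarrow> (nat \<Rightarrow> 'f) \<Rightarrow> (nat \<Rightarrow> 'f) \<Rightarrow> (nat \<Rightarrow> 'f)
     \<Rightarrow> (nat \<Rightarrow> 'f) \<Rightarrow> (nat \<Rightarrow> 'f) \<Rightarrow> (nat \<Rightarrow> 'f) \<Rightarrow> hecke_char \<Rightarrow> 'f::field" where
  "schur_element d x y z X Y Z (Lin i j k) =
     Phi1 (x i / x (1 - i)) * Phi1 (y j / y (1 - j)) *
     (\<Prod>l\<in>{..<d} - {k}. Phi1 (z k / z l) *
        Phi1 ((x i / x (1 - i)) * (y j / y (1 - j)) * (z k / z l)))"
| "schur_element d x y z X Y Z (Quad k l \<epsilon>) =
     - 2 * (\<Prod>m\<in>{..<d} - {k, l}. Phi1 (z k / z m) * Phi1 (z l / z m)) *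
     (\<Prod>i\<in>{0, 1}.
        Phi1 (of_int \<epsilon> * (X i / X (1 - i)) * (Y i / Y (1 - i)) * (Z k / Z l)) *
        Phi1 (of_int \<epsilon> * (X i / X (1 - i)) * (Y (1 - i) / Y i) * (Z l / Z k)))"


section \<open>The cyclotomic specialization\<close>

definition xs :: "nat \<Rightarrow> (nat \<Rightarrow> int) \<Rightarrow> nat \<Rightarrow> ratfun" where
  "xs d a i = (-1) ^ i * qpar d powi a i"

definition ys :: "nat \<Rightarrow> (nat \<Rightarrow> int) \<Rightarrow> nat \<Rightarrow> ratfun" where
  "ys d b j = (-1) ^ j * qpar d powi b j"

definition zs :: "nat \<Rightarrow> (nat \<Rightarrow> int) \<Rightarrow> nat \<Rightarrow> ratfun" where
  "zs d c k = rconst (zeta d ^ k) * qpar d powi c k"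

text \<open>An extension of the specialization to the square roots of the indeterminates; the other
  choices only permute the values \<open>\<epsilon> = 1, -1\<close>. The number \<open>|\<mu>(K)|\<close> is even since
  \<open>-1 \<in> \<mu>(K)\<close>.\<close>

definition qsqrt :: "nat \<Rightarrow> ratfun" where
  "qsqrt d = rvar ^ (card (cyc_mu d) div 2)"

definition xs_root :: "nat \<Rightarrow> (nat \<Rightarrow> int) \<Rightarrow> nat \<Rightarrow> ratfun" where
  "xs_root d a i = rconst (\<i> ^ i) * qsqrt d powi a i"

definition ys_root :: "nat \<Rightarrow> (nat \<Rightarrow> int) \<Rightarrow> nat \<Rightarrow> ratfun" where
  "ys_root d b j = rconst (\<i> ^ j) * qsqrt d powi b j"

definition zs_root :: "nat \<Rightarrow> (nat \<Rightarrow> int) \<Rightarrow> nat \<Rightarrow> ratfun" where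
  "zs_root d c k = rconst (zeta (2 * d) ^ k) * qsqrt d powi c k"

lemma even_card_cyc_mu: "even (card (cyc_mu d))"
proof (cases "finite (cyc_mu d)")
  case True
  let ?K = "class_ring :: complex ring"
  have minus: "- w \<in> cyc_mu d" if w: "w \<in> cyc_mu d" for w
  proof -
    from w obtain n where n: "w \<in> cyc_field d" "n \<ge> 1" "w ^ n = 1"
      unfolding cyc_mu_def by blast
    have "\<ominus>\<^bsub>?K\<^esub> w \<in> cyc_field d"
      using n(1) unfolding cyc_field_def by (rule generate_field.a_inv)
    moreover have "\<ominus>\<^bsub>?K\<^esub> w = - w"
      by (simp add: class_ring_simps)
    moreover have "(- w) ^ (2 * n) = 1"
    proof -
      have "(- w) ^ (2 * n) = (w\<^sup>2) ^ n" by (simp add: power_mult)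
      also have "\<dots> = (w ^ n)\<^sup>2" by (metis power_mult mult.commute)
      finally show ?thesis using n(3) by simp
    qed
    ultimately show ?thesis using n(2) unfolding cyc_mu_def
      by (auto intro!: exI[of _ "2 * n"])
  qed
  define P where "P = (\<lambda>w. {w, - w}) ` cyc_mu d"
  have nz: "w \<noteq> 0" if "w \<in> cyc_mu d" for w
    using that unfolding cyc_mu_def by (auto simp: power_0_left)
  have "card (cyc_mu d) = card (\<Union> P)"
    unfolding P_def using minus by (auto intro!: arg_cong[of _ _ card])
  also have "\<dots> = (\<Sum>p\<in>P. card p)"
  proof (rule card_Union_disjoint)
    show "pairwise disjnt P" unfolding P_def pairwise_def disjnt_def by auto
  qed (auto simp: P_def)
  also have "\<dots> = (\<Sum>p\<in>P. 2)"
  proof (rule sum.cong[OF refl])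
    fix p assume "p \<in> P"
    then obtain w where w: "w \<in> cyc_mu d" "p = {w, - w}" unfolding P_def by blast
    have "w \<noteq> - w" using nz[OF w(1)] by simp
    then show "card p = 2" using w(2) by simp
  qed
  finally show ?thesis by simp
qed simp

lemma qsqrt_square: "qsqrt d ^ 2 = qpar d"
proof -
  have "card (cyc_mu d) div 2 * 2 = card (cyc_mu d)" using even_card_cyc_mu by simp
  then show ?thesis unfolding qsqrt_def qpar_def by (metis power_mult)
qed

lemma rconst_mult: "rconst (v * w) = rconst v * rconst w"
  by (simp add: rconst_def to_fract_def mult.commute)

lemma rconst_neg_one_power: "rconst ((-1) ^ i) = (-1) ^ i"
  proof (induction i)
  case 0 show ?case by (simp add: rconst_def to_fract_def One_fract_def one_pCons)
next
  case (Suc i)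
  have "rconst (- 1) = - 1" by (simp add: rconst_def to_fract_def One_fract_def one_pCons)
  with Suc show ?case using rconst_mult[of "- 1" "(- 1) ^ i"] by simp
qed

lemma qsqrt_powi_square: "(qsqrt d powi n)\<^sup>2 = qpar d powi n"
  by (metis power2_eq_square power_int_mult_distrib qsqrt_square)

lemma roots_square:
  "xs_root d a i ^ 2 = xs d a i" "ys_root d b i ^ 2 = ys d b i"
  "d \<ge> 1 \<Longrightarrow> zs_root d c i ^ 2 = zs d c i"
proof -
  have i2: "(\<i> ^ i)\<^sup>2 = (-1) ^ i" by (metis power2_i power_mult mult.commute)
  have r2: "(rconst w)\<^sup>2 = rconst (w\<^sup>2)" for w
    by (simp add: power2_eq_square rconst_mult)
  show "xs_root d a i ^ 2 = xs d a i" "ys_root d b i ^ 2 = ys d b i"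
    unfolding xs_root_def ys_root_def xs_def ys_def
    by (simp_all add: power_mult_distrib qsqrt_powi_square r2 i2 rconst_neg_one_power)
  assume "d \<ge> 1"
  then have "(zeta (2 * d))\<^sup>2 = zeta d"
    unfolding zeta_def by (simp add: exp_double[symmetric] field_simps)
  then have "(zeta (2 * d) ^ i)\<^sup>2 = zeta d ^ i" by (metis power_mult mult.commute)
  then show "zs_root d c i ^ 2 = zs d c i"
    unfolding zs_root_def zs_def by (simp add: power_mult_distrib qsqrt_powi_square r2)
qed

context
  fixes d :: nat and a b c :: "nat \<Rightarrow> int"
begin

definition KyH :: "ratfun free set ring" where
  "KyH = hecke_algebra (Ky d) d (xs d a) (ys d b) (zs d c)"

definition RyH :: "ratfun free set ring" where
  "RyH = hecke_algebra (rouquier_ring d) d (xs d a) (ys d b) (zs d c)"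

definition RyH_to_KyH :: "ratfun free set \<Rightarrow> ratfun free set" where
  "RyH_to_KyH = hecke_extend (Ky d) d (xs d a) (ys d b) (zs d c)"

text \<open>\<open>f\<close> is the irreducible character \<open>\<chi>\<^sub>\<phi>\<close> of \<open>K(y)(H\<^sub>d)\<^sub>\<phi>\<close>.\<close>

definition specialized_char :: "hecke_char \<Rightarrow> (ratfun free set \<Rightarrow> ratfun) \<Rightarrow> bool" where
  "specialized_char \<chi> f \<longleftrightarrow> hecke_irr d \<chi> \<and>
     (\<exists>n \<rho>. irreducible_hecke_rep (Ky d) d (xs d a) (ys d b) (zs d c) n \<rho> \<and>
        affords (Ky d) d (xs d a) (ys d b) (zs d c)
          (xs_root d a) (ys_root d b) (zs_root d c) n \<rho> \<chi> \<and>
        (\<forall>h\<in>carrier KyH. f h = mat_tr (\<rho> h)))"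

definition char_idem :: "(ratfun free set \<Rightarrow> ratfun) \<Rightarrow> ratfun free set \<Rightarrow> bool" where
  "char_idem f e \<longleftrightarrow> central_primitive_idem KyH e \<and> (\<forall>h\<in>carrier KyH. f (e \<otimes>\<^bsub>KyH\<^esub> h) = f h)"

definition same_rouquier_block ::
  "(ratfun free set \<Rightarrow> ratfun) \<Rightarrow> (ratfun free set \<Rightarrow> ratfun) \<Rightarrow> bool" where
  "same_rouquier_block f g \<longleftrightarrow>
     (\<exists>B e e'. central_primitive_idem RyH B \<and> char_idem f e \<and> char_idem g e' \<and>
        e \<otimes>\<^bsub>KyH\<^esub> RyH_to_KyH B = e \<and> e' \<otimes>\<^bsub>KyH\<^esub> RyH_to_KyH B = e')"

definition specialized_schur :: "hecke_char \<Rightarrow> ratfun" where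
  "specialized_schur \<chi> = schur_element d (xs d a) (ys d b) (zs d c)
     (xs_root d a) (ys_root d b) (zs_root d c) \<chi>"

definition a_value :: "hecke_char \<Rightarrow> rat" where
  "a_value \<chi> = of_int (val_y (specialized_schur \<chi>)) / of_nat (card (cyc_mu d))"

definition A_value :: "hecke_char \<Rightarrow> rat" where
  "A_value \<chi> = of_int (deg_y (specialized_schur \<chi>)) / of_nat (card (cyc_mu d))"

end

end

theory Submission
  imports Defs
begin

text \<open>
  Attach to every character a pair of values \<open>p, p'\<close>: for the characters of degree \<open>2\<close> these are
  \<open>z\<^sub>k, z\<^sub>l\<close>, and for \<open>\<chi>\<^sub>i\<^sub>j\<^sub>k\<close> they are \<open>z\<^sub>k\<close> and \<open>z\<^sub>k x\<^sub>i y\<^sub>j / (x\<^sub>1\<^sub>-\<^sub>i y\<^sub>1\<^sub>-\<^sub>j)\<close>. After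
  specialization both are roots of unity times powers of \<open>q\<close>; the exponents of \<open>q\<close> are the
  \<open>char_exponents\<close>. The theorem follows from two facts: characters in one Rouquier block have the
  same unordered pair of exponents (\<open>same_block_exponents\<close>), and the valuation and the degree of the
  Schur element depend only on this pair (\<open>growth_schur\<close>).

  For the first fact, put \<open>w = stu\<close>, which is central. The elements \<open>s\<close> and \<open>t\<close> generate a Hecke
  algebra of the infinite dihedral group, in which the Bernstein element
  \<open>\<theta> = st + x\<^sub>0x\<^sub>1y\<^sub>0y\<^sub>1(st)\<^sup>-\<^sup>1\<close> is central. As \<open>u = w(st)\<^sup>-\<^sup>1\<close>, the element \<open>u\<close> has a conjugate
  \<open>ubar = w(st)/(x\<^sub>0x\<^sub>1y\<^sub>0y\<^sub>1)\<close> such that \<open>u + ubar\<close> and \<open>u ubar\<close> are central; on the characters above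
  they act as \<open>p + p'\<close> and \<open>p p'\<close>. Consequently, for a polynomial \<open>h\<close> over the Rouquier ring,
  \<open>h(u)h(ubar)\<close> is central and acts as \<open>h(p)h(p')\<close> (\<open>norm_value\<close>). Monomials \<open>\<zeta>q\<^sup>m\<close> with different
  exponents differ by a unit of the Rouquier ring (\<open>qmon_diff_unit\<close>). For every set \<open>W\<close> of exponents
  there is therefore an \<open>h\<close> which is \<open>1\<close> at the values with exponent in \<open>W\<close>, is \<open>0\<close> at the other ones,
  and for which \<open>h\<^sup>2 - h\<close> is divisible by the product of the linear factors of all values
  (\<open>separating_polynomial\<close>). If this product annihilates \<open>u\<close> and \<open>ubar\<close>, then \<open>h(u)h(ubar)\<close> is a
  central idempotent of the algebra over the Rouquier ring. A primitive one lies below it or is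
  orthogonal to it, so characters in one block agree on whether both of their exponents lie in \<open>W\<close>.

  It remains to annihilate \<open>ubar\<close>. Let \<open>P = \<Prod>\<^sub>k (U - z\<^sub>k)\<close>. Dividing \<open>P\<close> by
  \<open>U\<^sup>2 - (u + ubar)U + u ubar\<close> turns \<open>P(u) = 0\<close> into \<open>\<alpha> + \<beta>u = 0\<close> with central \<open>\<alpha>, \<beta>\<close>. Commuting
  with \<open>s\<close> gives \<open>\<beta>(ts - st) = 0\<close> (\<open>central_coefficient_eta\<close>), and \<open>(ts - st)\<^sup>2(st)\<^sup>2\<close> equals
  \<open>\<Prod>\<^sub>i\<^sub>j (st - x\<^sub>iy\<^sub>j)\<close>. Since \<open>P(ubar) = \<beta>(ubar - u)\<close>, this product annihilates \<open>P(ubar)\<close>. Finally,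
  where \<open>st\<close> is the scalar \<open>x\<^sub>iy\<^sub>j\<close>, the element \<open>ubar\<close> is a scalar multiple of \<open>u\<close> and its equation
  comes from that of \<open>u\<close> (\<open>ubar_on_eigenvalue\<close>, \<open>ev_eigenvalues\<close>).

  For the second fact, a factor \<open>\<xi>y\<^sup>m - 1\<close> has valuation \<open>(m - |m|)/2\<close> and degree \<open>(m + |m|)/2\<close>. Over all
  factors of a Schur element, the sum of the \<open>m\<close> and the sum of the \<open>|m|\<close> are given by the same
  formulas (\<open>growth_sum\<close>, \<open>growth_spread\<close>) in the two exponents, symmetric in them, for the linear
  characters and for those of degree \<open>2\<close>.
\<close>

section \<open>Congruences modulo an ideal\<close>

text \<open>Quotients are handled as congruences: identities between words can then be checked by ring
  normalization in \<open>G\<close>, up to explicit elements of the ideal \<open>I\<close>.\<close>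
locale ideal_congruence =
  fixes G I :: "'a::ring_1 set"
  assumes G_one: "1 \<in> G" and G_add: "\<And>f g. f \<in> G \<Longrightarrow> g \<in> G \<Longrightarrow> f + g \<in> G"
    and G_minus: "\<And>f. f \<in> G \<Longrightarrow> - f \<in> G"
    and G_mult: "\<And>f g. f \<in> G \<Longrightarrow> g \<in> G \<Longrightarrow> f * g \<in> G"
    and I_sub: "I \<subseteq> G" and I_zero: "0 \<in> I"
    and I_add: "\<And>f g. f \<in> I \<Longrightarrow> g \<in> I \<Longrightarrow> f + g \<in> I"
    and I_left: "\<And>f g. f \<in> G \<Longrightarrow> g \<in> I \<Longrightarrow> f * g \<in> I"
    and I_right: "\<And>f g. f \<in> I \<Longrightarrow> g \<in> G \<Longrightarrow> f * g \<in> I"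
begin

lemma G_zero: "0 \<in> G" using I_zero I_sub by blast

lemma G_diff: "f \<in> G \<Longrightarrow> g \<in> G \<Longrightarrow> f - g \<in> G"
  using G_add[of f "- g"] G_minus by simp

lemma I_minus: "f \<in> I \<Longrightarrow> - f \<in> I"
  using I_left[of "- 1" f] G_minus[OF G_one] by simp

lemma I_diff: "f \<in> I \<Longrightarrow> g \<in> I \<Longrightarrow> f - g \<in> I"
  using I_add[of f "- g"] I_minus by simp

lemmas G_intros = G_zero G_one G_add G_minus G_diff G_mult

text \<open>Membership in \<open>G\<close> is part of the relation, so that a chain of congruences carries the closure
  conditions with it.\<close>
definition cong (infix \<open>\<approx>\<close> 50) where
  "f \<approx> g \<longleftrightarrow> f \<in> G \<and> g \<in> G \<and> f - g \<in> I"

lemma cong_in_G: "f \<approx> g \<Longrightarrow> f \<in> G" "f \<approx> g \<Longrightarrow> g \<in> G"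
  by (auto simp: cong_def)

lemma cong_refl: "f \<in> G \<Longrightarrow> f \<approx> f"
  by (simp add: cong_def I_zero)

lemma cong_sym: "f \<approx> g \<Longrightarrow> g \<approx> f"
  unfolding cong_def using I_minus by fastforce

lemma cong_trans [trans]: "f \<approx> g \<Longrightarrow> g \<approx> h \<Longrightarrow> f \<approx> h"
  unfolding cong_def using I_add[of "f - g" "g - h"] by auto

lemma cong_add: "f \<approx> f' \<Longrightarrow> g \<approx> g' \<Longrightarrow> f + g \<approx> f' + g'"
  unfolding cong_def using I_add[of "f - f'" "g - g'"]
  by (auto simp: algebra_simps intro: G_intros)

lemma cong_diff: "f \<approx> f' \<Longrightarrow> g \<approx> g' \<Longrightarrow> f - g \<approx> f' - g'"
  unfolding cong_def using I_diff[of "f - f'" "g - g'"]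
  by (auto simp: algebra_simps intro: G_intros)

lemma cong_minus: "f \<approx> f' \<Longrightarrow> - f \<approx> - f'"
  using cong_diff[of 0 0 f f'] by (simp add: cong_refl G_zero)

lemma cong_mult:
  assumes "f \<approx> f'" "g \<approx> g'" shows "f * g \<approx> f' * g'"
proof -
  have "f * g - f' * g' = (f - f') * g + f' * (g - g')" by (simp add: algebra_simps)
  moreover have "(f - f') * g + f' * (g - g') \<in> I"
    using assms unfolding cong_def by (intro I_add I_left I_right) auto
  ultimately show ?thesis using assms unfolding cong_def by (auto intro: G_mult)
qed

lemma cong_left: "h \<in> G \<Longrightarrow> f \<approx> g \<Longrightarrow> h * f \<approx> h * g"
  by (intro cong_mult cong_refl)

lemma cong_right: "h \<in> G \<Longrightarrow> f \<approx> g \<Longrightarrow> f * h \<approx> g * h"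
  by (intro cong_mult cong_refl)

lemma congI: "f \<in> G \<Longrightarrow> g \<in> G \<Longrightarrow> f - g = r \<Longrightarrow> r \<in> I \<Longrightarrow> f \<approx> g"
  by (simp add: cong_def)

lemma cong_zero_iff: "f \<approx> 0 \<longleftrightarrow> f \<in> I"
  unfolding cong_def using I_sub G_zero by auto

lemma cong_diff_zero_iff: "f \<in> G \<Longrightarrow> g \<in> G \<Longrightarrow> f - g \<approx> 0 \<longleftrightarrow> f \<approx> g"
  unfolding cong_def by (auto intro: G_intros)

definition central :: "'a \<Rightarrow> bool" where
  "central f \<longleftrightarrow> f \<in> G \<and> (\<forall>g\<in>G. f * g \<approx> g * f)"

lemma central_in_G: "central f \<Longrightarrow> f \<in> G" by (simp add: central_def)

lemma centralD: "central f \<Longrightarrow> g \<in> G \<Longrightarrow> f * g \<approx> g * f" by (simp add: central_def)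

lemma commute_add: "f * g \<approx> g * f \<Longrightarrow> f * h \<approx> h * f \<Longrightarrow> f * (g + h) \<approx> (g + h) * f"
  by (simp add: algebra_simps cong_add)

lemma commute_mult:
  assumes "f \<in> G" "g \<in> G" "h \<in> G" "f * g \<approx> g * f" "f * h \<approx> h * f"
  shows "f * (g * h) \<approx> (g * h) * f"
proof -
  have "f * (g * h) = (f * g) * h" by (simp add: mult.assoc)
  also have "\<dots> \<approx> (g * f) * h" using assms by (intro cong_right)
  also have "(g * f) * h = g * (f * h)" by (simp add: mult.assoc)
  also have "g * (f * h) \<approx> g * (h * f)" using assms by (intro cong_left)
  finally show ?thesis by (simp add: mult.assoc)
qed

lemma central_cong: "central f \<Longrightarrow> g \<approx> f \<Longrightarrow> central g"
  unfolding central_def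
  by (meson cong_in_G cong_left cong_right cong_sym cong_trans)

lemma central_add: "central f \<Longrightarrow> central g \<Longrightarrow> central (f + g)"
  unfolding central_def by (auto intro: G_intros simp: algebra_simps cong_add)

lemma central_minus: "central f \<Longrightarrow> central (- f)"
  unfolding central_def by (auto intro: G_intros simp: cong_minus)

lemma central_diff: "central f \<Longrightarrow> central g \<Longrightarrow> central (f - g)"
  using central_add[of f "- g"] central_minus by simp

lemma central_mult:
  assumes "central f" "central g" shows "central (f * g)"
  unfolding central_def
proof (intro conjI ballI)
  show "f * g \<in> G" using assms by (simp add: central_def G_mult)
  fix h assume h: "h \<in> G"
  have "h * (f * g) \<approx> (f * g) * h"
    using assms h by (intro commute_mult) (auto simp: central_def cong_sym)
  then show "(f * g) * h \<approx> h * (f * g)" by (rule cong_sym)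
qed

end

section \<open>Two generators with quadratic relations\<close>

definition qrel :: "'a::ring_1 \<Rightarrow> 'a \<Rightarrow> 'a \<Rightarrow> 'a" where
  "qrel v A N = v * v - A * v + N"

context
  fixes s t A B N M :: "'a::ring_1"
  assumes comm: "\<And>g. g * A = A * g" "\<And>g. g * B = B * g" "\<And>g. g * N = N * g" "\<And>g. g * M = M * g"
begin

private lemma ac:
  "s * A = A * s" "t * A = A * t" "s * (A * h) = A * (s * h)" "t * (A * h) = A * (t * h)"
  "s * B = B * s" "t * B = B * t" "s * (B * h) = B * (s * h)" "t * (B * h) = B * (t * h)"
  "s * N = N * s" "t * N = N * t" "s * (N * h) = N * (s * h)" "t * (N * h) = N * (t * h)"
  "s * M = M * s" "t * M = M * t" "s * (M * h) = M * (s * h)" "t * (M * h) = M * (t * h)"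
  "B * A = A * B" "B * (A * h) = A * (B * h)"
  "N * A = A * N" "N * (A * h) = A * (N * h)"
  "N * B = B * N" "N * (B * h) = B * (N * h)"
  "M * A = A * M" "M * (A * h) = A * (M * h)"
  "M * B = B * M" "M * (B * h) = B * (M * h)"
  "M * N = N * M" "M * (N * h) = N * (M * h)"
  by (metis comm mult.assoc)+

text \<open>The identities below are exact. Their right-hand sides are combinations of the quadratic
  relations of \<open>s\<close> and \<open>t\<close>, hence vanish in the Hecke algebra. With \<open>s' = A - s\<close> and \<open>t' = B - t\<close>,
  which are \<open>N/s\<close> and \<open>M/t\<close> there, the element \<open>\<theta>\<close> is \<open>st + t's'\<close>, the trace of \<open>st\<close> over the
  center.\<close>
lemma theta_commutes_s:
  fixes \<theta> defines "\<theta> \<equiv> s * t + t * s - A * t - B * s + A * B"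
  shows "s * \<theta> - \<theta> * s = qrel s A N * t - t * qrel s A N"
  unfolding \<theta>_def qrel_def by (simp add: algebra_simps ac mult_2)

text \<open>The characteristic equation of \<open>st\<close>, which has trace \<open>\<theta>\<close> and norm \<open>NM\<close>.\<close>
lemma theta_square:
  fixes \<theta> defines "\<theta> \<equiv> s * t + t * s - A * t - B * s + A * B"
  shows "(s * t) * (s * t) - \<theta> * (s * t) + N * M
    = - (t * qrel s A N * t) + B * qrel s A N * t + N * qrel t B M"
  unfolding \<theta>_def qrel_def by (simp add: algebra_simps ac mult_2)

text \<open>The square of the commutator is central; in a representation of degree \<open>2\<close> it is minus its
  determinant, which vanishes when \<open>s\<close> and \<open>t\<close> have a common eigenvector.\<close>
lemma eta_square:
  fixes \<theta> defines "\<theta> \<equiv> s * t + t * s - A * t - B * s + A * B"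
  shows "(t * s - s * t) * (t * s - s * t)
      - (\<theta> * \<theta> - A * B * \<theta> + A * A * M + B * B * N - 2 * (N * M) - 2 * (N * M))
    = (- (t * qrel s A N * t) + B * qrel s A N * t + N * qrel t B M)
    + (- (s * qrel t B M * s) + A * qrel t B M * s + M * qrel s A N)
    - s * qrel t B M * s - t * qrel s A N * t - B * B * qrel s A N + B * qrel s A N * t
    + M * qrel s A N - A * A * qrel t B M + A * qrel t B M * s + N * qrel t B M
    - A * (qrel t B M * s - s * qrel t B M) - B * (qrel s A N * t - t * qrel s A N)"
  unfolding \<theta>_def qrel_def by (simp add: algebra_simps ac mult_2)

end

section \<open>Polynomials over a subring\<close>

definition poly_over :: "'f::comm_ring_1 set \<Rightarrow> 'f poly set" where
  "poly_over R = {h. \<forall>i. poly.coeff h i \<in> R}"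

definition subring_set :: "'f::comm_ring_1 set \<Rightarrow> bool" where
  "subring_set R \<longleftrightarrow> 1 \<in> R \<and> (\<forall>r\<in>R. - r \<in> R) \<and>
     (\<forall>r\<in>R. \<forall>r'\<in>R. r + r' \<in> R \<and> r * r' \<in> R)"

lemma subring_setD:
  assumes "subring_set R"
  shows "1 \<in> R" "0 \<in> R" "r \<in> R \<Longrightarrow> - r \<in> R" "r \<in> R \<Longrightarrow> r' \<in> R \<Longrightarrow> r + r' \<in> R"
    "r \<in> R \<Longrightarrow> r' \<in> R \<Longrightarrow> r * r' \<in> R" "r \<in> R \<Longrightarrow> r' \<in> R \<Longrightarrow> r - r' \<in> R"
proof -
  show one: "1 \<in> R" using assms by (simp add: subring_set_def)
  show neg: "r \<in> R \<Longrightarrow> - r \<in> R" for r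
    using assms by (simp add: subring_set_def)
  show add: "r \<in> R \<Longrightarrow> r' \<in> R \<Longrightarrow> r + r' \<in> R"
    and "r \<in> R \<Longrightarrow> r' \<in> R \<Longrightarrow> r * r' \<in> R" for r r'
    using assms by (auto simp: subring_set_def)
  show "0 \<in> R" using add[OF one neg[OF one]] by simp
  show "r \<in> R \<Longrightarrow> r' \<in> R \<Longrightarrow> r - r' \<in> R" using add[of r "- r'"] neg[of r'] by simp
qed

lemma subring_set_sum:
  "subring_set R \<Longrightarrow> (\<And>i. i \<in> J \<Longrightarrow> p i \<in> R) \<Longrightarrow> sum p J \<in> R"
  by (induction J rule: infinite_finite_induct) (auto simp: subring_setD)

lemma subring_set_power: "subring_set R \<Longrightarrow> r \<in> R \<Longrightarrow> r ^ n \<in> R"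
  by (induction n) (auto simp: subring_setD)

lemma poly_over_pCons [simp]:
  "pCons r h \<in> poly_over R \<longleftrightarrow> r \<in> R \<and> h \<in> poly_over R"
  unfolding poly_over_def by (auto simp: coeff_pCons split: nat.splits)

lemma subring_set_poly_over:
  assumes "subring_set R" shows "subring_set (poly_over R)"
  unfolding subring_set_def poly_over_def using assms
  by (auto simp: coeff_mult subring_setD one_poly.rep_eq one_pCons coeff_pCons
      intro!: subring_set_sum split: nat.splits)

lemma poly_over_0 [simp]: "subring_set R \<Longrightarrow> 0 \<in> poly_over R"
  by (simp add: subring_setD subring_set_poly_over)

definition linear_factors :: "'f::comm_ring_1 list \<Rightarrow> 'f poly" where
  "linear_factors rs = prod_list (map (\<lambda>r. [:- r, 1:]) rs)"

lemma linear_factors_over: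
  assumes R: "subring_set R" shows "set rs \<subseteq> R \<Longrightarrow> linear_factors rs \<in> poly_over R"
  using subring_set_poly_over[OF R] R
  by (induction rs) (auto simp: linear_factors_def subring_setD one_pCons simp del: mult_pCons_left)

lemma linear_factors_append: "linear_factors (rs @ rs') = linear_factors rs * linear_factors rs'"
  by (simp add: linear_factors_def)

lemma linear_factors_partition:
  "linear_factors (filter P rs) * linear_factors (filter (\<lambda>r. \<not> P r) rs) = linear_factors rs"
  by (induction rs) (auto simp: linear_factors_def algebra_simps simp del: mult_pCons_left)

lemma poly_linear_factors_root: "r \<in> set rs \<Longrightarrow> poly (linear_factors rs) r = 0"
  by (induction rs) (auto simp: linear_factors_def simp del: mult_pCons_left)

definition comaximal :: "'f::comm_ring_1 set \<Rightarrow> 'f poly \<Rightarrow> 'f poly \<Rightarrow> bool" where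
  "comaximal R f g \<longleftrightarrow> (\<exists>p\<in>poly_over R. \<exists>q\<in>poly_over R. p * f + q * g = 1)"

lemma comaximal_one: "subring_set R \<Longrightarrow> comaximal R f 1"
  unfolding comaximal_def
  by (rule bexI[of _ 0], rule bexI[of _ 1]) (auto simp: subring_setD(1)[OF subring_set_poly_over])

lemma comaximal_sym: "comaximal R f g \<Longrightarrow> comaximal R g f"
  unfolding comaximal_def by (metis add.commute)

lemma comaximal_mult:
  assumes R: "subring_set R" and over: "f \<in> poly_over R" "g \<in> poly_over R" "g' \<in> poly_over R"
    and "comaximal R f g" "comaximal R f g'"
  shows "comaximal R f (g * g')"
proof -
  obtain p q p' q' where pq: "p \<in> poly_over R" "q \<in> poly_over R" "p' \<in> poly_over R" "q' \<in> poly_over R"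
    "p * f + q * g = 1" "p' * f + q' * g' = 1"
    using assms unfolding comaximal_def by blast
  have "(p * p' * f + p * q' * g' + q * g * p') * f + (q * q') * (g * g')
      = (p * f + q * g) * (p' * f + q' * g')" by (simp add: algebra_simps)
  then have "(p * p' * f + p * q' * g' + q * g * p') * f + (q * q') * (g * g') = 1"
    by (simp add: pq)
  moreover have "p * p' * f + p * q' * g' + q * g * p' \<in> poly_over R" "q * q' \<in> poly_over R"
    using pq over by (simp_all add: subring_setD subring_set_poly_over[OF R])
  ultimately show ?thesis unfolding comaximal_def by blast
qed

lemma comaximal_linear:
  fixes r r' :: "'f::field"
  assumes "subring_set R" "r \<noteq> r'" "inverse (r - r') \<in> R"
  shows "comaximal R [:- r, 1:] [:- r', 1:]"
  unfolding comaximal_def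
proof (intro bexI)
  have "r * inverse (r - r') - r' * inverse (r - r') = 1"
    using assms(2) by (simp add: left_diff_distrib[symmetric])
  then show "[:- inverse (r - r'):] * [:- r, 1:] + [:inverse (r - r'):] * [:- r', 1:] = 1"
    by (simp add: one_pCons mult.commute)
qed (use assms in \<open>simp_all add: subring_setD\<close>)

text \<open>Comaximality is multiplicative in either argument, so that it reduces to pairs of linear
  factors, where it means that the difference of the roots is a unit.\<close>
lemma comaximal_linear_factors:
  fixes rs rs' :: "'f::field list"
  assumes R: "subring_set R" "set rs \<subseteq> R" "set rs' \<subseteq> R"
    and d: "\<And>r r'. r \<in> set rs \<Longrightarrow> r' \<in> set rs' \<Longrightarrow> r \<noteq> r' \<and> inverse (r - r') \<in> R"
  shows "comaximal R (linear_factors rs) (linear_factors rs')"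
proof -
  have 1: "comaximal R [:- r, 1:] (linear_factors rs')" if "r \<in> set rs" "r \<in> R" for r
    using R(3) d[OF that(1)]
  proof (induction rs')
    case Nil
    then show ?case by (simp add: linear_factors_def comaximal_one R)
  next
    case (Cons r' rs')
    have "comaximal R [:- r, 1:] ([:- r', 1:] * linear_factors rs')"
      using Cons R that
      by (intro comaximal_mult comaximal_linear linear_factors_over) (auto simp: subring_setD)
    then show ?case by (simp add: linear_factors_def del: mult_pCons_left)
  qed
  show ?thesis using R(2) 1
  proof (induction rs)
    case Nil
    then show ?case by (simp add: linear_factors_def comaximal_one comaximal_sym R)
  next
    case (Cons r rs)
    have "comaximal R (linear_factors rs') ([:- r, 1:] * linear_factors rs)"
      using Cons R
      by (intro comaximal_mult linear_factors_over comaximal_sym[of R "[:- r, 1:]"]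
          comaximal_sym[of R "linear_factors rs"]) (auto simp: subring_setD)
    then show ?case by (simp add: linear_factors_def comaximal_sym del: mult_pCons_left)
  qed
qed

text \<open>The Chinese remainder theorem: \<open>h\<close> is the idempotent modulo \<open>linear_factors rs\<close> that selects
  the roots satisfying \<open>P\<close>.\<close>
lemma separating_polynomial:
  fixes rs :: "'f::field list"
  assumes R: "subring_set R" "set rs \<subseteq> R"
    and d: "\<And>r r'. r \<in> set rs \<Longrightarrow> r' \<in> set rs \<Longrightarrow> P r \<Longrightarrow> \<not> P r' \<Longrightarrow> r \<noteq> r' \<and> inverse (r - r') \<in> R"
  obtains h g where "h \<in> poly_over R" "g \<in> poly_over R" "h * h - h = g * linear_factors rs"
    "\<And>r. r \<in> set rs \<Longrightarrow> poly h r = of_bool (P r)"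
proof -
  define f where "f = linear_factors (filter P rs)"
  define f' where "f' = linear_factors (filter (\<lambda>r. \<not> P r) rs)"
  have fR: "f \<in> poly_over R" "f' \<in> poly_over R"
    unfolding f_def f'_def using R by (auto intro!: linear_factors_over)
  have "comaximal R f f'"
    unfolding f_def f'_def using R d by (intro comaximal_linear_factors) auto
  then obtain p q where pq: "p \<in> poly_over R" "q \<in> poly_over R" "p * f + q * f' = 1"
    unfolding comaximal_def by blast
  define h where "h = q * f'"
  have h1: "h = 1 - p * f" using pq(3) by (simp add: h_def algebra_simps)
  have "h * h - h = (q * f') * (h - 1)" by (simp add: h_def algebra_simps)
  also have "\<dots> = - (q * p) * (f * f')" by (simp add: h1 algebra_simps)
  also have "f * f' = linear_factors rs" unfolding f_def f'_def by (rule linear_factors_partition)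
  finally have e: "h * h - h = - (q * p) * linear_factors rs" .
  have over: "h \<in> poly_over R" "- (q * p) \<in> poly_over R"
    using pq fR by (simp_all add: h_def subring_setD subring_set_poly_over[OF R(1)])
  have "poly h r = of_bool (P r)" if "r \<in> set rs" for r
  proof (cases "P r")
    case True
    then have "poly f r = 0" unfolding f_def using that by (intro poly_linear_factors_root) auto
    then show ?thesis using True by (simp add: h1)
  next
    case False
    then have "poly f' r = 0" unfolding f'_def using that by (intro poly_linear_factors_root) auto
    then show ?thesis using False by (simp add: h_def)
  qed
  then show thesis using that over e by blast
qed

section \<open>Central elements of the Hecke algebra\<close>

text \<open>Here \<open>G\<close> stands for the free algebra over \<open>R\<close> on \<open>s, t, u\<close>, the map \<open>k\<close> embeds the scalars, and \<open>I\<close> contains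
  the defining relations. All parameters are units of \<open>R\<close>.\<close>
locale hecke_congruence = ideal_congruence G I for G I :: "'a::ring_1 set" +
  fixes R :: "'f::field set" and k :: "'f \<Rightarrow> 'a" and s t u :: 'a
    and x0 x1 y0 y1 :: 'f and zs :: "'f list"
  assumes R: "subring_set R"
    and k_one: "k 1 = 1" and k_add: "\<And>r r'. k (r + r') = k r + k r'"
    and k_mult: "\<And>r r'. k (r * r') = k r * k r'"
    and k_comm: "\<And>r g. g * k r = k r * g"
    and k_G: "\<And>r. r \<in> R \<Longrightarrow> k r \<in> G"
    and gens_G: "s \<in> G" "t \<in> G" "u \<in> G"
    and G_generated: "\<And>S. k ` R \<subseteq> S \<Longrightarrow> s \<in> S \<Longrightarrow> t \<in> S \<Longrightarrow> u \<in> S \<Longrightarrow>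
      (\<And>f g. f \<in> S \<Longrightarrow> g \<in> S \<Longrightarrow> f + g \<in> S) \<Longrightarrow> (\<And>f g. f \<in> S \<Longrightarrow> g \<in> S \<Longrightarrow> f * g \<in> S) \<Longrightarrow>
      G \<subseteq> S"
    and params_R: "x0 \<in> R" "x1 \<in> R" "y0 \<in> R" "y1 \<in> R" "set zs \<subseteq> R"
    and params_inv: "inverse x0 \<in> R" "inverse x1 \<in> R" "inverse y0 \<in> R" "inverse y1 \<in> R"
      "inverse ` set zs \<subseteq> R"
    and params_nz: "x0 \<noteq> 0" "x1 \<noteq> 0" "y0 \<noteq> 0" "y1 \<noteq> 0" "0 \<notin> set zs"
    and rel_braid: "s * t * u - t * u * s \<in> I" "t * u * s - u * s * t \<in> I"
    and rel_s: "(s - k x0) * (s - k x1) \<in> I"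
    and rel_t: "(t - k y0) * (t - k y1) \<in> I"
    and rel_u: "prod_list (map (\<lambda>r. u - k r) zs) \<in> I"
begin

lemma k_0: "k 0 = 0" using k_add[of 0 0] by simp
lemma k_minus: "k (- r) = - k r" using k_add[of r "- r"] k_0 by (simp add: add_eq_0_iff2)
lemma k_diff: "k (r - r') = k r - k r'" using k_add[of r "- r'"] k_minus by simp

lemma central_k: "r \<in> R \<Longrightarrow> central (k r)"
  unfolding central_def
proof (intro conjI ballI k_G)
  fix g assume "r \<in> R" "g \<in> G"
  then have "k r * g \<approx> k r * g" by (intro cong_refl G_mult k_G)
  then show "k r * g \<approx> g * k r" by (simp only: k_comm[of g r])
qed

lemma centralI:
  assumes f: "f \<in> G" and c: "f * s \<approx> s * f" "f * t \<approx> t * f" "f * u \<approx> u * f"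
  shows "central f"
proof -
  have "G \<subseteq> {g \<in> G. f * g \<approx> g * f}"
  proof (rule G_generated)
    show "k ` R \<subseteq> {g \<in> G. f * g \<approx> g * f}"
      using f by (auto simp: k_comm[of f] k_G G_mult intro!: cong_refl)
  qed (use assms gens_G in \<open>auto simp: commute_add commute_mult G_add G_mult\<close>)
  then show ?thesis using f by (auto simp: central_def)
qed

text \<open>The algebra generated by \<open>s\<close> and \<open>t\<close> is a Hecke algebra of the infinite dihedral group, and
  \<open>theta\<close> is its Bernstein element \<open>X + det_st / X\<close>; thus \<open>theta - X\<close> stands for \<open>det_st / X\<close>. As
  \<open>u = w / X\<close>, the element \<open>ubar\<close> arises from \<open>u\<close> by exchanging \<open>X\<close> and \<open>det_st / X\<close>, and in a
  representation of degree \<open>2\<close> it is the adjugate of \<open>u\<close>.\<close>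
abbreviation A where "A \<equiv> k (x0 + x1)"
abbreviation B where "B \<equiv> k (y0 + y1)"
abbreviation N where "N \<equiv> k (x0 * x1)"
abbreviation M where "M \<equiv> k (y0 * y1)"
abbreviation X where "X \<equiv> s * t"
abbreviation w where "w \<equiv> s * t * u"
definition "theta = s * t + t * s - A * t - B * s + A * B"

definition det_st where "det_st = x0 * x1 * (y0 * y1)"
definition ubar where "ubar = k (inverse det_st) * X * w"
definition tau where "tau = u + ubar"
definition omega where "omega = k (inverse det_st) * w * w"

lemma det_st_inv: "inverse det_st \<in> R" "det_st \<in> R" "det_st \<noteq> 0"
  using params_R params_inv params_nz R by (auto simp: det_st_def subring_setD)

lemma scalars_R: "x0 + x1 \<in> R" "y0 + y1 \<in> R" "x0 * x1 \<in> R" "y0 * y1 \<in> R"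
  using params_R R by (auto simp: subring_setD)

lemma theta_G: "theta \<in> G"
  unfolding theta_def by (intro G_intros gens_G k_G scalars_R)
lemma X_G: "X \<in> G" and w_G: "w \<in> G" by (intro G_mult gens_G)+
lemma ubar_G: "ubar \<in> G" unfolding ubar_def by (intro G_mult k_G det_st_inv gens_G)
lemma tau_G: "tau \<in> G" unfolding tau_def by (intro G_add ubar_G gens_G)
lemmas elems_G = theta_G X_G w_G ubar_G tau_G gens_G scalars_R

lemma qrel_s: "qrel s A N \<in> I"
proof -
  have "qrel s A N = (s - k x0) * (s - k x1)"
    unfolding qrel_def by (simp add: k_add k_mult algebra_simps k_comm[of s])
  then show ?thesis using rel_s by simp
qed

lemma qrel_t: "qrel t B M \<in> I"
proof -
  have "qrel t B M = (t - k y0) * (t - k y1)"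
    unfolding qrel_def by (simp add: k_add k_mult algebra_simps k_comm[of t])
  then show ?thesis using rel_t by simp
qed

lemmas qrel_I = I_right[OF I_left[OF _ qrel_s]] I_right[OF I_left[OF _ qrel_t]]
  I_right[OF qrel_s] I_right[OF qrel_t] I_left[OF _ qrel_s] I_left[OF _ qrel_t]

lemma braid_cong: "t * u * s \<approx> w" "u * s * t \<approx> w" "t * u * s \<approx> u * s * t"
proof -
  show 1: "t * u * s \<approx> w"
    by (rule cong_sym) (use rel_braid in \<open>auto simp: cong_def intro!: G_mult gens_G\<close>)
  show 2: "t * u * s \<approx> u * s * t"
    using rel_braid by (auto simp: cong_def intro!: G_mult gens_G)
  show "u * s * t \<approx> w" using 1 2 cong_sym cong_trans by blast
qed

lemma central_w: "central w"
proof (rule centralI)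
  have "w * s = s * (t * u * s)" by (simp add: mult.assoc)
  also have "\<dots> \<approx> s * w" by (intro cong_left braid_cong gens_G)
  finally show "w * s \<approx> s * w" .
  have "t * w \<approx> t * (u * s * t)" by (intro cong_left gens_G cong_sym[OF braid_cong(2)])
  also have "\<dots> = (t * u * s) * t" by (simp add: mult.assoc)
  also have "\<dots> \<approx> w * t" by (intro cong_right gens_G braid_cong)
  finally show "w * t \<approx> t * w" by (rule cong_sym)
  have "w * u \<approx> (u * s * t) * u" by (intro cong_right gens_G cong_sym[OF braid_cong(2)])
  also have "\<dots> = u * w" by (simp add: mult.assoc)
  finally show "w * u \<approx> u * w" .
qed (rule w_G)

lemma theta_s: "s * theta \<approx> theta * s"
  by (rule congI[OF _ _ theta_commutes_s[where s = s and t = t and A = A and B = B and N = N and M = M, OF k_comm k_comm k_comm k_comm, folded theta_def]])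
    (intro I_diff qrel_I G_mult elems_G)+

text \<open>The definition of \<open>theta\<close> is symmetric under exchanging \<open>s\<close> and \<open>t\<close>.\<close>
lemma theta_t: "t * theta \<approx> theta * t"
proof -
  have "theta = t * s + s * t - B * s - A * t + B * A"
    unfolding theta_def by (simp add: k_comm[of A] algebra_simps)
  then have "t * theta - theta * t = qrel t B M * s - s * qrel t B M"
    using theta_commutes_s[where s = t and t = s and A = B and B = A and N = M and M = N, OF k_comm k_comm k_comm k_comm] by simp
  then show ?thesis by (rule congI[rotated 2]) (intro I_diff qrel_I G_mult elems_G)+
qed

lemma X_square: "X * X \<approx> theta * X - k det_st"
proof (rule congI)
  show "X * X - (theta * X - k det_st) = - (t * qrel s A N * t) + B * qrel s A N * t + N * qrel t B M"
    using theta_square[where s = s and t = t and A = A and B = B and N = N and M = M, OF k_comm k_comm k_comm k_comm, folded theta_def]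
    by (simp add: det_st_def k_mult[of "x0 * x1"] diff_diff_eq2 diff_add_eq)
  show "- (t * qrel s A N * t) + B * qrel s A N * t + N * qrel t B M \<in> I"
    by (intro I_add I_minus qrel_I k_G gens_G scalars_R)
qed (intro G_intros elems_G k_G det_st_inv)+

lemma X_theta: "X * theta \<approx> theta * X"
  using commute_mult[of theta s t] theta_s theta_t elems_G by (meson cong_sym)

lemma Xbar_X: "(theta - X) * X \<approx> k det_st"
proof -
  have "(theta - X) * X = theta * X - X * X" by (simp add: algebra_simps)
  also have "\<dots> \<approx> theta * X - (theta * X - k det_st)"
    by (intro cong_diff X_square cong_refl G_intros elems_G)
  finally show ?thesis by simp
qed

lemma u_eq: "u \<approx> k (inverse det_st) * (theta - X) * w"
proof -
  have "k (inverse det_st) * (theta - X) * w = k (inverse det_st) * ((theta - X) * X) * u"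
    by (simp add: mult.assoc)
  also have "\<dots> \<approx> k (inverse det_st) * k det_st * u"
    by (intro cong_right cong_left Xbar_X k_G det_st_inv gens_G)
  also have "\<dots> = u" using det_st_inv by (simp add: k_mult[symmetric] k_one)
  finally show ?thesis by (rule cong_sym)
qed

text \<open>It remains to commute with \<open>u\<close>, which is a polynomial in \<open>theta\<close>, \<open>X\<close> and \<open>w\<close>.\<close>
lemma central_theta: "central theta"
proof (rule centralI)
  have *: "theta * (k (inverse det_st) * (theta - X) * w) \<approx> (k (inverse det_st) * (theta - X) * w) * theta"
  proof (rule commute_mult[OF _ _ _ commute_mult])
    show "theta * k (inverse det_st) \<approx> k (inverse det_st) * theta"
      by (simp add: k_comm[of theta] cong_refl G_mult theta_G k_G det_st_inv)
    have "theta * (theta - X) = theta * theta - theta * X" by (simp add: algebra_simps)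
    also have "\<dots> \<approx> theta * theta - X * theta"
      by (intro cong_diff cong_refl cong_sym[OF X_theta] G_mult theta_G)
    finally show "theta * (theta - X) \<approx> (theta - X) * theta" by (simp add: algebra_simps)
    show "theta * w \<approx> w * theta" by (rule cong_sym[OF centralD[OF central_w theta_G]])
  qed (intro G_intros elems_G k_G det_st_inv)+
  have "theta * u \<approx> theta * (k (inverse det_st) * (theta - X) * w)" by (intro cong_left u_eq theta_G)
  also note *
  also have "(k (inverse det_st) * (theta - X) * w) * theta \<approx> u * theta"
    by (intro cong_right theta_G cong_sym[OF u_eq])
  finally show "theta * u \<approx> u * theta" .
qed (use theta_s theta_t theta_G cong_sym in auto)

lemma tau_eq: "tau \<approx> k (inverse det_st) * theta * w"
proof -
  have "tau \<approx> k (inverse det_st) * (theta - X) * w + k (inverse det_st) * X * w"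
    unfolding tau_def ubar_def by (intro cong_add u_eq cong_refl G_mult k_G det_st_inv gens_G)
  then show ?thesis by (simp add: algebra_simps)
qed

lemma central_tau: "central tau"
  by (rule central_cong[OF _ tau_eq]) (intro central_mult central_k det_st_inv central_theta central_w)

lemma central_omega: "central omega"
  unfolding omega_def by (intro central_mult central_k det_st_inv central_w)

lemma ubar_u: "ubar * u \<approx> omega"
proof -
  have "ubar * u = k (inverse det_st) * X * (w * u)" by (simp add: ubar_def mult.assoc)
  also have "\<dots> \<approx> k (inverse det_st) * X * (u * w)"
    by (intro cong_left centralD central_w G_mult k_G det_st_inv gens_G)
  also have "\<dots> = omega" by (simp add: omega_def mult.assoc)
  finally show ?thesis .
qed

lemma u_ubar: "u * ubar \<approx> omega"
proof -
  have "u * ubar = k (inverse det_st) * (u * s * t) * w"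
    by (simp add: ubar_def k_comm[of u] mult.assoc[symmetric])
  also have "\<dots> \<approx> k (inverse det_st) * w * w"
    by (intro cong_left cong_right braid_cong k_G det_st_inv w_G)
  finally show ?thesis by (simp add: omega_def)
qed

lemma u_ubar_commute: "u * ubar \<approx> ubar * u"
  using u_ubar ubar_u cong_sym cong_trans by blast

lemma u_square: "u * u \<approx> tau * u - omega"
proof -
  have "u * u = tau * u - ubar * u" by (simp add: tau_def algebra_simps)
  also have "\<dots> \<approx> tau * u - omega" by (intro cong_diff cong_refl ubar_u G_mult elems_G)
  finally show ?thesis .
qed

lemma ubar_square: "ubar * ubar \<approx> tau * ubar - omega"
proof -
  have "ubar * ubar = tau * ubar - u * ubar" by (simp add: tau_def algebra_simps)
  also have "\<dots> \<approx> tau * ubar - omega" by (intro cong_diff cong_refl u_ubar G_mult elems_G)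
  finally show ?thesis .
qed

end

section \<open>Polynomials in a conjugate pair\<close>

context hecke_congruence begin

definition ev :: "'f poly \<Rightarrow> 'a \<Rightarrow> 'a" where
  "ev h v = (\<Sum>i\<le>Polynomial.degree h. v ^ i * k (poly.coeff h i))"

lemma ev_0 [simp]: "ev 0 v = 0" by (simp add: ev_def k_0)

lemma ev_pCons [simp]: "ev (pCons r h) v = k r + v * ev h v"
proof (cases "h = 0")
  case False
  then show ?thesis
    by (simp add: ev_def sum.atMost_Suc_shift sum_distrib_left mult.assoc del: sum.atMost_Suc)
qed (simp add: ev_def k_0)

lemma ev_1 [simp]: "ev 1 v = 1" by (simp add: one_pCons k_one)

lemma ev_add: "ev (h + h') v = ev h v + ev h' v"
proof (induction h arbitrary: h')
  case (pCons r h)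
  then show ?case by (cases h') (simp add: k_add algebra_simps)
qed simp

lemma ev_smult: "ev (Polynomial.smult r h) v = k r * ev h v"
  by (induction h) (simp_all add: k_mult algebra_simps, simp add: mult.assoc[symmetric] k_comm[of v], rule k_comm)

lemma ev_mult: "ev (h * h') v = ev h v * ev h' v"
  by (induction h) (simp_all add: ev_add ev_smult k_0 algebra_simps)

lemma ev_diff: "ev (h - h') v = ev h v - ev h' v"
  using ev_add[of "h - h'" h' v] by (simp add: algebra_simps)

lemma ev_linear_factors:
  "ev (prod_list (map (\<lambda>r. [:- r, 1:]) rs)) v = prod_list (map (\<lambda>r. v - k r) rs)"
  by (induction rs) (simp_all add: ev_mult k_minus k_one k_0 del: mult_pCons_left)

lemma ev_G: "h \<in> poly_over R \<Longrightarrow> v \<in> G \<Longrightarrow> ev h v \<in> G"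
  by (induction h) (auto intro!: G_intros k_G)

lemma commute_ev:
  assumes "h \<in> poly_over R" "f \<in> G" "v \<in> G" "f * v \<approx> v * f"
  shows "f * ev h v \<approx> ev h v * f"
  using assms(1)
proof (induction h)
  case (pCons r h)
  have "f * k r \<approx> k r * f"
    using pCons.prems assms by (simp add: k_comm[of f] cong_refl G_mult k_G)
  then show ?case using pCons assms
    by (auto intro!: commute_add commute_mult ev_G)
qed (simp add: cong_refl G_zero)

text \<open>One step of Horner's scheme, reduced by the quadratic equation that \<open>u\<close> and \<open>ubar\<close> share.\<close>
lemma horner_step:
  assumes v: "v \<in> G" "v * v \<approx> tau * v - omega" and c: "central \<alpha>" "central \<beta>"
    and g: "g \<approx> \<alpha> + \<beta> * v"
  shows "v * g \<approx> - (\<beta> * omega) + (\<alpha> + \<beta> * tau) * v"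
proof -
  note cs = central_in_G[OF c(1)] central_in_G[OF c(2)] central_in_G[OF central_omega] tau_G
  have "v * g \<approx> v * (\<alpha> + \<beta> * v)" using v g by (intro cong_left)
  also have "\<dots> = v * \<alpha> + (v * \<beta>) * v" by (simp add: algebra_simps)
  also have "\<dots> \<approx> \<alpha> * v + (\<beta> * v) * v"
    using c v by (intro cong_add cong_right cong_sym[OF centralD])
  also have "\<dots> = \<alpha> * v + \<beta> * (v * v)" by (simp add: mult.assoc)
  also have "\<dots> \<approx> \<alpha> * v + \<beta> * (tau * v - omega)"
    using v cs by (intro cong_add cong_left cong_refl G_mult)
  also have "\<dots> = - (\<beta> * omega) + (\<alpha> + \<beta> * tau) * v" by (simp add: algebra_simps)
  finally show ?thesis .
qed

text \<open>The remainder of \<open>h\<close> modulo \<open>U\<^sup>2 - tau U + omega\<close>. The same \<open>\<alpha>, \<beta>\<close> serve \<open>u\<close> and \<open>ubar\<close>, because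
  both are roots. The relation \<open>val\<close> is meant for the scalars by which elements act in a
  representation; if \<open>tau\<close> and \<open>omega\<close> have the values \<open>z + z'\<close> and \<open>zz'\<close>, then the remainder has
  values which compute \<open>h(z)\<close> and \<open>h(z')\<close>.\<close>
lemma conjugate_values:
  fixes val :: "'a \<Rightarrow> 'f \<Rightarrow> bool"
  assumes h: "h \<in> poly_over R"
    and val_k: "\<And>r. r \<in> R \<Longrightarrow> val (k r) r"
    and val_add: "\<And>f g a b. f \<in> G \<Longrightarrow> g \<in> G \<Longrightarrow> val f a \<Longrightarrow> val g b \<Longrightarrow> val (f + g) (a + b)"
    and val_mult: "\<And>f g a b. f \<in> G \<Longrightarrow> g \<in> G \<Longrightarrow> val f a \<Longrightarrow> val g b \<Longrightarrow> val (f * g) (a * b)"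
    and val_tau: "val tau (z + z')" and val_omega: "val omega (z * z')"
  shows "\<exists>\<alpha> \<beta> a b. central \<alpha> \<and> central \<beta> \<and> val \<alpha> a \<and> val \<beta> b \<and>
    ev h u \<approx> \<alpha> + \<beta> * u \<and> ev h ubar \<approx> \<alpha> + \<beta> * ubar \<and>
    poly h z = a + b * z \<and> poly h z' = a + b * z'"
  using h
proof (induction h)
  case 0
  have "central 0" "val 0 0" using central_k[of 0] val_k[of 0] R by (auto simp: k_0 subring_setD)
  then show ?case
    by (intro exI[of _ 0]) (simp add: cong_refl G_zero)
next
  case (pCons r h)
  then obtain \<alpha> \<beta> a b where IH: "central \<alpha>" "central \<beta>" "val \<alpha> a" "val \<beta> b"
    "ev h u \<approx> \<alpha> + \<beta> * u" "ev h ubar \<approx> \<alpha> + \<beta> * ubar"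
    "poly h z = a + b * z" "poly h z' = a + b * z'" by auto
  have r: "r \<in> R" using pCons.prems by simp
  have m1: "- 1 \<in> R" using R by (simp add: subring_setD)
  define \<alpha>' where "\<alpha>' = k r + k (- 1) * (\<beta> * omega)"
  define \<beta>' where "\<beta>' = \<alpha> + \<beta> * tau"
  have c: "central \<alpha>'" "central \<beta>'"
    unfolding \<alpha>'_def \<beta>'_def
    by (intro central_add central_mult central_k r m1 IH central_omega central_tau)+
  have v: "val \<alpha>' (r + - 1 * (b * (z * z')))" "val \<beta>' (a + b * (z + z'))"
    unfolding \<alpha>'_def \<beta>'_def
    by (intro val_add val_mult val_k r m1 IH val_omega val_tau central_in_G central_mult
        central_k central_omega central_tau)+
  have e: "ev (pCons r h) v \<approx> \<alpha>' + \<beta>' * v"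
    if "v \<in> G" "v * v \<approx> tau * v - omega" "ev h v \<approx> \<alpha> + \<beta> * v" for v
  proof -
    have "k r + v * ev h v \<approx> k r + (- (\<beta> * omega) + (\<alpha> + \<beta> * tau) * v)"
      using that IH r by (intro cong_add cong_refl k_G horner_step)
    then show ?thesis by (simp add: \<alpha>'_def \<beta>'_def k_minus k_one algebra_simps)
  qed
  have "ev (pCons r h) u \<approx> \<alpha>' + \<beta>' * u" "ev (pCons r h) ubar \<approx> \<alpha>' + \<beta>' * ubar"
    by (intro e elems_G u_square ubar_square IH)+
  moreover have "poly (pCons r h) z = (r + - 1 * (b * (z * z'))) + (a + b * (z + z')) * z"
    "poly (pCons r h) z' = (r + - 1 * (b * (z * z'))) + (a + b * (z + z')) * z'"
    by (simp_all add: IH algebra_simps)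
  ultimately show ?case using c v by blast
qed

text \<open>The norm \<open>(\<alpha> + \<beta>u)(\<alpha> + \<beta>ubar) = \<alpha>\<^sup>2 + \<alpha>\<beta> tau + \<beta>\<^sup>2 omega\<close> of \<open>h(u)\<close> involves only central
  elements.\<close>
lemma norm_value:
  fixes val :: "'a \<Rightarrow> 'f \<Rightarrow> bool"
  assumes h: "h \<in> poly_over R"
    and val_k: "\<And>r. r \<in> R \<Longrightarrow> val (k r) r"
    and val_add: "\<And>f g a b. f \<in> G \<Longrightarrow> g \<in> G \<Longrightarrow> val f a \<Longrightarrow> val g b \<Longrightarrow> val (f + g) (a + b)"
    and val_mult: "\<And>f g a b. f \<in> G \<Longrightarrow> g \<in> G \<Longrightarrow> val f a \<Longrightarrow> val g b \<Longrightarrow> val (f * g) (a * b)"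
    and val_tau: "val tau (z + z')" and val_omega: "val omega (z * z')"
  obtains c where "central c" "val c (poly h z * poly h z')" "ev h u * ev h ubar \<approx> c"
proof -
  obtain \<alpha> \<beta> a b where *: "central \<alpha>" "central \<beta>" "val \<alpha> a" "val \<beta> b"
    "ev h u \<approx> \<alpha> + \<beta> * u" "ev h ubar \<approx> \<alpha> + \<beta> * ubar"
    "poly h z = a + b * z" "poly h z' = a + b * z'"
    using conjugate_values[of h val, OF assms] by blast
  note G = central_in_G[OF *(1)] central_in_G[OF *(2)] central_in_G[OF central_omega] elems_G
  define c where "c = (\<alpha> * \<alpha> + \<alpha> * \<beta> * tau) + \<beta> * \<beta> * omega"
  have "central c" unfolding c_def by (intro central_add central_mult central_omega central_tau *)
  moreover have "val c ((a * a + a * b * (z + z')) + b * b * (z * z'))"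
    unfolding c_def
    by (intro val_add val_mult * val_omega val_tau G_add G_mult G)
  moreover have "(a * a + a * b * (z + z')) + b * b * (z * z') = poly h z * poly h z'"
    by (simp add: * algebra_simps)
  moreover have "ev h u * ev h ubar \<approx> c"
  proof -
    have "ev h u * ev h ubar \<approx> (\<alpha> + \<beta> * u) * (\<alpha> + \<beta> * ubar)" by (intro cong_mult *)
    also have "\<dots> = \<alpha> * \<alpha> + \<alpha> * \<beta> * ubar + (\<beta> * (u * \<alpha>) + \<beta> * (u * \<beta>) * ubar)"
      by (simp add: algebra_simps)
    also have "\<dots> \<approx> \<alpha> * \<alpha> + \<alpha> * \<beta> * ubar + (\<beta> * (\<alpha> * u) + \<beta> * (\<beta> * u) * ubar)"
      by (intro cong_add cong_refl cong_right cong_left cong_sym[OF centralD] * G_add G_mult G)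
    also have "\<dots> = \<alpha> * \<alpha> + \<alpha> * \<beta> * ubar + ((\<beta> * \<alpha>) * u + \<beta> * \<beta> * (u * ubar))"
      by (simp add: algebra_simps)
    also have "\<dots> \<approx> \<alpha> * \<alpha> + \<alpha> * \<beta> * ubar + ((\<alpha> * \<beta>) * u + \<beta> * \<beta> * omega)"
      by (intro cong_add cong_refl cong_right cong_left centralD u_ubar * G_add G_mult G)
    also have "\<dots> = c" by (simp add: c_def tau_def algebra_simps)
    finally show ?thesis .
  qed
  ultimately show thesis using that by metis
qed

section \<open>An equation for the conjugate of \<open>u\<close>\<close>

lemma u_equation: "ev (linear_factors zs) u \<approx> 0"
  using rel_u by (simp add: cong_zero_iff linear_factors_def ev_linear_factors)

text \<open>If \<open>g u = 0\<close>, then each factor \<open>u - z\<^sub>k\<close> of the equation of \<open>u\<close> multiplies \<open>g\<close> by the unit \<open>- z\<^sub>k\<close>.\<close>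
lemma u_cancel:
  assumes g: "g \<in> G" "g * u \<approx> 0" shows "g \<approx> 0"
proof -
  have "\<exists>e\<in>R. inverse e \<in> R \<and> e \<noteq> 0 \<and> g * prod_list (map (\<lambda>r. u - k r) rs) \<approx> k e * g"
    if "set rs \<subseteq> set zs" for rs
    using that
  proof (induction rs)
    case Nil
    then show ?case using R by (intro bexI[of _ 1]) (auto simp: subring_setD k_one cong_refl g)
  next
    case (Cons r rs)
    then obtain e where e: "e \<in> R" "inverse e \<in> R" "e \<noteq> 0"
      "g * prod_list (map (\<lambda>r. u - k r) rs) \<approx> k e * g" by auto
    have r: "r \<in> R" "inverse r \<in> R" "r \<noteq> 0"
      using Cons.prems params_R params_inv params_nz by auto
    have rsG: "prod_list (map (\<lambda>r. u - k r) rs) \<in> G"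
      using Cons.prems params_R by (induction rs) (auto intro!: G_intros k_G gens_G)
    have "g * prod_list (map (\<lambda>r. u - k r) (r # rs))
        = (g * u - k r * g) * prod_list (map (\<lambda>r. u - k r) rs)"
      by (simp add: mult.assoc[symmetric] right_diff_distrib k_comm[of g])
    also have "\<dots> \<approx> (0 - k r * g) * prod_list (map (\<lambda>r. u - k r) rs)"
      by (intro cong_right cong_diff g rsG cong_refl G_mult k_G r)
    also have "\<dots> = k (- r) * (g * prod_list (map (\<lambda>r. u - k r) rs))"
      by (simp add: k_minus mult.assoc)
    also have "\<dots> \<approx> k (- r) * (k e * g)"
      using R r e by (intro cong_left k_G) (auto simp: subring_setD)
    also have "\<dots> = k (- r * e) * g" by (simp add: k_mult[of "- r"] mult.assoc del: mult_minus_left)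
    finally show ?case using R r e
      by (intro bexI[of _ "- r * e"]) (auto simp: subring_setD)
  qed
  from this[of zs] obtain e where e: "e \<in> R" "inverse e \<in> R" "e \<noteq> 0"
    "g * prod_list (map (\<lambda>r. u - k r) zs) \<approx> k e * g" by auto
  have "g * prod_list (map (\<lambda>r. u - k r) zs) \<approx> g * 0"
    using g rel_u by (intro cong_left) (simp_all add: cong_zero_iff)
  from cong_trans[OF cong_sym[OF e(4)] this] have "k e * g \<approx> 0" by simp
  then have "k (inverse e) * (k e * g) \<approx> k (inverse e) * 0" by (intro cong_left k_G e)
  moreover have "k (inverse e) * (k e * g) = g"
    using e by (simp add: mult.assoc[symmetric] k_mult[symmetric] k_one)
  ultimately show ?thesis by simp
qed

definition eta where "eta = t * s - s * t"

lemma eta_G: "eta \<in> G" unfolding eta_def by (intro G_intros gens_G)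

text \<open>Commuting with \<open>s\<close> gives \<open>\<beta>us = \<beta>su\<close>. With the relation \<open>tus = stu\<close> this becomes
  \<open>\<beta>tsu = \<beta>stu\<close>, and \<open>u\<close> can be cancelled.\<close>
lemma central_coefficient_eta:
  assumes c: "central \<alpha>" "central \<beta>" and z: "\<alpha> + \<beta> * u \<approx> 0"
  shows "\<beta> * eta \<approx> 0"
proof (rule u_cancel)
  note G = central_in_G[OF c(1)] central_in_G[OF c(2)] elems_G
  have us: "\<beta> * (u * s) \<approx> \<beta> * (s * u)"
  proof -
    have "\<alpha> * s + \<beta> * (u * s) = (\<alpha> + \<beta> * u) * s" by (simp add: algebra_simps)
    also have "\<dots> \<approx> 0 * s" by (intro cong_right z G)
    also have "0 * s = s * 0" by simp
    also have "s * 0 \<approx> s * (\<alpha> + \<beta> * u)" by (intro cong_left cong_sym[OF z] G)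
    also have "\<dots> = s * \<alpha> + (s * \<beta>) * u" by (simp add: algebra_simps)
    also have "\<dots> \<approx> \<alpha> * s + (\<beta> * s) * u"
      by (intro cong_add cong_right cong_sym[OF centralD] c G)
    finally have "\<alpha> * s + \<beta> * (u * s) - \<alpha> * s \<approx> \<alpha> * s + (\<beta> * s) * u - \<alpha> * s"
      by (intro cong_diff cong_refl G_mult G)
    then show ?thesis by (simp add: mult.assoc)
  qed
  have "\<beta> * (t * s * u) = (\<beta> * t) * (s * u)" by (simp add: mult.assoc)
  also have "\<dots> \<approx> (t * \<beta>) * (s * u)" by (intro cong_right centralD c G_mult G)
  also have "\<dots> = t * (\<beta> * (s * u))" by (simp add: mult.assoc)
  also have "\<dots> \<approx> t * (\<beta> * (u * s))" by (intro cong_left cong_sym[OF us] G)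
  also have "\<dots> = (t * \<beta>) * (u * s)" by (simp add: mult.assoc)
  also have "\<dots> \<approx> (\<beta> * t) * (u * s)" by (intro cong_right cong_sym[OF centralD] c G_mult G)
  also have "\<dots> = \<beta> * (t * u * s)" by (simp add: mult.assoc)
  also have "\<dots> \<approx> \<beta> * w" by (intro cong_left braid_cong G)
  finally have "\<beta> * (t * s * u) - \<beta> * w \<approx> \<beta> * w - \<beta> * w"
    by (intro cong_diff cong_refl G_mult G)
  then show "\<beta> * eta * u \<approx> 0" by (simp add: eta_def algebra_simps)
qed (intro G_mult eta_G central_in_G c)

text \<open>The two scalars are the values of \<open>theta\<close> on the linear characters: there \<open>X\<close> is some \<open>x\<^sub>iy\<^sub>j\<close>
  and \<open>det_st / X\<close> is \<open>x\<^sub>1\<^sub>-\<^sub>iy\<^sub>1\<^sub>-\<^sub>j\<close>.\<close>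
lemma eta_eta: "eta * eta \<approx> (theta - k (x0 * y0 + x1 * y1)) * (theta - k (x0 * y1 + x1 * y0))"
proof (rule congI)
  have th: "k (x0 * y0 + x1 * y1) * k (x0 * y1 + x1 * y0)
      = A * A * M + B * B * N - 2 * (N * M) - 2 * (N * M)"
    unfolding mult_2 k_mult[symmetric] k_add[symmetric] k_diff[symmetric]
    by (rule arg_cong[where f = k]) (simp add: algebra_simps)
  have su: "k (x0 * y0 + x1 * y1) + k (x0 * y1 + x1 * y0) = A * B"
    unfolding k_mult[symmetric] k_add[symmetric]
    by (rule arg_cong[where f = k]) (simp add: algebra_simps)
  have "(theta - k (x0 * y0 + x1 * y1)) * (theta - k (x0 * y1 + x1 * y0))
     = theta * theta - (k (x0 * y0 + x1 * y1) + k (x0 * y1 + x1 * y0)) * theta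
       + k (x0 * y0 + x1 * y1) * k (x0 * y1 + x1 * y0)"
    by (simp add: algebra_simps k_comm[of theta])
  also have "\<dots> = theta * theta - A * B * theta + A * A * M + B * B * N - 2 * (N * M) - 2 * (N * M)"
    unfolding th su by (simp add: algebra_simps)
  finally have e: "(theta - k (x0 * y0 + x1 * y1)) * (theta - k (x0 * y1 + x1 * y0)) = \<dots>" .
  show "eta * eta - (theta - k (x0 * y0 + x1 * y1)) * (theta - k (x0 * y1 + x1 * y0))
    = (- (t * qrel s A N * t) + B * qrel s A N * t + N * qrel t B M)
    + (- (s * qrel t B M * s) + A * qrel t B M * s + M * qrel s A N)
    - s * qrel t B M * s - t * qrel s A N * t - B * B * qrel s A N + B * qrel s A N * t
    + M * qrel s A N - A * A * qrel t B M + A * qrel t B M * s + N * qrel t B M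
    - A * (qrel t B M * s - s * qrel t B M) - B * (qrel s A N * t - t * qrel s A N)" (is "_ = ?certificate")
    unfolding e eta_def
    using eta_square[where s = s and t = t and A = A and B = B and N = N and M = M,
        OF k_comm k_comm k_comm k_comm, folded theta_def] by simp
  have "A * (qrel t B M * s - s * qrel t B M) \<in> I" "B * (qrel s A N * t - t * qrel s A N) \<in> I"
    by (intro I_left I_diff qrel_I k_G gens_G scalars_R)+
  then show "?certificate \<in> I"
    by (intro I_add I_minus I_diff qrel_I k_G gens_G scalars_R G_mult)
qed (use R params_R in \<open>auto intro!: G_intros elems_G k_G eta_G simp: subring_setD\<close>)


lemma coefficient_discriminant:
  assumes c: "central \<alpha>" "central \<beta>" and z: "\<alpha> + \<beta> * u \<approx> 0"
  shows "\<beta> * ((theta - k (x0 * y0 + x1 * y1)) * (theta - k (x0 * y1 + x1 * y0))) \<approx> 0"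
proof -
  note b = central_in_G[OF c(2)]
  have "\<beta> * ((theta - k (x0 * y0 + x1 * y1)) * (theta - k (x0 * y1 + x1 * y0))) \<approx> \<beta> * (eta * eta)"
    by (intro cong_left b cong_sym[OF eta_eta])
  also have "\<dots> = (\<beta> * eta) * eta" by (simp add: mult.assoc)
  also have "\<dots> \<approx> 0 * eta" by (intro cong_right central_coefficient_eta[OF c z] eta_G)
  finally show ?thesis by simp
qed

text \<open>This is \<open>theta = X + det_st / X\<close>, multiplied by \<open>X\<close>.\<close>
lemma theta_factor:
  assumes "a \<in> R" "b \<in> R" "a * b = det_st"
  shows "(theta - k (a + b)) * X \<approx> (X - k a) * (X - k b)"
proof -
  have "(X - k a) * (X - k b) = X * X - k (a + b) * X + k det_st"
    using assms(3) by (simp add: algebra_simps k_comm[of X] k_add k_mult[symmetric])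
      (simp add: mult.assoc[symmetric] k_comm[of X] k_comm[of s] k_comm[of t])
  also have "\<dots> \<approx> (theta * X - k det_st) - k (a + b) * X + k det_st"
    using R assms by (intro cong_add cong_diff cong_refl X_square G_mult elems_G k_G)
      (auto simp: subring_setD det_st_inv)
  also have "\<dots> = (theta - k (a + b)) * X" by (simp add: algebra_simps)
  finally show ?thesis by (rule cong_sym)
qed

definition st_values :: "'f list" where
  "st_values = [x0 * y0, x1 * y1, x0 * y1, x1 * y0]"

lemma st_values_R: "set st_values \<subseteq> R"
  using R params_R by (auto simp: st_values_def subring_setD)

lemma ubar_X: "ubar * X \<approx> X * ubar"
proof -
  have "ubar * X = k (inverse det_st) * X * (w * X)" by (simp add: ubar_def mult.assoc)
  also have "\<dots> \<approx> k (inverse det_st) * X * (X * w)"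
    by (intro cong_left centralD[OF central_w] elems_G G_mult k_G det_st_inv)
  also have "\<dots> = X * ubar" unfolding ubar_def
    by (simp add: mult.assoc[symmetric] k_comm[of s] k_comm[of t] k_comm[of "s * t"])
  finally show ?thesis .
qed

text \<open>With \<open>P(u) = \<alpha> + \<beta>u = 0\<close> one has \<open>P(ubar) = \<beta>(ubar - u)\<close>, which is annihilated by the square of
  the commutator; up to \<open>X\<^sup>2\<close> this square is the product of the \<open>X - x\<^sub>iy\<^sub>j\<close>.\<close>
lemma conjugate_of_u_equation:
  "ev (linear_factors zs) ubar * prod_list (map (\<lambda>a. X - k a) st_values) \<approx> 0"
proof -
  define h where "h = linear_factors zs"
  have h: "h \<in> poly_over R" unfolding h_def by (intro linear_factors_over[OF R] params_R)
  obtain \<alpha> \<beta> where c: "central \<alpha>" "central \<beta>"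
    and u: "ev h u \<approx> \<alpha> + \<beta> * u" and ub: "ev h ubar \<approx> \<alpha> + \<beta> * ubar"
    using conjugate_values[of h "\<lambda>_ _. True" 0 0] h by auto
  note G = central_in_G[OF c(1)] central_in_G[OF c(2)] elems_G
  have z: "\<alpha> + \<beta> * u \<approx> 0" using u u_equation cong_sym cong_trans unfolding h_def by blast
  define D1 where "D1 = theta - k (x0 * y0 + x1 * y1)"
  define D2 where "D2 = theta - k (x0 * y1 + x1 * y0)"
  have cD: "central D1" "central D2"
    unfolding D1_def D2_def using R params_R
    by (auto intro!: central_diff central_theta central_k simp: subring_setD)
  note GD = cD[THEN central_in_G]
  have F: "prod_list (map (\<lambda>a. X - k a) st_values) \<approx> (D1 * D2) * (X * X)"
  proof -
    have "prod_list (map (\<lambda>a. X - k a) st_values)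
      = ((X - k (x0 * y0)) * (X - k (x1 * y1))) * ((X - k (x0 * y1)) * (X - k (x1 * y0)))"
      by (simp add: st_values_def mult.assoc)
    also have "\<dots> \<approx> (D1 * X) * (D2 * X)"
      unfolding D1_def D2_def using R params_R
      by (intro cong_mult cong_sym[OF theta_factor]) (auto simp: subring_setD det_st_def algebra_simps)
    also have "\<dots> = D1 * (X * D2) * X" by (simp add: mult.assoc)
    also have "\<dots> \<approx> D1 * (D2 * X) * X"
      by (intro cong_left cong_right cong_sym[OF centralD] cD G GD)
    finally show ?thesis by (simp add: mult.assoc)
  qed
  have "ev h ubar \<approx> (\<alpha> + \<beta> * ubar) - (\<alpha> + \<beta> * u)"
    using cong_diff[OF ub cong_sym[OF z]] by simp
  also have "\<dots> = \<beta> * (ubar - u)" by (simp add: algebra_simps)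
  finally have "ev h ubar * prod_list (map (\<lambda>a. X - k a) st_values)
      \<approx> \<beta> * (ubar - u) * ((D1 * D2) * (X * X))"
    using F by (intro cong_mult)
  also have "\<dots> = \<beta> * ((ubar - u) * (D1 * D2)) * (X * X)" by (simp add: mult.assoc)
  also have "\<dots> \<approx> \<beta> * ((D1 * D2) * (ubar - u)) * (X * X)"
    by (intro cong_left cong_right cong_sym[OF centralD] central_mult cD G GD G_mult G_diff)
  also have "\<dots> = (\<beta> * (D1 * D2)) * ((ubar - u) * (X * X))" by (simp add: mult.assoc)
  also have "\<dots> \<approx> 0 * ((ubar - u) * (X * X))"
    using coefficient_discriminant[OF c z] unfolding D1_def D2_def
    by (intro cong_right G_mult G_diff G)
  finally show ?thesis by (simp add: h_def)
qed

text \<open>The values of \<open>ubar = X\<^sup>2 u / det_st\<close> where \<open>X\<close> is the scalar \<open>a\<close>.\<close>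
definition linear_values :: "'f \<Rightarrow> 'f list" where
  "linear_values a = map (\<lambda>r. inverse det_st * (a * a) * r) zs"

lemma linear_values_R: "a \<in> R \<Longrightarrow> set (linear_values a) \<subseteq> R"
  using R params_R by (auto simp: linear_values_def subring_setD det_st_inv)

text \<open>Modulo \<open>X - a\<close> the element \<open>ubar\<close> is \<open>a\<^sup>2 u / det_st\<close>, so the product becomes a multiple of
  \<open>\<Prod>(u - z\<^sub>k) = 0\<close>. The induction keeps track of this multiple \<open>e\<close> for partial products.\<close>
lemma ubar_on_eigenvalue:
  assumes a: "a \<in> R"
  shows "\<exists>g\<in>G. ev (linear_factors (linear_values a)) ubar \<approx> (X - k a) * g"
proof -
  define m where "m = inverse det_st * (a * a)"
  have m: "m \<in> R" using R a det_st_inv by (auto simp: m_def subring_setD)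
  have "\<exists>g\<in>G. \<exists>e\<in>R. prod_list (map (\<lambda>r. ubar - k (m * r)) rs)
      \<approx> (X - k a) * g + k e * prod_list (map (\<lambda>r. u - k r) rs)" if "set rs \<subseteq> R" for rs
    using that
  proof (induction rs)
    case Nil
    then show ?case using R by (intro bexI[of _ 0] bexI[of _ 1])
        (auto simp: subring_setD k_one cong_refl G_zero G_one)
  next
    case (Cons r rs)
    then obtain g e where g: "g \<in> G" "e \<in> R" "prod_list (map (\<lambda>r. ubar - k (m * r)) rs)
      \<approx> (X - k a) * g + k e * prod_list (map (\<lambda>r. u - k r) rs)" by auto
    define Q where "Q = prod_list (map (\<lambda>r. u - k r) rs)"
    define V where "V = ubar - k (m * r)"
    have Q: "Q \<in> G" unfolding Q_def
      using Cons.prems by (induction rs) (auto intro!: G_intros k_G gens_G)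
    have V: "V \<in> G" unfolding V_def using Cons.prems m R
      by (auto intro!: G_intros elems_G k_G simp: subring_setD)
    \<comment> \<open>The factor \<open>V\<close> is \<open>(X - a) C + m (u - r)\<close>, as \<open>X\<^sup>2 - a\<^sup>2 = (X - a)(X + a)\<close>.\<close>
    define C where "C = k (inverse det_st) * (X + k a) * u"
    have C: "C \<in> G" unfolding C_def by (intro G_mult G_add elems_G k_G det_st_inv a)
    have XG: "X - k a \<in> G" by (intro G_diff k_G a elems_G)
    have "X * k a = k a * X" by (rule k_comm)
    then have "(X - k a) * (X + k a) = X * X - k (a * a)" by (simp add: algebra_simps k_mult)
    moreover have "(X - k a) * k (inverse det_st) = k (inverse det_st) * (X - k a)" by (rule k_comm)
    ultimately have "(X - k a) * C = k (inverse det_st) * (X * X - k (a * a)) * u"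
      unfolding C_def by (metis mult.assoc)
    then have "(X - k a) * C = ubar - k m * u"
      by (simp add: ubar_def m_def k_mult left_diff_distrib right_diff_distrib mult.assoc)
    then have V_eq: "V = (X - k a) * C + k m * (u - k r)"
      by (simp add: V_def right_diff_distrib k_mult[of m])
    have XV: "V * (X - k a) \<approx> (X - k a) * V"
    proof -
      have "V * (X - k a) = ubar * X - k (m * r) * X - ubar * k a + k (m * r) * k a"
        by (simp add: V_def algebra_simps)
      also have "\<dots> \<approx> X * ubar - k (m * r) * X - ubar * k a + k (m * r) * k a"
        using m a Cons.prems R
        by (intro cong_add cong_diff cong_refl ubar_X G_mult elems_G k_G) (auto simp: subring_setD)
      also have "\<dots> = (X - k a) * V"
        unfolding V_def using k_comm[of X "m * r"] k_comm[of ubar a] k_comm[of "k a" "m * r"]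
        by (simp add: algebra_simps)
      finally show ?thesis .
    qed
    have "prod_list (map (\<lambda>r. ubar - k (m * r)) (r # rs)) \<approx> V * ((X - k a) * g + k e * Q)"
      unfolding V_def[symmetric] Q_def using g V by (auto simp: V_def[symmetric] intro!: cong_left)
    also have "\<dots> = V * (X - k a) * g + V * (k e * Q)" by (simp add: algebra_simps)
    also have "\<dots> \<approx> (X - k a) * V * g + V * (k e * Q)"
      by (intro cong_add cong_right cong_refl XV G_mult V g k_G Q)
    also have "V * (k e * Q) = (X - k a) * (C * (k e * Q)) + k m * (u - k r) * (k e * Q)"
      unfolding V_eq by (simp add: algebra_simps)
    also have "k m * (u - k r) * (k e * Q) = k (m * e) * ((u - k r) * Q)"
      using k_comm[of "u - k r" e] by (simp add: k_mult mult.assoc[symmetric]) (simp add: mult.assoc)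
    also have "(X - k a) * V * g + ((X - k a) * (C * (k e * Q)) + k (m * e) * ((u - k r) * Q))
      = (X - k a) * (V * g + C * (k e * Q)) + k (m * e) * ((u - k r) * Q)"
      by (simp add: algebra_simps)
    finally show ?case using m g R Q V C unfolding Q_def
      by (intro bexI[of _ "V * g + C * (k e * Q)"] bexI[of _ "m * e"])
        (auto intro!: G_add G_mult k_G simp: subring_setD Q_def)
  qed
  from this[of zs] params_R obtain g e where g: "g \<in> G" "e \<in> R"
    "prod_list (map (\<lambda>r. ubar - k (m * r)) zs) \<approx> (X - k a) * g + k e * prod_list (map (\<lambda>r. u - k r) zs)"
    by auto
  note g(3)
  also have "(X - k a) * g + k e * prod_list (map (\<lambda>r. u - k r) zs) \<approx> (X - k a) * g + k e * 0"
    using rel_u g a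
    by (intro cong_add cong_left cong_refl G_mult G_diff elems_G k_G) (auto simp: cong_zero_iff)
  also have "prod_list (map (\<lambda>r. ubar - k (m * r)) zs) = ev (linear_factors (linear_values a)) ubar"
    unfolding linear_factors_def ev_linear_factors by (simp add: linear_values_def m_def o_def)
  finally show ?thesis using g by auto
qed

text \<open>As \<open>X\<close> commutes with \<open>ubar\<close>, the factors \<open>X - a\<close> can be replaced one at a time by the polynomials
  in \<open>ubar\<close> that they divide.\<close>
lemma replace_eigenvalues:
  assumes "set as \<subseteq> R" "f \<in> G" "f * prod_list (map (\<lambda>a. X - k a) as) \<approx> 0"
  shows "f * ev (prod_list (map (\<lambda>a. linear_factors (linear_values a)) as)) ubar \<approx> 0"
  using assms
proof (induction as arbitrary: f)
  case (Cons a as)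
  define h where "h = prod_list (map (\<lambda>a. linear_factors (linear_values a)) as)"
  define h' where "h' = linear_factors (linear_values a)"
  have h': "h' \<in> poly_over R"
    unfolding h'_def using Cons.prems by (intro linear_factors_over[OF R] linear_values_R) auto
  have h: "h \<in> poly_over R"
    unfolding h_def using Cons.prems(1) subring_set_poly_over[OF R]
    by (induction as) (auto simp: subring_setD linear_factors_over[OF R] linear_values_R)
  have XG: "X - k a \<in> G" using Cons.prems by (auto intro!: G_diff k_G elems_G)
  have hG: "ev h ubar \<in> G" by (intro ev_G h ubar_G)
  have 1: "f * (X - k a) * ev h ubar \<approx> 0"
    unfolding h_def using Cons.prems XG by (intro Cons.IH) (auto simp: mult.assoc G_mult)
  have 2: "(X - k a) * ev h ubar \<approx> ev h ubar * (X - k a)"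
  proof (rule commute_ev[OF h XG ubar_G])
    have "ubar * (X - k a) \<approx> (X - k a) * ubar"
      unfolding left_diff_distrib right_diff_distrib k_comm[of ubar a] using Cons.prems
      by (intro cong_diff ubar_X cong_refl G_mult ubar_G k_G) auto
    then show "(X - k a) * ubar \<approx> ubar * (X - k a)" by (rule cong_sym)
  qed
  have "f * (ev h ubar * (X - k a)) \<approx> f * ((X - k a) * ev h ubar)"
    by (intro cong_left Cons.prems cong_sym[OF 2])
  also have "\<dots> = f * (X - k a) * ev h ubar" by (simp add: mult.assoc)
  also note 1
  finally have 0: "f * (ev h ubar * (X - k a)) \<approx> 0" .
  obtain g where g: "g \<in> G" "ev h' ubar \<approx> (X - k a) * g"
    using ubar_on_eigenvalue Cons.prems unfolding h'_def by auto
  have "f * ev (h * h') ubar = f * ev h ubar * ev h' ubar" by (simp add: ev_mult mult.assoc)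
  also have "\<dots> \<approx> f * ev h ubar * ((X - k a) * g)"
    by (intro cong_left g G_mult Cons.prems hG)
  also have "\<dots> = f * (ev h ubar * (X - k a)) * g" by (simp add: mult.assoc)
  also have "\<dots> \<approx> 0 * g" by (intro cong_right 0 g)
  finally show ?case by (simp add: h_def h'_def mult.commute)
qed (simp add: cong_refl)

definition eigenvalues :: "'f list" where
  "eigenvalues = zs @ concat (map linear_values st_values)"

lemma eigenvalues_R: "set eigenvalues \<subseteq> R"
  unfolding eigenvalues_def using params_R st_values_R linear_values_R by fastforce

lemma ev_eigenvalues:
  "ev (linear_factors eigenvalues) u \<approx> 0" "ev (linear_factors eigenvalues) ubar \<approx> 0"
proof -
  have lc: "linear_factors (concat (map linear_values as))
      = prod_list (map (\<lambda>a. linear_factors (linear_values a)) as)" for as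
    by (induction as) (simp_all add: linear_factors_append, simp add: linear_factors_def)
  have e: "linear_factors eigenvalues = linear_factors zs *
      prod_list (map (\<lambda>a. linear_factors (linear_values a)) st_values)"
    unfolding eigenvalues_def linear_factors_append lc ..
  have "set (concat (map linear_values st_values)) \<subseteq> R"
    using eigenvalues_R by (simp add: eigenvalues_def)
  then have "ev (prod_list (map (\<lambda>a. linear_factors (linear_values a)) st_values)) u \<in> G"
    unfolding lc[symmetric] by (intro ev_G linear_factors_over[OF R] gens_G)
  then show "ev (linear_factors eigenvalues) u \<approx> 0"
    using cong_right[OF _ u_equation] unfolding e ev_mult by fastforce
  show "ev (linear_factors eigenvalues) ubar \<approx> 0"
    unfolding e ev_mult
    by (intro replace_eigenvalues st_values_R conjugate_of_u_equation ev_G linear_factors_over[OF R]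
        params_R ubar_G)
qed

text \<open>The norm is a product of two commuting idempotents.\<close>
lemma norm_idempotent:
  assumes h: "h \<in> poly_over R" and g: "g \<in> poly_over R"
    and e: "h * h - h = g * linear_factors eigenvalues"
  shows "(ev h u * ev h ubar) * (ev h u * ev h ubar) \<approx> ev h u * ev h ubar"
proof -
  have idem: "ev h v * ev h v \<approx> ev h v" if v: "v \<in> G" "ev (linear_factors eigenvalues) v \<approx> 0" for v
  proof -
    have "ev h v * ev h v - ev h v = ev g v * ev (linear_factors eigenvalues) v"
      by (simp add: ev_mult[symmetric] ev_diff[symmetric] e)
    also have "\<dots> \<approx> ev g v * 0" by (intro cong_left ev_G g v)
    finally show ?thesis using cong_diff_zero_iff ev_G[OF h v(1)] by (simp add: G_mult)
  qed
  have G: "ev h u \<in> G" "ev h ubar \<in> G" by (intro ev_G h elems_G)+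
  have "u * ev h ubar \<approx> ev h ubar * u" by (intro commute_ev h elems_G u_ubar_commute)
  from commute_ev[OF h G(2) gens_G(3) cong_sym[OF this]]
  have c: "ev h ubar * ev h u \<approx> ev h u * ev h ubar" .
  have "(ev h u * ev h ubar) * (ev h u * ev h ubar) = ev h u * (ev h ubar * ev h u) * ev h ubar"
    by (simp add: mult.assoc)
  also have "\<dots> \<approx> ev h u * (ev h u * ev h ubar) * ev h ubar"
    by (intro cong_left cong_right c G)
  also have "\<dots> = (ev h u * ev h u) * (ev h ubar * ev h ubar)" by (simp add: mult.assoc)
  also have "\<dots> \<approx> ev h u * ev h ubar"
    by (intro cong_mult idem elems_G ev_eigenvalues)
  finally show ?thesis .
qed

end

section \<open>The Hecke algebra as a quotient of the free algebra\<close>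

lemma poly_mapping_eq_sum_single:
  "f = (\<Sum>w\<in>Poly_Mapping.keys f. Poly_Mapping.single w (Poly_Mapping.lookup f w))"
  by (rule poly_mapping_eqI) (simp add: lookup_sum lookup_single when_def in_keys_iff)

lemma carrier_free_alg: "f \<in> carrier (free_alg R) \<longleftrightarrow> (\<forall>w. Poly_Mapping.lookup f w \<in> R)"
  by (simp add: free_alg_def)

lemma free_alg_ops [simp]:
  "\<one>\<^bsub>free_alg R\<^esub> = 1" "\<zero>\<^bsub>free_alg R\<^esub> = 0" "f \<oplus>\<^bsub>free_alg R\<^esub> g = f + g" "f \<otimes>\<^bsub>free_alg R\<^esub> g = f * g"
  by (simp_all add: free_alg_def)

lemma single_in_free_alg: "subring_set R \<Longrightarrow> r \<in> R \<Longrightarrow> Poly_Mapping.single w r \<in> carrier (free_alg R)"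
  by (auto simp: carrier_free_alg lookup_single when_def subring_setD)

context
  fixes R :: "'f::comm_ring_1 set"
  assumes R: "subring_set R"
begin

lemma free_alg_closed:
  "0 \<in> carrier (free_alg R)" "1 \<in> carrier (free_alg R)"
  "f \<in> carrier (free_alg R) \<Longrightarrow> - f \<in> carrier (free_alg R)"
  "f \<in> carrier (free_alg R) \<Longrightarrow> g \<in> carrier (free_alg R) \<Longrightarrow> f + g \<in> carrier (free_alg R)"
  "f \<in> carrier (free_alg R) \<Longrightarrow> g \<in> carrier (free_alg R) \<Longrightarrow> f - g \<in> carrier (free_alg R)"
  "f \<in> carrier (free_alg R) \<Longrightarrow> g \<in> carrier (free_alg R) \<Longrightarrow> f * g \<in> carrier (free_alg R)"
proof -
  show zero: "0 \<in> carrier (free_alg R)" using R by (simp add: carrier_free_alg subring_setD)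
  show "1 \<in> carrier (free_alg R)"
    using R by (auto simp: carrier_free_alg lookup_one when_def subring_setD)
  show "f \<in> carrier (free_alg R) \<Longrightarrow> - f \<in> carrier (free_alg R)"
    using R by (simp add: carrier_free_alg subring_setD)
  show add: "f \<in> carrier (free_alg R) \<Longrightarrow> g \<in> carrier (free_alg R) \<Longrightarrow> f + g \<in> carrier (free_alg R)"
    for f g :: "'f free" using R by (simp add: carrier_free_alg lookup_add subring_setD)
  show "f \<in> carrier (free_alg R) \<Longrightarrow> g \<in> carrier (free_alg R) \<Longrightarrow> f - g \<in> carrier (free_alg R)"
    using R by (simp add: carrier_free_alg lookup_minus subring_setD)
  have sum: "(\<And>j. j \<in> J \<Longrightarrow> p j \<in> carrier (free_alg R)) \<Longrightarrow> sum p J \<in> carrier (free_alg R)"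
    for J :: "gen list set" and p by (induction J rule: infinite_finite_induct) (auto intro: zero add)
  assume fg: "f \<in> carrier (free_alg R)" "g \<in> carrier (free_alg R)"
  have "f * g = (\<Sum>w\<in>Poly_Mapping.keys f. \<Sum>w'\<in>Poly_Mapping.keys g.
      Poly_Mapping.single (w + w') (Poly_Mapping.lookup f w * Poly_Mapping.lookup g w'))"
    by (subst poly_mapping_eq_sum_single[of f], subst poly_mapping_eq_sum_single[of g])
      (simp add: sum_product mult_single)
  also have "\<dots> \<in> carrier (free_alg R)"
    using fg R by (intro sum single_in_free_alg) (simp_all add: carrier_free_alg subring_setD)
  finally show "f * g \<in> carrier (free_alg R)" .
qed

lemma ring_free_alg: "ring (free_alg R)"
proof (rule ringI)
  show "abelian_group (free_alg R)"
    by (rule abelian_groupI) (auto simp: free_alg_closed algebra_simps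
        intro!: bexI[of _ "- _"])
  show "Group.monoid (free_alg R)"
    by (rule Group.monoid.intro) (auto simp: free_alg_closed algebra_simps)
qed (simp_all add: algebra_simps)

lemma a_minus_free_alg:
  assumes "f \<in> carrier (free_alg R)" "g \<in> carrier (free_alg R)"
  shows "f \<ominus>\<^bsub>free_alg R\<^esub> g = f - g"
proof -
  interpret ring "free_alg R" by (rule ring_free_alg)
  have "\<ominus>\<^bsub>free_alg R\<^esub> g = - g"
    using assms by (intro minus_equality) (auto simp: free_alg_closed)
  then show ?thesis by (simp add: a_minus_def)
qed

lemma fgen_in_free_alg: "fgen g \<in> carrier (free_alg R)"
  unfolding fgen_def using R by (intro single_in_free_alg) (auto simp: subring_setD)

lemma fconst_in_free_alg: "r \<in> R \<Longrightarrow> fconst r \<in> carrier (free_alg R)"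
  unfolding fconst_def using R by (intro single_in_free_alg)

lemma free_alg_generated:
  assumes const: "fconst ` R \<subseteq> S" and gens: "\<And>g. fgen g \<in> S"
    and add: "\<And>f g. f \<in> S \<Longrightarrow> g \<in> S \<Longrightarrow> f + g \<in> S" and mult: "\<And>f g. f \<in> S \<Longrightarrow> g \<in> S \<Longrightarrow> f * g \<in> S"
  shows "carrier (free_alg R) \<subseteq> S"
proof
  have single: "Poly_Mapping.single w r \<in> S" if "r \<in> R" for w r
  proof (induction w)
    case Nil
    then show ?case using const that by (auto simp: fconst_def)
  next
    case (Cons g w)
    have "Poly_Mapping.single (g # w) r = fgen g * Poly_Mapping.single w r"
      by (simp add: fgen_def mult_single plus_list_def)
    then show ?case using gens mult Cons by auto
  qed
  have zero: "0 \<in> S" using single[of 0 "[]"] R by (simp add: subring_setD)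
  have sum: "(\<And>j. j \<in> J \<Longrightarrow> p j \<in> S) \<Longrightarrow> sum p J \<in> S" for J :: "gen list set" and p
    by (induction J rule: infinite_finite_induct) (auto intro: zero add)
  fix f assume "f \<in> carrier (free_alg R)"
  then show "f \<in> S"
    by (subst poly_mapping_eq_sum_single) (auto simp: carrier_free_alg intro!: sum single)
qed

end

lemma fconst_ring_hom:
  "fconst 1 = 1" "fconst (r + r') = fconst r + fconst r'" "fconst (r * r') = fconst r * fconst r'"
proof -
  show "fconst 1 = (1 :: 'a free)" by (metis fconst_def single_one zero_list_def)
qed (simp_all add: fconst_def single_add mult_single plus_list_def)

lemma fconst_commute: "f * fconst r = fconst r * f"
proof -
  have "Poly_Mapping.single w a * fconst r = fconst r * Poly_Mapping.single w a" for w a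
    by (simp add: fconst_def mult_single plus_list_def mult.commute)
  then show ?thesis
    by (subst (1 2) poly_mapping_eq_sum_single[of f]) (simp add: sum_distrib_left sum_distrib_right)
qed

locale hecke_presentation =
  fixes R :: "'f::comm_ring_1 set" and d :: nat and x y z :: "nat \<Rightarrow> 'f"
  assumes R: "subring_set R"
    and params: "x 0 \<in> R" "x 1 \<in> R" "y 0 \<in> R" "y 1 \<in> R" "\<And>k. k < d \<Longrightarrow> z k \<in> R"
begin

abbreviation F where "F \<equiv> free_alg R"
abbreviation H where "H \<equiv> hecke_algebra R d x y z"
abbreviation I where "I \<equiv> hecke_ideal R d x y z"
abbreviation cls where "cls \<equiv> hecke_class R d x y z"

lemma hecke_relations_carrier: "hecke_relations d x y z \<subseteq> carrier F"
proof -
  have "prod_list (map (\<lambda>k. fgen GU - fconst (z k)) ks) \<in> carrier F" if "set ks \<subseteq> {..<d}" for ks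
    using that by (induction ks)
      (auto intro!: free_alg_closed[OF R] fgen_in_free_alg[OF R] fconst_in_free_alg[OF R] params)
  moreover have "set [0..<d] \<subseteq> {..<d}" by auto
  ultimately have "prod_list (map (\<lambda>k. fgen GU - fconst (z k)) [0..<d]) \<in> carrier F" by blast
  then show ?thesis unfolding hecke_relations_def
    by (auto intro!: free_alg_closed[OF R] fgen_in_free_alg[OF R] fconst_in_free_alg[OF R]
        params params[unfolded One_nat_def])
qed

lemma ideal_I: "ideal I F"
  unfolding hecke_ideal_def by (intro ring.genideal_ideal ring_free_alg R hecke_relations_carrier)

lemma relations_I: "hecke_relations d x y z \<subseteq> I"
  unfolding hecke_ideal_def by (intro ring.genideal_self ring_free_alg R hecke_relations_carrier)

lemma ideal_congruence: "ideal_congruence (carrier F) I"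
proof -
  interpret ideal I F by (rule ideal_I)
  show ?thesis
    using additive_subgroup.a_closed[OF additive_subgroup_axioms]
      additive_subgroup.zero_closed[OF additive_subgroup_axioms] I_l_closed I_r_closed a_subset
    by unfold_locales (auto simp: free_alg_closed[OF R])
qed

lemma cls_hom: "cls \<in> Ring.ring_hom F H"
proof -
  interpret ideal I F by (rule ideal_I)
  show ?thesis using rcos_ring_hom unfolding hecke_class_def hecke_algebra_def by simp
qed

lemma cls_eq_iff:
  assumes "f \<in> carrier F" "g \<in> carrier F"
  shows "cls f = cls g \<longleftrightarrow> f - g \<in> I"
  using ring.quotient_eq_iff_same_a_r_cos[OF ring_free_alg[OF R] ideal_I assms] assms
  by (simp add: hecke_class_def a_minus_free_alg[OF R])

lemma cls_closed: "f \<in> carrier F \<Longrightarrow> cls f \<in> carrier H"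
  and cls_mult: "f \<in> carrier F \<Longrightarrow> g \<in> carrier F \<Longrightarrow> cls f \<otimes>\<^bsub>H\<^esub> cls g = cls (f * g)"
  and cls_add: "f \<in> carrier F \<Longrightarrow> g \<in> carrier F \<Longrightarrow> cls f \<oplus>\<^bsub>H\<^esub> cls g = cls (f + g)"
  using cls_hom by (auto simp: Ring.ring_hom_def)

lemma carrier_H: "carrier H = cls ` carrier F"
  by (auto simp: hecke_algebra_def hecke_class_def FactRing_def A_RCOSETS_def' a_r_coset_def')

lemma ring_H: "ring H"
  unfolding hecke_algebra_def by (rule ideal.quotient_is_ring[OF ideal_I])

lemma cls_zero: "\<zero>\<^bsub>H\<^esub> = cls 0"
proof -
  interpret h: ring_hom_ring F H cls
    by (intro ring_hom_ringI2 ring_free_alg R ring_H cls_hom)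
  show ?thesis using h.hom_zero by simp
qed

end


text \<open>The contraction of the larger ideal is an ideal that contains the relations.\<close>
lemma (in hecke_presentation) hecke_ideal_mono:
  assumes "hecke_presentation R' d x y z" "R \<subseteq> R'"
  shows "I \<subseteq> hecke_ideal R' d x y z"
proof -
  interpret R': hecke_presentation R' d x y z by fact
  have sub: "carrier F \<subseteq> carrier (free_alg R')" using assms(2) by (auto simp: carrier_free_alg subset_eq)
  interpret c: ideal_congruence "carrier (free_alg R')" "hecke_ideal R' d x y z"
    by (rule R'.ideal_congruence)
  have "ideal (hecke_ideal R' d x y z \<inter> carrier F) F"
  proof (rule idealI)
    show "ring F" by (rule ring_free_alg[OF R])
    then interpret ring F .
    show "subgroup (hecke_ideal R' d x y z \<inter> carrier F) (add_monoid F)"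
    proof (rule add.subgroupI)
      fix f assume f: "f \<in> hecke_ideal R' d x y z \<inter> carrier F"
      then have "\<ominus>\<^bsub>F\<^esub> f = - f" by (intro minus_equality) (auto simp: free_alg_closed[OF R])
      then show "\<ominus>\<^bsub>F\<^esub> f \<in> hecke_ideal R' d x y z \<inter> carrier F"
        using f by (simp add: c.I_minus free_alg_closed[OF R])
    qed (use c.I_zero c.I_add in \<open>auto simp: free_alg_closed[OF R]\<close>)
  qed (use sub c.I_left c.I_right in \<open>auto simp: free_alg_closed[OF R]\<close>)
  then show ?thesis unfolding hecke_ideal_def[of R]
    using ring.genideal_minimal[OF ring_free_alg[OF R]] hecke_relations_carrier R'.relations_I
    by (metis le_inf_iff)
qed

lemma (in hecke_presentation) hecke_extend_class:
  assumes R': "hecke_presentation R' d x y z" "R \<subseteq> R'" and f: "f \<in> carrier F"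
  shows "hecke_extend R' d x y z (cls f) = hecke_class R' d x y z f"
proof -
  interpret R': hecke_presentation R' d x y z by fact
  interpret c: ideal_congruence "carrier F" I by (rule ideal_congruence)
  interpret c': ideal_congruence "carrier (free_alg R')" "hecke_ideal R' d x y z"
    by (rule R'.ideal_congruence)
  have sub: "I \<subseteq> hecke_ideal R' d x y z" by (rule hecke_ideal_mono[OF R'])
  have "hecke_extend R' d x y z (cls f) = {a + (b + f) |a b. a \<in> hecke_ideal R' d x y z \<and> b \<in> I}"
    unfolding hecke_extend_def hecke_class_def set_add_def' a_r_coset_def' by auto
  also have "\<dots> = {a + f |a. a \<in> hecke_ideal R' d x y z}"
  proof (intro equalityI subsetI)
    fix g assume "g \<in> {a + (b + f) |a b. a \<in> hecke_ideal R' d x y z \<and> b \<in> I}"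
    then obtain a b where "g = (a + b) + f" "a \<in> hecke_ideal R' d x y z" "b \<in> I"
      by (auto simp: add.assoc)
    then show "g \<in> {a + f |a. a \<in> hecke_ideal R' d x y z}" using sub c'.I_add by blast
  next
    fix g assume "g \<in> {a + f |a. a \<in> hecke_ideal R' d x y z}"
    then obtain a where "g = a + (0 + f)" "a \<in> hecke_ideal R' d x y z" by auto
    then show "g \<in> {a + (b + f) |a b. a \<in> hecke_ideal R' d x y z \<and> b \<in> I}"
      using c.I_zero by blast
  qed
  also have "\<dots> = hecke_class R' d x y z f"
    unfolding hecke_class_def a_r_coset_def' by auto
  finally show ?thesis .
qed

locale invertible_hecke_presentation = hecke_presentation R d x y z
  for R :: "'f::field set" and d x y z +
  assumes nz: "x 0 \<noteq> 0" "x 1 \<noteq> 0" "y 0 \<noteq> 0" "y 1 \<noteq> 0" "\<And>k. k < d \<Longrightarrow> z k \<noteq> 0"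
    and inv: "inverse (x 0) \<in> R" "inverse (x 1) \<in> R" "inverse (y 0) \<in> R" "inverse (y 1) \<in> R"
      "\<And>k. k < d \<Longrightarrow> inverse (z k) \<in> R"

sublocale invertible_hecke_presentation \<subseteq> hc: hecke_congruence "carrier F" I R fconst
  "fgen GS" "fgen GT" "fgen GU" "x 0" "x 1" "y 0" "y 1" "map z [0..<d]"
proof (intro hecke_congruence.intro ideal_congruence hecke_congruence_axioms.intro)
  show "carrier F \<subseteq> S" if "fconst ` R \<subseteq> S" "fgen GS \<in> S" "fgen GT \<in> S" "fgen GU \<in> S"
    "\<And>f g. f \<in> S \<Longrightarrow> g \<in> S \<Longrightarrow> f + g \<in> S" "\<And>f g. f \<in> S \<Longrightarrow> g \<in> S \<Longrightarrow> f * g \<in> S" for S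
  proof (rule free_alg_generated[OF R])
    show "fgen g \<in> S" for g using that by (cases g) auto
  qed (use that in auto)
  have m: "map (\<lambda>r. fgen GU - fconst r) (map z [0..<d]) = map (\<lambda>k. fgen GU - fconst (z k)) [0..<d]"
    by simp
  show "prod_list (map (\<lambda>r. fgen GU - fconst r) (map z [0..<d])) \<in> I"
    unfolding m using relations_I by (simp add: hecke_relations_def)
qed (use relations_I params nz inv in \<open>auto simp: hecke_relations_def R fconst_ring_hom
    fgen_in_free_alg fconst_in_free_alg intro: fconst_commute\<close>)

section \<open>Central idempotents and representations\<close>

text \<open>\<open>B\<close> is the orthogonal sum of the central idempotents \<open>BE\<close> and \<open>B - BE\<close>.\<close>
lemma (in ring) primitive_idem_dichotomy:
  assumes B: "central_primitive_idem R B" and E: "central_idem R E"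
  shows "B \<otimes> E = B \<or> B \<otimes> E = \<zero>"
proof -
  have Bc: "B \<in> carrier R" "B \<otimes> B = B" "\<And>h. h \<in> carrier R \<Longrightarrow> B \<otimes> h = h \<otimes> B"
    using B by (auto simp: central_primitive_idem_def central_idem_def ring_center_def)
  have Ec: "E \<in> carrier R" "E \<otimes> E = E" "\<And>h. h \<in> carrier R \<Longrightarrow> E \<otimes> h = h \<otimes> E"
    using E by (auto simp: central_idem_def ring_center_def)
  define C where "C = B \<otimes> E"
  note cs = Bc(1) Ec(1)
  have C: "C \<in> carrier R" unfolding C_def using cs by simp
  have Ccomm: "C \<otimes> h = h \<otimes> C" if h: "h \<in> carrier R" for h
  proof -
    have "C \<otimes> h = B \<otimes> (E \<otimes> h)" unfolding C_def using cs h by (simp add: m_assoc)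
    also have "\<dots> = (B \<otimes> h) \<otimes> E" unfolding Ec(3)[OF h] using cs h by (simp add: m_assoc)
    also have "\<dots> = h \<otimes> C" unfolding Bc(3)[OF h] C_def using cs h by (simp add: m_assoc)
    finally show ?thesis .
  qed
  have BC: "B \<otimes> C = C"
    unfolding C_def using cs Bc(2) by (simp add: m_assoc[symmetric])
  have CB: "C \<otimes> B = C" using Ccomm[OF Bc(1)] BC by simp
  have CC: "C \<otimes> C = C"
  proof -
    have "C \<otimes> C = C \<otimes> (B \<otimes> E)" by (simp only: C_def)
    also have "\<dots> = (C \<otimes> B) \<otimes> E" using cs C by (simp add: m_assoc)
    also have "\<dots> = B \<otimes> (E \<otimes> E)" unfolding CB using cs by (simp add: C_def m_assoc)
    finally show ?thesis using Ec(2) by (simp add: C_def)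
  qed
  have 1: "central_idem R C"
    using C Ccomm CC unfolding central_idem_def ring_center_def by blast
  have 2: "central_idem R (B \<ominus> C)"
    unfolding central_idem_def ring_center_def
  proof (intro conjI CollectI ballI)
    show "B \<ominus> C \<in> carrier R" using cs C by simp
    show "(B \<ominus> C) \<otimes> h = h \<otimes> (B \<ominus> C)" if h: "h \<in> carrier R" for h
    proof -
      have "(B \<ominus> C) \<otimes> h = B \<otimes> h \<oplus> \<ominus> (C \<otimes> h)"
        using cs C h by (simp add: a_minus_def l_distr l_minus)
      also have "\<dots> = h \<otimes> (B \<ominus> C)"
        unfolding Bc(3)[OF h] Ccomm[OF h] using cs C h by (simp add: a_minus_def r_distr r_minus)
      finally show ?thesis .
    qed
    have "(B \<ominus> C) \<otimes> (B \<ominus> C) = (B \<ominus> C) \<oplus> (\<ominus> C \<oplus> C)"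
      using cs C by (simp add: a_minus_def l_distr r_distr l_minus r_minus a_assoc r_neg l_neg Bc(2) BC CB CC)
    then show "(B \<ominus> C) \<otimes> (B \<ominus> C) = B \<ominus> C" using cs C by (simp add: l_neg)
  qed
  have 3: "C \<otimes> (B \<ominus> C) = \<zero>"
    using cs C by (simp add: a_minus_def r_distr r_minus r_neg CB CC)
  have 4: "B = C \<oplus> (B \<ominus> C)"
  proof -
    have "C \<oplus> (B \<ominus> C) = B \<oplus> (C \<ominus> C)" using cs C by (simp add: a_minus_def a_lcomm)
    then show ?thesis using cs C by (simp add: a_minus_def r_neg)
  qed
  have "C = \<zero> \<or> B \<ominus> C = \<zero>"
    using B 1 2 3 4 unfolding central_primitive_idem_def by blast
  then show ?thesis using 4 C cs unfolding C_def[symmetric] by (metis r_zero)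
qed

lemma char_poly_2:
  fixes U :: "'f::field mat"
  assumes U: "U \<in> carrier_mat 2 2"
  shows "char_poly U = [:U $$ (0,0) * U $$ (1,1) - U $$ (0,1) * U $$ (1,0),
    - (U $$ (0,0) + U $$ (1,1)), 1:]"
proof -
  have c: "char_poly_matrix U \<in> carrier_mat 2 2" using U by simp
  have d: "det (mat_delete (char_poly_matrix U) 0 0) = char_poly_matrix U $$ (1, 1)"
    "det (mat_delete (char_poly_matrix U) 0 1) = char_poly_matrix U $$ (1, 0)"
    by (subst det_single; use c in \<open>auto simp: mat_delete_def\<close>)+
  have "char_poly U = char_poly_matrix U $$ (0, 0) * char_poly_matrix U $$ (1, 1)
      - char_poly_matrix U $$ (0, 1) * char_poly_matrix U $$ (1, 0)"
    unfolding char_poly_def laplace_expansion_row[OF c zero_less_numeral]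
    by (simp add: cofactor_def d d[unfolded One_nat_def] numeral_2_eq_2 lessThan_Suc)
  also have "\<dots> = [:- U $$ (0,0), 1:] * [:- U $$ (1,1), 1:] - [:- U $$ (0,1):] * [:- U $$ (1,0):]"
    using U by (simp add: char_poly_matrix_def)
  finally show ?thesis by simp
qed

text \<open>The factor \<open>(p + q) - U\<close> is the adjugate of \<open>U\<close>.\<close>
lemma cayley_hamilton_2:
  fixes U :: "'f::field mat"
  assumes U: "U \<in> carrier_mat 2 2" and cp: "char_poly U = [:- p, 1:] * [:- q, 1:]"
  shows "U * ((p + q) \<cdot>\<^sub>m 1\<^sub>m 2 - U) = (p * q) \<cdot>\<^sub>m 1\<^sub>m 2"
proof -
  have e: "U $$ (0,0) * U $$ (1,1) - U $$ (0,1) * U $$ (1,0) = p * q" "U $$ (0,0) + U $$ (1,1) = p + q"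
    using cp[unfolded char_poly_2[OF U]] by (auto simp: algebra_simps minus_equation_iff[of "U $$ _ + _"])
  show ?thesis
  proof (rule eq_matI)
    fix i j :: nat assume "i < dim_row ((p * q) \<cdot>\<^sub>m 1\<^sub>m 2)" "j < dim_col ((p * q) \<cdot>\<^sub>m (1\<^sub>m 2 :: 'f mat))"
    then have "i \<in> {0, 1}" "j \<in> {0, 1}" by auto
    then show "(U * ((p + q) \<cdot>\<^sub>m 1\<^sub>m 2 - U)) $$ (i, j) = ((p * q) \<cdot>\<^sub>m 1\<^sub>m 2) $$ (i, j)"
      using U unfolding e[symmetric]
      by (auto simp: scalar_prod_def numeral_2_eq_2 algebra_simps)
  qed (use U in auto)
qed


locale hecke_extension = invertible_hecke_presentation R d x y z + L: hecke_presentation L d x y z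
  for R L :: "'f::field set" and d x y z +
  assumes R_sub_L: "R \<subseteq> L"
begin

lemma carrier_sub: "carrier F \<subseteq> carrier L.F"
  using R_sub_L by (auto simp: carrier_free_alg subset_eq)

lemma extend_cls: "f \<in> carrier F \<Longrightarrow> hecke_extend L d x y z (cls f) = L.cls f"
  using hecke_extend_class[OF L.hecke_presentation_axioms R_sub_L] .

lemma L_cls_cong: "hc.cong f g \<Longrightarrow> L.cls f = L.cls g"
  using hecke_ideal_mono[OF L.hecke_presentation_axioms R_sub_L] carrier_sub
  by (subst L.cls_eq_iff) (auto simp: hc.cong_def)

lemma cls_cong_iff:
  "f \<in> carrier F \<Longrightarrow> g \<in> carrier F \<Longrightarrow> cls f = cls g \<longleftrightarrow> hc.cong f g"
  by (simp add: cls_eq_iff hc.cong_def)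

lemma central_idem_cls:
  assumes c: "hc.central e" and i: "hc.cong (e * e) e"
  shows "central_idem H (cls e)"
proof -
  have e: "e \<in> carrier F" by (rule hc.central_in_G[OF c])
  have "cls e \<otimes>\<^bsub>H\<^esub> h = h \<otimes>\<^bsub>H\<^esub> cls e" if h: "h \<in> carrier H" for h
  proof -
    obtain f where f: "f \<in> carrier F" "h = cls f" using h by (auto simp: carrier_H)
    then show ?thesis
      using hc.centralD[OF c f(1)] e
      by (simp add: cls_mult) (simp add: cls_cong_iff free_alg_closed[OF R])
  qed
  moreover have "cls e \<otimes>\<^bsub>H\<^esub> cls e = cls e"
    using i e by (simp add: cls_mult) (simp add: cls_cong_iff free_alg_closed[OF R])
  ultimately show ?thesis
    using cls_closed[OF e] unfolding central_idem_def ring_center_def by blast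
qed

definition acts :: "('f free set \<Rightarrow> 'f mat) \<Rightarrow> nat \<Rightarrow> 'f free \<Rightarrow> 'f \<Rightarrow> bool" where
  "acts \<rho> n f r \<longleftrightarrow> \<rho> (L.cls f) = r \<cdot>\<^sub>m 1\<^sub>m n"

context
  fixes n :: nat and \<rho> :: "'f free set \<Rightarrow> 'f mat"
  assumes rep: "hecke_rep L d x y z n \<rho>"
begin

lemma rep_closed: "h \<in> carrier L.H \<Longrightarrow> \<rho> h \<in> carrier_mat n n"
  and rep_mult: "h \<in> carrier L.H \<Longrightarrow> h' \<in> carrier L.H \<Longrightarrow> \<rho> (h \<otimes>\<^bsub>L.H\<^esub> h') = \<rho> h * \<rho> h'"
  and rep_add: "h \<in> carrier L.H \<Longrightarrow> h' \<in> carrier L.H \<Longrightarrow> \<rho> (h \<oplus>\<^bsub>L.H\<^esub> h') = \<rho> h + \<rho> h'"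
  and rep_one: "\<rho> \<one>\<^bsub>L.H\<^esub> = 1\<^sub>m n"
  using rep unfolding hecke_rep_def Ring.ring_hom_def mat_alg_def by (auto simp: ring_mat_def)

lemma L_cls_closed: "f \<in> carrier F \<Longrightarrow> L.cls f \<in> carrier L.H"
  using carrier_sub by (auto intro: L.cls_closed)

lemma rep_cls_mult: "f \<in> carrier F \<Longrightarrow> g \<in> carrier F \<Longrightarrow>
    \<rho> (L.cls (f * g)) = \<rho> (L.cls f) * \<rho> (L.cls g)"
  using carrier_sub by (simp add: L.cls_mult[symmetric] rep_mult L_cls_closed subset_eq)

lemma rep_cls_add: "f \<in> carrier F \<Longrightarrow> g \<in> carrier F \<Longrightarrow>
    \<rho> (L.cls (f + g)) = \<rho> (L.cls f) + \<rho> (L.cls g)"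
  using carrier_sub by (simp add: L.cls_add[symmetric] rep_add L_cls_closed subset_eq)

lemma rep_cls_carrier: "f \<in> carrier F \<Longrightarrow> \<rho> (L.cls f) \<in> carrier_mat n n"
  by (intro rep_closed L_cls_closed)

lemma acts_const: "r \<in> R \<Longrightarrow> acts \<rho> n (fconst r) r"
  using rep R_sub_L by (auto simp: acts_def hecke_rep_def)

lemma acts_add:
  "f \<in> carrier F \<Longrightarrow> g \<in> carrier F \<Longrightarrow> acts \<rho> n f r \<Longrightarrow> acts \<rho> n g r' \<Longrightarrow> acts \<rho> n (f + g) (r + r')"
  by (simp add: acts_def rep_cls_add add_smult_distrib_right_mat[of _ n n])

lemma acts_mult:
  "f \<in> carrier F \<Longrightarrow> g \<in> carrier F \<Longrightarrow> acts \<rho> n f r \<Longrightarrow> acts \<rho> n g r' \<Longrightarrow> acts \<rho> n (f * g) (r * r')"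
  by (simp add: acts_def rep_cls_mult mult_smult_assoc_mat[of _ n n _ n] mult_smult_distrib[of _ n n _ n])
    (rule eq_matI, auto)

lemma acts_cong: "hc.cong f g \<Longrightarrow> acts \<rho> n f r \<longleftrightarrow> acts \<rho> n g r"
  by (simp add: acts_def L_cls_cong)

lemma acts_norm:
  assumes h: "h \<in> poly_over R" and t: "acts \<rho> n hc.tau (p + q)" and o: "acts \<rho> n hc.omega (p * q)"
  shows "acts \<rho> n (hc.ev h (fgen GU) * hc.ev h hc.ubar) (poly h p * poly h q)"
proof -
  obtain c where "acts \<rho> n c (poly h p * poly h q)" "hc.cong (hc.ev h (fgen GU) * hc.ev h hc.ubar) c"
    using hc.norm_value[of h "acts \<rho> n" p q, OF h acts_const acts_add acts_mult t o] by blast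
  then show ?thesis using acts_cong by blast
qed

text \<open>The second value \<open>q\<close> is the member of \<open>linear_values (r r')\<close> that belongs to \<open>p\<close>.\<close>
lemma acts_conjugates_linear:
  assumes "acts \<rho> n (fgen GS) r" "acts \<rho> n (fgen GT) r'" "acts \<rho> n (fgen GU) p"
  defines "q \<equiv> inverse hc.det_st * ((r * r') * (r * r')) * p"
  shows "acts \<rho> n hc.tau (p + q)" "acts \<rho> n hc.omega (p * q)"
proof -
  note G = hc.elems_G fconst_in_free_alg[OF R hc.det_st_inv(1)] free_alg_closed[OF R]
  have "acts \<rho> n hc.ubar (inverse hc.det_st * (r * r') * (r * r' * p))"
    unfolding hc.ubar_def using G hc.det_st_inv by (intro acts_mult acts_const assms) auto
  then have "acts \<rho> n hc.tau (p + inverse hc.det_st * (r * r') * (r * r' * p))"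
    unfolding hc.tau_def using G by (intro acts_add assms) auto
  then show "acts \<rho> n hc.tau (p + q)" by (simp add: q_def mult_ac)
  have "acts \<rho> n hc.omega (inverse hc.det_st * (r * r' * p) * (r * r' * p))"
    unfolding hc.omega_def using G hc.det_st_inv by (intro acts_mult acts_const assms) auto
  then show "acts \<rho> n hc.omega (p * q)" by (simp add: q_def mult_ac)
qed

text \<open>The product \<open>ubar u = omega\<close> acts as \<open>r\<^sup>2 / det_st = pq\<close>, and so does the product of the adjugate
  of \<open>u\<close> with \<open>u\<close>. Hence \<open>ubar\<close> acts as the adjugate, and \<open>tau\<close> as the trace of \<open>u\<close>.\<close>
lemma acts_conjugates_quadratic:
  assumes n: "n = 2" and cp: "char_poly (\<rho> (L.cls (fgen GU))) = [:- p, 1:] * [:- q, 1:]"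
    and w: "acts \<rho> n (fgen GS * fgen GT * fgen GU) r" and r: "r * r = hc.det_st * (p * q)" and nz: "p * q \<noteq> 0"
  shows "acts \<rho> n hc.tau (p + q)" "acts \<rho> n hc.omega (p * q)"
proof -
  note G = hc.elems_G fconst_in_free_alg[OF R hc.det_st_inv(1)] free_alg_closed[OF R]
  have "acts \<rho> n hc.omega (inverse hc.det_st * r * r)"
    unfolding hc.omega_def using G hc.det_st_inv by (intro acts_mult acts_const w) auto
  moreover have "inverse hc.det_st * r * r = p * q"
  proof -
    have "inverse hc.det_st * r * r = inverse hc.det_st * (hc.det_st * (p * q))" by (simp only: mult.assoc r)
    also have "\<dots> = (inverse hc.det_st * hc.det_st) * (p * q)" by (simp only: mult.assoc)
    also have "\<dots> = p * q" using hc.det_st_inv(3) by simp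
    finally show ?thesis .
  qed
  ultimately show omega: "acts \<rho> n hc.omega (p * q)" by simp
  define U where "U = \<rho> (L.cls (fgen GU))"
  define V where "V = \<rho> (L.cls hc.ubar)"
  have c: "U \<in> carrier_mat 2 2" "V \<in> carrier_mat 2 2"
    unfolding U_def V_def n[symmetric] using G by (auto intro!: rep_cls_carrier)
  have VU: "V * U = (p * q) \<cdot>\<^sub>m 1\<^sub>m 2"
    using acts_cong[OF hc.ubar_u] omega G
    by (simp add: acts_def rep_cls_mult U_def V_def n)
  define W where "W = (p + q) \<cdot>\<^sub>m 1\<^sub>m 2 - U"
  have W: "W \<in> carrier_mat 2 2" unfolding W_def using c by auto
  have UW: "U * W = (p * q) \<cdot>\<^sub>m 1\<^sub>m 2"
    unfolding W_def using cp c by (intro cayley_hamilton_2) (auto simp: U_def)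
  have "(p * q) \<cdot>\<^sub>m V = V * (U * W)"
    unfolding UW using c by (simp add: mult_smult_distrib[of _ 2 2 _ 2])
  also have "\<dots> = (V * U) * W" using c W by (simp add: assoc_mult_mat[of _ 2 2 _ 2 _ 2])
  also have "\<dots> = (p * q) \<cdot>\<^sub>m W" unfolding VU using W by (simp add: mult_smult_assoc_mat[of _ 2 2 _ 2])
  finally have "V $$ ij = W $$ ij" if "fst ij < 2" "snd ij < 2" for ij
    using nz c W that by (cases ij) (auto dest!: arg_cong[of _ _ "\<lambda>M. M $$ ij"])
  then have "V = W" using c W by (intro eq_matI) auto
  then have "U + V = (p + q) \<cdot>\<^sub>m 1\<^sub>m 2" unfolding W_def using c by (intro eq_matI) auto
  then show "acts \<rho> n hc.tau (p + q)"
    using G unfolding acts_def hc.tau_def by (simp add: rep_cls_add U_def V_def n)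
qed

lemma mat_tr_scalar: "mat_tr (r \<cdot>\<^sub>m 1\<^sub>m m) = of_nat m * (r :: 'f)"
  by (simp add: mat_tr_def)

text \<open>The idempotent \<open>e'\<close> of the character lies below \<open>B\<close>. If \<open>Be = B\<close>, then \<open>e'e = e'\<close> has trace \<open>n\<close>;
  otherwise \<open>Be = 0\<close>, and \<open>e'e = 0\<close> has trace \<open>0\<close>. This trace is \<open>n v\<close>.\<close>
lemma block_determines_action:
  assumes n: "of_nat n \<noteq> (0 :: 'f)"
    and B: "central_primitive_idem H B" and e: "hc.central e" "hc.cong (e * e) e"
    and f: "\<And>h. h \<in> carrier L.H \<Longrightarrow> f h = mat_tr (\<rho> h)"
    and e': "e' \<in> carrier L.H" "\<And>h. h \<in> carrier L.H \<Longrightarrow> f (e' \<otimes>\<^bsub>L.H\<^esub> h) = f h"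
    and e'B: "e' \<otimes>\<^bsub>L.H\<^esub> hecke_extend L d x y z B = e'"
    and v: "acts \<rho> n e v"
  shows "v = of_bool (B \<otimes>\<^bsub>H\<^esub> cls e = B)"
proof -
  interpret LH: ring L.H by (rule L.ring_H)
  have eG: "e \<in> carrier F" by (rule hc.central_in_G[OF e(1)])
  have "B \<in> carrier H" "B \<noteq> \<zero>\<^bsub>H\<^esub>"
    using B by (auto simp: central_primitive_idem_def central_idem_def ring_center_def)
  then obtain b where b: "b \<in> carrier F" "B = cls b" by (auto simp: carrier_H)
  have f1: "f \<one>\<^bsub>L.H\<^esub> = of_nat n"
    using f[OF LH.one_closed] by (simp add: rep_one mat_tr_def)
  have f0: "f \<zero>\<^bsub>L.H\<^esub> = 0"
  proof -
    have "\<rho> \<zero>\<^bsub>L.H\<^esub> + \<rho> \<zero>\<^bsub>L.H\<^esub> = \<rho> \<zero>\<^bsub>L.H\<^esub>" using rep_add[of "\<zero>\<^bsub>L.H\<^esub>" "\<zero>\<^bsub>L.H\<^esub>"] by simp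
    then have "(\<rho> \<zero>\<^bsub>L.H\<^esub> + \<rho> \<zero>\<^bsub>L.H\<^esub>) $$ (i, i) = \<rho> \<zero>\<^bsub>L.H\<^esub> $$ (i, i)" for i by simp
    then have "\<rho> \<zero>\<^bsub>L.H\<^esub> $$ (i, i) = 0" if "i < n" for i
      using rep_closed[OF LH.zero_closed] that by (metis add_cancel_right_left carrier_matD index_add_mat(1))
    then show ?thesis
      using f[OF LH.zero_closed] rep_closed[OF LH.zero_closed] by (auto simp: mat_tr_def intro!: sum.neutral)
  qed
  have fe: "f (e' \<otimes>\<^bsub>L.H\<^esub> L.cls e) = of_nat n * v"
    using v e'(2)[of "L.cls e"] f[of "L.cls e"] L_cls_closed[OF eG]
    by (simp add: acts_def mat_tr_scalar)
  have "e' \<otimes>\<^bsub>L.H\<^esub> L.cls e = (e' \<otimes>\<^bsub>L.H\<^esub> L.cls b) \<otimes>\<^bsub>L.H\<^esub> L.cls e"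
    using e'B b by (simp add: extend_cls)
  also have "\<dots> = e' \<otimes>\<^bsub>L.H\<^esub> L.cls (b * e)"
    using e' b eG L_cls_closed carrier_sub
    by (simp add: LH.m_assoc L.cls_mult subset_eq)
  finally have e'e: "e' \<otimes>\<^bsub>L.H\<^esub> L.cls e = e' \<otimes>\<^bsub>L.H\<^esub> L.cls (b * e)" .
  have be: "b * e \<in> carrier F" by (intro free_alg_closed R b eG)
  consider "B \<otimes>\<^bsub>H\<^esub> cls e = B" | "B \<otimes>\<^bsub>H\<^esub> cls e = \<zero>\<^bsub>H\<^esub>"
    using ring.primitive_idem_dichotomy[OF ring_H B central_idem_cls[OF e]] by blast
  then show ?thesis
  proof cases
    case 1
    then have "hc.cong (b * e) b" using b eG be by (simp add: cls_mult cls_cong_iff)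
    then have "e' \<otimes>\<^bsub>L.H\<^esub> L.cls e = e'" using e'e e'B b by (simp add: L_cls_cong extend_cls)
    then have "of_nat n * v = f (e' \<otimes>\<^bsub>L.H\<^esub> \<one>\<^bsub>L.H\<^esub>)" using fe e' by simp
    then have "of_nat n * v = of_nat n" using e'(2)[OF LH.one_closed] f1 by simp
    then show ?thesis using n 1 by simp
  next
    case 2
    then have "hc.cong (b * e) 0"
      using b eG be by (simp add: cls_mult cls_zero cls_cong_iff free_alg_closed[OF R])
    then have "e' \<otimes>\<^bsub>L.H\<^esub> L.cls e = \<zero>\<^bsub>L.H\<^esub>"
      using e'e e' by (simp add: L_cls_cong L.cls_zero[symmetric])
    then have "of_nat n * v = 0" using fe f0 by simp
    then show ?thesis using n 2 \<open>B \<noteq> \<zero>\<^bsub>H\<^esub>\<close> by simp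
  qed
qed

end
end

section \<open>Roots of unity and constants in \<open>K(y)\<close>\<close>

lemma rconst_simps [simp]: "rconst 0 = 0" "rconst 1 = 1" "rconst w = 0 \<longleftrightarrow> w = 0"
  by (simp_all add: rconst_def one_pCons[symmetric])

lemma rconst_add: "rconst (v + w) = rconst v + rconst w"
  by (simp add: rconst_def to_fract_add[symmetric])

lemma rconst_eq_1_iff [simp]: "rconst w = 1 \<longleftrightarrow> w = 1"
proof
  assume "rconst w = 1"
  then have "to_fract [:w:] = to_fract [:1:]" by (simp add: rconst_def one_pCons[symmetric])
  then show "w = 1" by (simp only: to_fract_eq_iff) simp
qed simp

lemma rconst_uminus: "rconst (- w) = - rconst w"
  using rconst_add[of w "- w"] by (simp add: minus_unique)

lemma rconst_power: "rconst (w ^ k) = rconst w ^ k"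
  by (induction k) (simp_all add: rconst_mult)

lemma rconst_inverse: "rconst (inverse w) = inverse (rconst w)"
proof (cases "w = 0")
  case False
  then have "rconst w * rconst (inverse w) = 1" by (simp add: rconst_mult[symmetric])
  then show ?thesis by (simp add: inverse_unique)
qed simp

lemma rvar_nonzero [simp]: "rvar \<noteq> 0"
  by (simp add: rvar_def)

lemma rvar_power: "rvar ^ m = to_fract (Polynomial.monom 1 m)"
  by (induction m) (simp_all add: rvar_def monom_altdef one_pCons[symmetric] flip: to_fract_mult)

lemma rvar_power_neq_1:
  assumes "m \<ge> 1" shows "rvar ^ m \<noteq> 1"
proof
  assume "rvar ^ m = 1"
  then have "to_fract (Polynomial.monom 1 m :: complex poly) = to_fract 1" by (simp add: rvar_power)
  then have "Polynomial.degree (Polynomial.monom 1 m :: complex poly) = Polynomial.degree (1 :: complex poly)"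
    by (simp only: to_fract_eq_iff)
  then show False using assms by (simp add: degree_monom_eq)
qed

lemma zeta_power_cis: "zeta n ^ k = cis (2 * pi * real k / real n)"
proof -
  have "zeta n = cis (2 * pi / real n)"
    by (simp add: zeta_def cis_conv_exp mult_ac)
  then show ?thesis by (simp add: Complex.DeMoivre mult_ac)
qed

lemma zeta_power_self: "n \<ge> 1 \<Longrightarrow> zeta n ^ n = 1"
  by (simp add: zeta_power_cis)

lemma zeta_power_inj:
  assumes "k < n" "l < n" "zeta n ^ k = zeta n ^ l" shows "k = l"
  using bij_betw_roots_unity[of n] assms by (auto simp: bij_betw_def inj_on_def zeta_power_cis)

lemma zeta_nonzero [simp]: "zeta n \<noteq> 0"
  by (simp add: zeta_def)

lemma zeta_double_square: "d \<ge> 1 \<Longrightarrow> zeta (2 * d) ^ 2 = zeta d"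
  unfolding zeta_def by (simp add: exp_double[symmetric] field_simps)

section \<open>The Rouquier ring\<close>

lemma subring_set_rouquier_ring: "subring_set (rouquier_ring d)"
  unfolding subring_set_def rouquier_ring_def
  using generate_ring.one[of "class_ring :: ratfun ring"]
    generate_ring.a_inv[of _ "class_ring :: ratfun ring"]
    generate_ring.eng_add[of _ "class_ring :: ratfun ring"]
    generate_ring.eng_mult[of _ "class_ring :: ratfun ring"]
  by (auto simp: class_ring_simps)

lemma generate_field_inverse:
  "h \<in> generate_field class_ring S \<Longrightarrow> inverse h \<in> generate_field class_ring (S :: 'f::field set)"
proof (cases "h = 0")
  case False
  assume "h \<in> generate_field class_ring S"
  with False show ?thesis
    using generate_field.m_inv[of h "class_ring :: 'f ring" S] by (simp add: class_ring_simps)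
qed simp

lemma subring_set_generate_field: "subring_set (generate_field class_ring (S :: 'f::field set))"
  unfolding subring_set_def
  using generate_field.one[of "class_ring :: 'f ring"]
    generate_field.a_inv[of _ "class_ring :: 'f ring"]
    generate_field.eng_add[of _ "class_ring :: 'f ring"]
    generate_field.eng_mult[of _ "class_ring :: 'f ring"]
  by (auto simp: class_ring_simps)

lemma rouquier_ring_incl:
  "w \<in> cyc_integers d \<Longrightarrow> rconst w \<in> rouquier_ring d"
  "rvar \<in> rouquier_ring d" "inverse rvar \<in> rouquier_ring d"
  "n \<ge> 1 \<Longrightarrow> inverse (rvar ^ n - 1) \<in> rouquier_ring d"
  unfolding rouquier_ring_def by (auto intro!: generate_ring.incl)

lemma rouquier_ring_sub_Ky: "rouquier_ring d \<subseteq> Ky d"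
proof
  note K = subring_set_generate_field[of "rconst ` cyc_field d \<union> {rvar}", folded Ky_def]
  have rvar: "rvar \<in> Ky d" unfolding Ky_def by (intro generate_field.incl) auto
  fix h assume "h \<in> rouquier_ring d"
  then show "h \<in> Ky d" unfolding rouquier_ring_def
  proof induction
    case (incl h)
    have "inverse rvar \<in> Ky d" "\<And>n. inverse (rvar ^ n - 1) \<in> Ky d"
      using rvar K unfolding Ky_def
      by (auto intro!: generate_field_inverse subring_setD subring_set_power)
    moreover have "rconst w \<in> Ky d" if "w \<in> cyc_integers d" for w
      using that unfolding Ky_def cyc_integers_def by (intro generate_field.incl) auto
    ultimately show ?case using incl rvar by auto
  qed (use K in \<open>auto simp: subring_setD class_ring_simps\<close>)
qed

lemma zeta_in_cyc_integers:
  assumes "d \<ge> 1" shows "zeta d ^ k \<in> cyc_integers d"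
proof -
  note K = subring_set_generate_field[of "{zeta (2 * d)}", folded cyc_field_def]
  have "zeta (2 * d) \<in> cyc_field d" unfolding cyc_field_def by (intro generate_field.incl) auto
  then have "zeta d ^ k \<in> cyc_field d"
    unfolding zeta_double_square[OF assms, symmetric] by (intro subring_set_power K)
  moreover have "algebraic_int (zeta d ^ k)"
  proof (rule algebraic_int_root)
    have "(zeta d ^ k) ^ d = 1"
      using zeta_power_self[OF assms] by (simp add: power_mult[symmetric] mult.commute[of k]) (simp add: power_mult)
    then show "poly (Polynomial.monom 1 d) (zeta d ^ k) = 1" by (simp add: poly_monom)
  qed (use assms in \<open>auto simp: degree_monom_eq Polynomial.coeff_monom\<close>)
  ultimately show ?thesis by (simp add: cyc_integers_def)
qed

text \<open>All parameters \<open>z\<^sub>k\<close> and all values of \<open>ubar\<close> are of this form.\<close>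
definition qmon :: "nat \<Rightarrow> nat \<Rightarrow> int \<Rightarrow> ratfun" where
  "qmon d k m = rconst (zeta d ^ k) * qpar d powi m"

lemma qpar_nonzero [simp]: "qpar d \<noteq> 0" by (simp add: qpar_def)

lemma qmon_nonzero [simp]: "qmon d k m \<noteq> 0" by (simp add: qmon_def)

lemma qmon_mult: "qmon d k m * qmon d l m' = qmon d (k + l) (m + m')"
  by (simp add: qmon_def rconst_mult power_add power_int_add)

lemma qmon_inverse:
  assumes "d \<ge> 1" shows "inverse (qmon d k m) = qmon d ((d - 1) * k) (- m)"
proof -
  have "k + (d - 1) * k = d * k" using assms by (cases d) auto
  then have "qmon d k m * qmon d ((d - 1) * k) (- m) = 1"
    using zeta_power_self[OF assms] by (simp add: qmon_mult) (simp add: qmon_def power_mult)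
  then show ?thesis by (simp add: inverse_unique)
qed

lemma qmon_in_rouquier_ring:
  assumes "d \<ge> 1" shows "qmon d k m \<in> rouquier_ring d"
proof -
  note R = subring_set_rouquier_ring[of d]
  have "qpar d powi m \<in> rouquier_ring d"
    unfolding qpar_def power_int_def power_inverse[symmetric]
    by (auto intro!: subring_set_power R rouquier_ring_incl)
  then show ?thesis unfolding qmon_def
    using rouquier_ring_incl(1)[OF zeta_in_cyc_integers[OF assms]] R by (intro subring_setD) auto
qed

text \<open>The quotient \<open>g\<close> of the two monomials satisfies \<open>g\<^sup>d = y\<^sup>N\<close> with \<open>N \<ge> 1\<close>, up to exchanging them.
  Thus \<open>g - 1\<close> divides \<open>y\<^sup>N - 1\<close>, which is invertible in the Rouquier ring.\<close>
lemma qmon_diff_unit: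
  assumes d: "d \<ge> 1" and mu: "card (cyc_mu d) > 0" and m: "m \<noteq> m'"
  shows "qmon d k m \<noteq> qmon d k' m' \<and> inverse (qmon d k m - qmon d k' m') \<in> rouquier_ring d"
proof -
  note R = subring_set_rouquier_ring[of d]
  have *: "qmon d k m \<noteq> qmon d k' m' \<and> inverse (qmon d k m - qmon d k' m') \<in> rouquier_ring d"
    if "m' < m" for k k' m m'
  proof -
    define l where "l = k + (d - 1) * k'"
    define N where "N = card (cyc_mu d) * (nat (m - m') * d)"
    define g where "g = qmon d l (m - m')"
    have g: "qmon d k m = qmon d k' m' * g"
    proof -
      have "k' + l = k + d * k'" using d by (cases d) (auto simp: l_def)
      then have "qmon d k' m' * g = qmon d (k + d * k') m" by (simp add: g_def qmon_mult)
      also have "\<dots> = qmon d k m"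
        using zeta_power_self[OF d] by (simp add: qmon_def power_add power_mult)
      finally show ?thesis by simp
    qed
    have N: "N \<ge> 1" using mu d that by (simp add: N_def)
    have "(zeta d ^ l) ^ d = 1"
      using zeta_power_self[OF d] by (metis mult.commute power_mult power_one)
    then have "g ^ d = (qpar d powi (m - m')) ^ d"
      by (simp add: g_def qmon_def power_mult_distrib rconst_power[symmetric])
    also have "qpar d powi (m - m') = rvar ^ (card (cyc_mu d) * nat (m - m'))"
      using that by (simp add: qpar_def power_int_def power_mult)
    finally have gd: "g ^ d = rvar ^ N" by (simp add: N_def power_mult[symmetric] mult.assoc)
    have gd1: "g ^ d - 1 \<noteq> 0" using rvar_power_neq_1[OF N] by (simp add: gd)
    then have g1: "g - 1 \<noteq> 0" by auto
    have "g ^ d - 1 = (g - 1) * (\<Sum>i<d. g ^ i)" by (rule power_diff_1_eq)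
    then have "inverse (g - 1) = (\<Sum>i<d. g ^ i) * inverse (g ^ d - 1)"
      using g1 gd1 by (simp add: field_simps)
    moreover have "(\<Sum>i<d. g ^ i) \<in> rouquier_ring d"
      unfolding g_def using d R by (intro subring_set_sum subring_set_power qmon_in_rouquier_ring)
    ultimately have "inverse (g - 1) \<in> rouquier_ring d"
      using rouquier_ring_incl(4)[OF N] R by (simp add: gd subring_setD)
    moreover have "inverse (qmon d k' m') \<in> rouquier_ring d"
      unfolding qmon_inverse[OF d] using d by (rule qmon_in_rouquier_ring)
    moreover have "qmon d k m - qmon d k' m' = qmon d k' m' * (g - 1)"
      unfolding g by (simp add: algebra_simps)
    ultimately show ?thesis using g1 R by (auto simp: subring_setD)
  qed
  show ?thesis
  proof (cases "m' < m")
    case False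
    then have "m < m'" using m by simp
    from *[OF this, of k' k]
    have "qmon d k' m' \<noteq> qmon d k m" "- inverse (qmon d k' m' - qmon d k m) \<in> rouquier_ring d"
      using R by (auto simp: subring_setD)
    then show ?thesis by (simp flip: inverse_minus_eq)
  qed (rule *)
qed

section \<open>Exponents of the characters in a block\<close>

lemma zs_qmon: "zs d c k = qmon d k (c k)"
  by (simp add: zs_def qmon_def)

lemma hecke_extension_cyclotomic:
  assumes d: "d \<ge> 1"
  shows "hecke_extension (rouquier_ring d) (Ky d) d (xs d a) (ys d b) (zs d c)"
proof -
  note R = subring_set_rouquier_ring[of d]
  have q: "qpar d powi m \<in> rouquier_ring d" for m
    using qmon_in_rouquier_ring[OF d, of 0 m] by (simp add: qmon_def)
  have 1: "xs d a i \<in> rouquier_ring d" "inverse (xs d a i) \<in> rouquier_ring d" "xs d a i \<noteq> 0" for a i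
    using q R by (auto simp: xs_def subring_setD subring_set_power power_int_minus[symmetric] power_inverse[symmetric])
  have 2: "ys d b j \<in> rouquier_ring d" "inverse (ys d b j) \<in> rouquier_ring d" "ys d b j \<noteq> 0" for b j
    using 1[of b j] by (simp_all add: ys_def xs_def)
  have 3: "zs d c k \<in> rouquier_ring d" "inverse (zs d c k) \<in> rouquier_ring d" "zs d c k \<noteq> 0" for k
    using d by (simp_all add: zs_qmon qmon_in_rouquier_ring qmon_inverse)
  have "subring_set (Ky d)" unfolding Ky_def by (rule subring_set_generate_field)
  then show ?thesis
    using 1 2 3 R rouquier_ring_sub_Ky[of d]
    by unfold_locales auto
qed

text \<open>The exponents of \<open>q\<close> in the two values of \<open>(u, ubar)\<close> on the character.\<close>
fun char_exponents ::
  "(nat \<Rightarrow> int) \<Rightarrow> (nat \<Rightarrow> int) \<Rightarrow> (nat \<Rightarrow> int) \<Rightarrow> hecke_char \<Rightarrow> int \<times> int" where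
  "char_exponents a b c (Lin i j k) = (c k, c k + (a i - a (1 - i)) + (b j - b (1 - j)))"
| "char_exponents a b c (Quad k l \<epsilon>) = (c k, c l)"

lemma of_nat_2_ratfun: "of_nat 2 \<noteq> (0 :: ratfun)"
proof -
  have "of_nat 2 = rconst (1 + 1)" by (simp only: rconst_add) simp
  also have "\<dots> \<noteq> 0" by simp
  finally show ?thesis .
qed

lemma xs_square: "xs d a i * xs d a i = qmon d 0 (2 * a i)"
proof -
  have "xs d a i * xs d a i = ((- 1) ^ i * (- 1) ^ i) * (qpar d powi a i * qpar d powi a i)"
    by (simp add: xs_def mult_ac)
  also have "(- 1 :: ratfun) ^ i * (- 1) ^ i = 1" by (simp flip: power_mult_distrib)
  also have "qpar d powi a i * qpar d powi a i = qpar d powi (a i + a i)"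
    by (simp only: power_int_add[OF disjI1[OF qpar_nonzero]])
  finally show ?thesis by (simp add: qmon_def)
qed

lemma xs_xs: "xs d a 0 * xs d a 1 = - qmon d 0 (a 0 + a 1)"
  by (simp add: xs_def qmon_def power_int_add)

lemma ys_xs: "ys d = xs d"
  by (simp add: fun_eq_iff xs_def ys_def)

context
  fixes d :: nat and a b c :: "nat \<Rightarrow> int"
  assumes d: "d \<ge> 1"
begin

interpretation E: hecke_extension "rouquier_ring d" "Ky d" d "xs d a" "ys d b" "zs d c"
  by (rule hecke_extension_cyclotomic[OF d])

lemma det_st_qmon: "E.hc.det_st = qmon d 0 (a 0 + a 1 + b 0 + b 1)"
proof -
  have "E.hc.det_st = (xs d a 0 * xs d a 1) * (xs d b 0 * xs d b 1)"
    unfolding E.hc.det_st_def by (simp only: ys_xs)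
  then show ?thesis unfolding xs_xs by (simp add: qmon_mult add.assoc)
qed

lemma linear_value_qmon:
  "\<exists>k'. inverse E.hc.det_st * ((xs d a i * ys d b j) * (xs d a i * ys d b j)) * zs d c k
    = qmon d k' (2 * a i + 2 * b j - (a 0 + a 1 + b 0 + b 1) + c k)"
proof -
  have "(xs d a i * ys d b j) * (xs d a i * ys d b j) = (xs d a i * xs d a i) * (xs d b j * xs d b j)"
    by (simp only: ys_xs mult_ac)
  also have "\<dots> = qmon d 0 (2 * a i + 2 * b j)" by (simp add: xs_square qmon_mult)
  finally have sq: "(xs d a i * ys d b j) * (xs d a i * ys d b j) = qmon d 0 (2 * a i + 2 * b j)" .
  have "inverse E.hc.det_st * ((xs d a i * ys d b j) * (xs d a i * ys d b j)) * zs d c k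
      = qmon d k (- (a 0 + a 1 + b 0 + b 1) + (2 * a i + 2 * b j) + c k)"
    unfolding sq det_st_qmon qmon_inverse[OF d] zs_qmon qmon_mult by simp
  also have "- (a 0 + a 1 + b 0 + b 1) + (2 * a i + 2 * b j) + c k
      = 2 * a i + 2 * b j - (a 0 + a 1 + b 0 + b 1) + c k" by simp
  finally show ?thesis by blast
qed

lemma eigenvalues_qmon:
  assumes "r \<in> set E.hc.eigenvalues" obtains k m where "r = qmon d k m"
proof -
  consider k where "r = zs d c k"
    | v k where "v \<in> set E.hc.st_values" "r = inverse E.hc.det_st * (v * v) * zs d c k"
    using assms unfolding E.hc.eigenvalues_def E.hc.linear_values_def by auto
  then show thesis
  proof cases
    case 1
    then show thesis using that by (simp add: zs_qmon)
  next
    case 2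
    then obtain i j where "v = xs d a i * ys d b j"
      unfolding E.hc.st_values_def by auto
    then show thesis using linear_value_qmon[of i j k] 2 that by auto
  qed
qed

text \<open>For a linear character the second value is \<open>z\<^sub>k (x\<^sub>iy\<^sub>j)\<^sup>2 / (x\<^sub>0x\<^sub>1y\<^sub>0y\<^sub>1)\<close>; its exponent is the one in
  \<open>char_exponents\<close> because \<open>2a\<^sub>i - a\<^sub>0 - a\<^sub>1 = a\<^sub>i - a\<^sub>1\<^sub>-\<^sub>i\<close>.\<close>
lemma specialized_char_acts:
  assumes "specialized_char d a b c \<chi> f"
  obtains n \<rho> k k' where
    "hecke_rep (Ky d) d (xs d a) (ys d b) (zs d c) n \<rho>" "of_nat n \<noteq> (0 :: ratfun)"
    "\<forall>h\<in>carrier (KyH d a b c). f h = mat_tr (\<rho> h)"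
    "E.acts \<rho> n E.hc.tau (qmon d k (fst (char_exponents a b c \<chi>)) + qmon d k' (snd (char_exponents a b c \<chi>)))"
    "E.acts \<rho> n E.hc.omega (qmon d k (fst (char_exponents a b c \<chi>)) * qmon d k' (snd (char_exponents a b c \<chi>)))"
    "qmon d k (fst (char_exponents a b c \<chi>)) \<in> set E.hc.eigenvalues"
    "qmon d k' (snd (char_exponents a b c \<chi>)) \<in> set E.hc.eigenvalues"
proof -
  have irr: "hecke_irr d \<chi>" using assms unfolding specialized_char_def by (rule conjunct1)
  from assms[unfolded specialized_char_def, THEN conjunct2] obtain n \<rho> where
    *: "irreducible_hecke_rep (Ky d) d (xs d a) (ys d b) (zs d c) n \<rho> \<and>
      affords (Ky d) d (xs d a) (ys d b) (zs d c) (xs_root d a) (ys_root d b) (zs_root d c) n \<rho> \<chi> \<and>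
      (\<forall>h\<in>carrier (KyH d a b c). f h = mat_tr (\<rho> h))" by (elim exE)
  have rep: "hecke_rep (Ky d) d (xs d a) (ys d b) (zs d c) n \<rho>"
    using *[THEN conjunct1] unfolding irreducible_hecke_rep_def by (rule conjunct1)
  have aff: "affords (Ky d) d (xs d a) (ys d b) (zs d c) (xs_root d a) (ys_root d b) (zs_root d c) n \<rho> \<chi>"
    using *[THEN conjunct2] by (rule conjunct1)
  note f = *[THEN conjunct2, THEN conjunct2]
  show thesis
  proof (cases \<chi>)
    case (Lin i j k)
    have n: "n = 1" and k: "k < d" and ij: "i \<in> {0, 1}" "j \<in> {0, 1}" using aff irr Lin by auto
    obtain k' where k': "inverse E.hc.det_st * ((xs d a i * ys d b j) * (xs d a i * ys d b j)) * zs d c k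
        = qmon d k' (2 * a i + 2 * b j - (a 0 + a 1 + b 0 + b 1) + c k)"
      using linear_value_qmon by blast
    have "2 * a i + 2 * b j - (a 0 + a 1 + b 0 + b 1) + c k = snd (char_exponents a b c \<chi>)"
      using ij Lin by auto
    note k' = k'[unfolded this]
    have act: "E.acts \<rho> n (fgen GS) (xs d a i)" "E.acts \<rho> n (fgen GT) (ys d b j)"
      "E.acts \<rho> n (fgen GU) (zs d c k)"
      using aff Lin n by (auto simp: E.acts_def)
    have 1: "zs d c k = qmon d k (fst (char_exponents a b c \<chi>))" by (simp add: zs_qmon Lin)
    have m1: "zs d c k \<in> set E.hc.eigenvalues" unfolding E.hc.eigenvalues_def using k by auto
    have "xs d a i * ys d b j \<in> set E.hc.st_values"
      unfolding E.hc.st_values_def using ij by auto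
    then have m2: "inverse E.hc.det_st * ((xs d a i * ys d b j) * (xs d a i * ys d b j)) * zs d c k
        \<in> set E.hc.eigenvalues"
      unfolding E.hc.eigenvalues_def E.hc.linear_values_def using k by fastforce
    note acts = E.acts_conjugates_linear[OF rep act, unfolded k', unfolded 1]
    show thesis
      by (rule that[OF rep _ f acts m1[unfolded 1] m2[unfolded k']]) (simp_all add: n)
  next
    case (Quad k l \<epsilon>)
    have n: "n = 2" and kl: "k < d" "l < d" and \<epsilon>: "\<epsilon> = 1 \<or> \<epsilon> = - 1" using aff irr Quad by auto
    define r where "r = of_int \<epsilon> * xs_root d a 0 * xs_root d a 1 * ys_root d b 0 * ys_root d b 1
      * zs_root d c k * zs_root d c l"
    have "r * r = (of_int \<epsilon>)\<^sup>2 * (xs_root d a 0)\<^sup>2 * (xs_root d a 1)\<^sup>2 * (ys_root d b 0)\<^sup>2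
        * (ys_root d b 1)\<^sup>2 * (zs_root d c k)\<^sup>2 * (zs_root d c l)\<^sup>2"
      unfolding r_def power2_eq_square by (simp only: mult_ac)
    also have "\<dots> = E.hc.det_st * (zs d c k * zs d c l)"
      unfolding roots_square(1,2) roots_square(3)[OF d] E.hc.det_st_def using \<epsilon> by (auto simp: mult_ac)
    finally have r: "r * r = E.hc.det_st * (zs d c k * zs d c l)" .
    have cp: "char_poly (\<rho> (hecke_class (Ky d) d (xs d a) (ys d b) (zs d c) (fgen GU)))
        = [:- zs d c k, 1:] * [:- zs d c l, 1:]"
      using aff Quad by simp
    have w: "E.acts \<rho> n (fgen GS * fgen GT * fgen GU) r"
      using aff Quad by (simp add: E.acts_def r_def)
    have e: "zs d c k = qmon d k (fst (char_exponents a b c \<chi>))"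
      "zs d c l = qmon d l (snd (char_exponents a b c \<chi>))" by (simp_all add: zs_qmon Quad)
    have m: "zs d c k \<in> set E.hc.eigenvalues" "zs d c l \<in> set E.hc.eigenvalues"
      unfolding E.hc.eigenvalues_def using kl by auto
    have nz: "zs d c k * zs d c l \<noteq> 0" by (simp add: zs_qmon)
    note acts = E.acts_conjugates_quadratic[OF rep n cp w r nz]
    show thesis
      by (rule that[OF rep _ f acts[unfolded e] m[unfolded e]]) (use of_nat_2_ratfun n in simp_all)
  qed
qed

text \<open>Let \<open>h\<close> select the exponents \<open>W\<close> of \<open>\<chi>\<close>. The central idempotent \<open>h(u)h(ubar)\<close> acts as \<open>1\<close> on \<open>\<chi>\<close>, so
  it contains the block and acts as \<open>1\<close> on \<open>\<psi>\<close> as well.\<close>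
lemma same_block_exponents_subset:
  assumes mu: "card (cyc_mu d) > 0"
    and \<chi>: "specialized_char d a b c \<chi> f" and \<psi>: "specialized_char d a b c \<psi> g"
    and block: "same_rouquier_block d a b c f g"
  shows "{fst (char_exponents a b c \<psi>), snd (char_exponents a b c \<psi>)}
    \<subseteq> {fst (char_exponents a b c \<chi>), snd (char_exponents a b c \<chi>)}"
proof -
  define W where "W = {fst (char_exponents a b c \<chi>), snd (char_exponents a b c \<chi>)}"
  define P where "P r \<longleftrightarrow> (\<exists>k. \<exists>m\<in>W. r = qmon d k m)" for r
  have P: "P (qmon d k m) \<longleftrightarrow> m \<in> W" for k m
    using qmon_diff_unit[OF d mu, of m] unfolding P_def by metis
  obtain h p where h: "h \<in> poly_over (rouquier_ring d)" "p \<in> poly_over (rouquier_ring d)"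
    "h * h - h = p * linear_factors E.hc.eigenvalues"
    "\<And>r. r \<in> set E.hc.eigenvalues \<Longrightarrow> poly h r = of_bool (P r)"
  proof (rule separating_polynomial[of "rouquier_ring d" E.hc.eigenvalues P])
    show "r \<noteq> r' \<and> inverse (r - r') \<in> rouquier_ring d"
      if "r \<in> set E.hc.eigenvalues" "r' \<in> set E.hc.eigenvalues" "P r" "\<not> P r'" for r r'
    proof -
      obtain k m where r: "r = qmon d k m" using eigenvalues_qmon \<open>r \<in> _\<close> by blast
      obtain k' m' where r': "r' = qmon d k' m'" using eigenvalues_qmon \<open>r' \<in> _\<close> by blast
      show ?thesis unfolding r r'
        by (rule qmon_diff_unit[OF d mu]) (use that P r r' in auto)
    qed
  qed (use E.R E.hc.eigenvalues_R in auto)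
  define N where "N = E.hc.ev h (fgen GU) * E.hc.ev h E.hc.ubar"
  obtain c' where c': "E.hc.central c'" "E.hc.cong N c'"
    using E.hc.norm_value[of h "\<lambda>_ _. True" 0 0] h(1) unfolding N_def by auto
  have central: "E.hc.central N" using E.hc.central_cong c' by blast
  have idem: "E.hc.cong (N * N) N"
    unfolding N_def using E.hc.norm_idempotent[OF h(1-3)] by simp
  obtain B e e' where B: "central_primitive_idem E.H B"
    and e: "char_idem d a b c f e" "char_idem d a b c g e'"
    and eB: "e \<otimes>\<^bsub>E.L.H\<^esub> hecke_extend (Ky d) d (xs d a) (ys d b) (zs d c) B = e"
      "e' \<otimes>\<^bsub>E.L.H\<^esub> hecke_extend (Ky d) d (xs d a) (ys d b) (zs d c) B = e'"
    using block unfolding same_rouquier_block_def KyH_def RyH_def RyH_to_KyH_def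
    by (elim exE conjE) (rule that)
  have block_iff: "(fst (char_exponents a b c \<theta>) \<in> W \<and> snd (char_exponents a b c \<theta>) \<in> W)
      \<longleftrightarrow> B \<otimes>\<^bsub>E.H\<^esub> E.cls N = B"
    if \<theta>: "specialized_char d a b c \<theta> t" and u: "char_idem d a b c t v"
      and v: "v \<otimes>\<^bsub>E.L.H\<^esub> hecke_extend (Ky d) d (xs d a) (ys d b) (zs d c) B = v" for \<theta> t v
  proof -
    from \<theta> obtain n \<rho> k k' where rep: "hecke_rep (Ky d) d (xs d a) (ys d b) (zs d c) n \<rho>"
      and n: "of_nat n \<noteq> (0 :: ratfun)"
      and t: "\<forall>h\<in>carrier (KyH d a b c). t h = mat_tr (\<rho> h)"
      and act: "E.acts \<rho> n E.hc.tau (qmon d k (fst (char_exponents a b c \<theta>)) + qmon d k' (snd (char_exponents a b c \<theta>)))"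
      "E.acts \<rho> n E.hc.omega (qmon d k (fst (char_exponents a b c \<theta>)) * qmon d k' (snd (char_exponents a b c \<theta>)))"
      and ev: "qmon d k (fst (char_exponents a b c \<theta>)) \<in> set E.hc.eigenvalues"
      "qmon d k' (snd (char_exponents a b c \<theta>)) \<in> set E.hc.eigenvalues"
      by (rule specialized_char_acts)
    have act_N: "E.acts \<rho> n N (of_bool (fst (char_exponents a b c \<theta>) \<in> W) * of_bool (snd (char_exponents a b c \<theta>) \<in> W))"
      using E.acts_norm[OF rep h(1) act] unfolding N_def h(4)[OF ev(1)] h(4)[OF ev(2)] P .
    have "v \<in> carrier E.L.H"
      using u unfolding char_idem_def KyH_def central_primitive_idem_def central_idem_def ring_center_def
      by (elim conjE CollectE)
    moreover have "t (v \<otimes>\<^bsub>E.L.H\<^esub> h) = t h" if "h \<in> carrier E.L.H" for h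
      using u[unfolded char_idem_def KyH_def, THEN conjunct2] that by (rule bspec)
    ultimately have "of_bool (fst (char_exponents a b c \<theta>) \<in> W) * of_bool (snd (char_exponents a b c \<theta>) \<in> W)
        = (of_bool (B \<otimes>\<^bsub>E.H\<^esub> E.cls N = B) :: ratfun)"
      using E.block_determines_action[OF rep n B central idem bspec[OF t[unfolded KyH_def]] _ _ v act_N] by simp
    then show ?thesis by (auto simp: of_bool_def split: if_splits)
  qed
  have "B \<otimes>\<^bsub>E.H\<^esub> E.cls N = B"
    using block_iff[OF \<chi> e(1) eB(1)] by (simp add: W_def)
  then show ?thesis using block_iff[OF \<psi> e(2) eB(2)] by (simp add: W_def)
qed

lemma same_block_exponents:
  assumes mu: "card (cyc_mu d) > 0"
    and \<chi>: "specialized_char d a b c \<chi> f" and \<psi>: "specialized_char d a b c \<psi> g"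
    and block: "same_rouquier_block d a b c f g"
  shows "{fst (char_exponents a b c \<psi>), snd (char_exponents a b c \<psi>)}
    = {fst (char_exponents a b c \<chi>), snd (char_exponents a b c \<chi>)}"
proof -
  have "same_rouquier_block d a b c g f" using block unfolding same_rouquier_block_def by blast
  then show ?thesis
    using same_block_exponents_subset[OF mu \<chi> \<psi> block] same_block_exponents_subset[OF mu \<psi> \<chi>] by blast
qed

end

section \<open>Valuation and degree\<close>

lemma map_poly_rconst_rvar: "poly (map_poly rconst p) rvar = to_fract p"
proof (induction p)
  case (pCons w p)
  have "to_fract (pCons w p) = to_fract ([:w:] + [:0, 1:] * p)" by simp
  also have "\<dots> = rconst w + rvar * to_fract p"
    unfolding to_fract_add to_fract_mult rconst_def rvar_def ..
  finally show ?case using pCons by (simp add: map_poly_pCons)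
qed simp

lemma map_poly_rconst_inverse_rvar:
  "poly (map_poly rconst p) (inverse rvar) = to_fract (reflect_poly p) / rvar ^ Polynomial.degree p"
proof -
  have deg: "Polynomial.degree (map_poly rconst p) = Polynomial.degree p"
    by (rule degree_map_poly) simp
  have "reflect_poly (map_poly rconst p) = map_poly rconst (reflect_poly p)"
    by (rule poly_eqI) (simp add: coeff_reflect_poly coeff_map_poly deg)
  then have "to_fract (reflect_poly p) = rvar ^ Polynomial.degree p * poly (map_poly rconst p) (inverse rvar)"
    using poly_reflect_poly_nz[of rvar "map_poly rconst p"] by (simp add: map_poly_rconst_rvar deg)
  then show ?thesis by (simp add: field_simps)
qed

text \<open>At \<open>1/y\<close> a polynomial takes the value of its reflection at \<open>y\<close>, divided by \<open>y\<close> to its degree. As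
  reflection and degree are compatible with products, the result does not depend on the fraction
  chosen.\<close>
lemma subst_inv_Fract:
  assumes "p \<noteq> 0" "r \<noteq> 0"
  shows "subst_inv (Fract p r) = Fract (reflect_poly p * Polynomial.monom 1 (Polynomial.degree r))
    (reflect_poly r * Polynomial.monom 1 (Polynomial.degree p))"
proof -
  have eval: "poly (map_poly rconst p) (inverse rvar) / poly (map_poly rconst r) (inverse rvar)
    = Fract (reflect_poly p * Polynomial.monom 1 (Polynomial.degree r))
      (reflect_poly r * Polynomial.monom 1 (Polynomial.degree p))" for p r
    unfolding map_poly_rconst_inverse_rvar Fract_conv_to_fract to_fract_mult rvar_power by simp
  show ?thesis unfolding subst_inv_def eval
  proof (rule the_equality)
    fix Q assume "\<exists>p' r'. r' \<noteq> 0 \<and> Fract p r = Fract p' r' \<and>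
      Q = Fract (reflect_poly p' * Polynomial.monom 1 (Polynomial.degree r'))
        (reflect_poly r' * Polynomial.monom 1 (Polynomial.degree p'))"
    then obtain p' r' where r': "r' \<noteq> 0" "Fract p r = Fract p' r'"
      and Q: "Q = Fract (reflect_poly p' * Polynomial.monom 1 (Polynomial.degree r'))
        (reflect_poly r' * Polynomial.monom 1 (Polynomial.degree p'))" by blast
    have mm: "Polynomial.monom (1 :: complex) (m + n) = Polynomial.monom 1 m * Polynomial.monom 1 n" for m n
      by (simp add: mult_monom)
    have e: "p * r' = p' * r" using assms r' by (simp add: eq_fract)
    then have p': "p' \<noteq> 0" using assms r' by auto
    have "reflect_poly p * reflect_poly r' = reflect_poly p' * reflect_poly r"
      using arg_cong[OF e, of reflect_poly] by (simp add: reflect_poly_mult)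
    moreover have "Polynomial.degree p + Polynomial.degree r' = Polynomial.degree p' + Polynomial.degree r"
      using arg_cong[OF e, of Polynomial.degree] assms r' p' by (simp add: degree_mult_eq)
    ultimately have "reflect_poly p * reflect_poly r' * Polynomial.monom 1 (Polynomial.degree p' + Polynomial.degree r)
      = reflect_poly p' * reflect_poly r * Polynomial.monom 1 (Polynomial.degree p + Polynomial.degree r')"
      by simp
    then have "(reflect_poly p' * Polynomial.monom 1 (Polynomial.degree r')) * (reflect_poly r * Polynomial.monom 1 (Polynomial.degree p))
      = (reflect_poly p * Polynomial.monom 1 (Polynomial.degree r)) * (reflect_poly r' * Polynomial.monom 1 (Polynomial.degree p'))"
      unfolding mm by (simp only: mult_ac)
    then show "Q = Fract (reflect_poly p * Polynomial.monom 1 (Polynomial.degree r))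
        (reflect_poly r * Polynomial.monom 1 (Polynomial.degree p))"
      unfolding Q using assms r' by (simp add: eq_fract)
  qed (use assms in blast)
qed

lemma deg_y_Fract:
  assumes "p \<noteq> 0" "r \<noteq> 0"
  shows "deg_y (Fract p r) = int (Polynomial.degree p) - int (Polynomial.degree r)"
proof -
  have "Polynomial.order 0 (reflect_poly q) = 0" if "q \<noteq> 0" for q :: "complex poly"
    using that by (intro order_0I) simp
  then show ?thesis
    unfolding deg_y_def subst_inv_Fract[OF assms] using assms
    by (subst val_y_Fract) (simp_all add: Polynomial.order_mult order_0_monom)
qed

lemma Fract_eq_0_iff: "r \<noteq> 0 \<Longrightarrow> Fract p r = 0 \<longleftrightarrow> p = 0"
  by (simp add: Zero_fract_def eq_fract)

text \<open>For a product of factors \<open>\<xi>y\<^sup>m - 1\<close> the integers \<open>e\<close> and \<open>v\<close> are the sums of the \<open>m\<close> and of the \<open>|m|\<close>,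
  since \<open>min 0 m = (m - |m|)/2\<close> and \<open>max 0 m = (m + |m|)/2\<close>. In this form both invariants are
  additive.\<close>
definition growth :: "ratfun \<Rightarrow> int \<Rightarrow> int \<Rightarrow> bool" where
  "growth P e v \<longleftrightarrow> P \<noteq> 0 \<and> 2 * val_y P = e - v \<and> 2 * deg_y P = e + v"

lemma growth_mult:
  assumes "growth P e v" "growth Q e' v'" shows "growth (P * Q) (e + e') (v + v')"
proof -
  have nz: "P \<noteq> 0" "Q \<noteq> 0" using assms by (auto simp: growth_def)
  obtain p r where P: "P = Fract p r" "r \<noteq> 0" by (cases P) auto
  obtain p' r' where Q: "Q = Fract p' r'" "r' \<noteq> 0" by (cases Q) auto
  have p: "p \<noteq> 0" "p' \<noteq> 0" using nz P Q by (auto simp: Fract_eq_0_iff)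
  show ?thesis using assms P Q p
    by (simp add: growth_def val_y_Fract deg_y_Fract Polynomial.order_mult degree_mult_eq Fract_eq_0_iff)
qed

lemma growth_const: "w \<noteq> 0 \<Longrightarrow> growth (rconst w) 0 0"
  unfolding growth_def rconst_def to_fract_def
  by (auto simp: val_y_Fract deg_y_Fract order_0I Fract_eq_0_iff)

lemma growth_prod:
  assumes "finite J" "\<And>j. j \<in> J \<Longrightarrow> growth (P j) (e j) (v j)"
  shows "growth (\<Prod>j\<in>J. P j) (\<Sum>j\<in>J. e j) (\<Sum>j\<in>J. v j)"
  using assms growth_const[of 1] by (induction J) (auto simp: growth_mult)

lemma growth_Phi1:
  assumes "w \<noteq> 0" "m \<noteq> 0 \<or> w \<noteq> 1"
  shows "growth (Phi1 (rconst w * rvar powi m)) m \<bar>m\<bar>"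
proof (cases "m \<ge> 0")
  case True
  define n where "n = nat m"
  have m: "m = int n" using True by (simp add: n_def)
  define p where "p = Polynomial.monom w n - 1"
  have p0: "poly p 0 \<noteq> 0" using assms by (cases "n = 0") (auto simp: p_def m poly_monom power_0_left)
  then have p: "p \<noteq> 0" by auto
  have deg: "Polynomial.degree p = n"
  proof (cases "n = 0")
    case False
    then show ?thesis unfolding p_def using assms
      by (subst diff_conv_add_uminus, subst degree_add_eq_left) (auto simp: degree_monom_eq)
  qed (simp add: p_def monom_0 one_pCons)
  have "Phi1 (rconst w * rvar powi m) = Fract p 1"
    unfolding Phi1_def m power_int_of_nat rvar_power rconst_def to_fract_def p_def
    by (simp add: One_fract_def smult_monom)
  then show ?thesis unfolding growth_def
    using p p0 by (simp add: val_y_Fract deg_y_Fract order_0I deg m Fract_eq_0_iff)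
next
  case False
  define n where "n = nat (- m)"
  have m: "m = - int n" and n: "n > 0" using False by (auto simp: n_def)
  define p where "p = [:w:] - Polynomial.monom 1 n"
  have p0: "poly p 0 \<noteq> 0" using assms n by (auto simp: p_def poly_monom power_0_left)
  then have p: "p \<noteq> 0" by auto
  have deg: "Polynomial.degree p = n" unfolding p_def using n
    by (subst diff_conv_add_uminus, subst degree_add_eq_right) (auto simp: degree_monom_eq)
  have "Phi1 (rconst w * rvar powi m) = Fract p (Polynomial.monom 1 n)"
    unfolding Phi1_def m power_int_minus power_int_of_nat p_def Fract_conv_to_fract to_fract_diff
      rvar_power[symmetric] rconst_def
    by (simp add: field_simps)
  then show ?thesis unfolding growth_def
    using p p0 by (simp add: val_y_Fract deg_y_Fract order_0I order_0_monom deg m degree_monom_eq Fract_eq_0_iff)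
qed

section \<open>The Schur elements\<close>

definition growth_sum :: "nat \<Rightarrow> (nat \<Rightarrow> int) \<Rightarrow> int \<times> int \<Rightarrow> int" where
  "growth_sum d c p = (\<Sum>m<d. fst p + snd p - 2 * c m)"

text \<open>With \<open>\<alpha> = a\<^sub>0 - a\<^sub>1\<close>, \<open>\<beta> = b\<^sub>0 - b\<^sub>1\<close> and \<open>\<gamma>\<close> the difference of the exponents, the terms after the sum
  are \<open>max |\<alpha>+\<beta>| |\<gamma>| + max |\<alpha>-\<beta>| |\<gamma>| - 2|\<gamma>|\<close>. For degree \<open>2\<close> the two maxima come from the last four
  factors of the Schur element, and \<open>2|\<gamma>|\<close> from the indices \<open>k, l\<close> omitted in its first product. For a
  linear character \<open>|\<gamma>|\<close> is \<open>|\<alpha>+\<beta>|\<close> or \<open>|\<alpha>-\<beta>|\<close>, and the terms reduce to \<open>|\<alpha>| + |\<beta>| - |\<gamma>|\<close>: the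
  first two factors, and the omitted index \<open>k\<close>.\<close>
definition growth_spread ::
  "nat \<Rightarrow> (nat \<Rightarrow> int) \<Rightarrow> (nat \<Rightarrow> int) \<Rightarrow> (nat \<Rightarrow> int) \<Rightarrow> int \<times> int \<Rightarrow> int" where
  "growth_spread d a b c p = (\<Sum>m<d. \<bar>fst p - c m\<bar> + \<bar>snd p - c m\<bar>) - 2 * \<bar>fst p - snd p\<bar>
     + max \<bar>(a 0 - a 1) + (b 0 - b 1)\<bar> \<bar>fst p - snd p\<bar> + max \<bar>(a 0 - a 1) - (b 0 - b 1)\<bar> \<bar>fst p - snd p\<bar>"

lemma qpar_powi: "qpar d powi m = rvar powi (int (card (cyc_mu d)) * m)"
  by (simp add: qpar_def power_int_power)

lemma qsqrt_powi: "qsqrt d powi m = rvar powi (int (card (cyc_mu d) div 2) * m)"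
  by (simp add: qsqrt_def power_int_power)

lemma rconst_divide: "rconst v / rconst w = rconst (v / w)"
  by (simp add: divide_inverse rconst_mult rconst_inverse)

lemma growth_Phi1_qpar:
  "w \<noteq> 0 \<Longrightarrow> w \<noteq> 1 \<Longrightarrow> growth (Phi1 (rconst w * qpar d powi m)) (int (card (cyc_mu d)) * m) (int (card (cyc_mu d)) * \<bar>m\<bar>)"
  unfolding qpar_powi using growth_Phi1[of w "int (card (cyc_mu d)) * m"] by (simp add: abs_mult)

lemma growth_Phi1_qsqrt:
  "w \<noteq> 0 \<Longrightarrow> w \<noteq> 1 \<Longrightarrow> growth (Phi1 (rconst w * qsqrt d powi m))
    (int (card (cyc_mu d) div 2) * m) (int (card (cyc_mu d) div 2) * \<bar>m\<bar>)"
  unfolding qsqrt_powi using growth_Phi1[of w "int (card (cyc_mu d) div 2) * m"] by (simp add: abs_mult)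

lemma xs_ratio: "i \<in> {0, 1} \<Longrightarrow> xs d a i / xs d a (1 - i) = rconst (- 1) * qpar d powi (a i - a (1 - i))"
  by (auto simp: xs_def rconst_uminus power_int_diff)

lemma zs_ratio: "zs d c k / zs d c l = rconst (zeta d ^ k / zeta d ^ l) * qpar d powi (c k - c l)"
  by (simp add: zs_def power_int_diff rconst_divide[symmetric])

lemma zeta_ratio_neq_1: "k < d \<Longrightarrow> l < d \<Longrightarrow> k \<noteq> l \<Longrightarrow> zeta d ^ k / zeta d ^ l \<noteq> 1"
  using zeta_power_inj[of k d l] by auto

lemma abs_add_abs_diff: "\<bar>p + q\<bar> + \<bar>p - q\<bar> = 2 * max \<bar>p\<bar> \<bar>q\<bar>" for p q :: int
  by (simp add: max_def abs_if)

lemma max_abs_add_diff: "max \<bar>p + q\<bar> \<bar>p - q\<bar> = \<bar>p\<bar> + \<bar>q\<bar>" for p q :: int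
  by (simp add: max_def abs_if)

text \<open>For \<open>l = k\<close> the summand of \<open>growth_sum\<close> is \<open>\<alpha> + \<beta>\<close>, which the first two factors contribute.\<close>
lemma growth_schur_linear:
  assumes "hecke_irr d (Lin i j k)"
  defines "\<mu> \<equiv> int (card (cyc_mu d))"
  shows "growth (specialized_schur d a b c (Lin i j k))
    (\<mu> * growth_sum d c (char_exponents a b c (Lin i j k)))
    (\<mu> * growth_spread d a b c (char_exponents a b c (Lin i j k)))"
proof -
  have ij: "i \<in> {0, 1}" "j \<in> {0, 1}" and k: "k < d" using assms by auto
  define \<alpha> where "\<alpha> = a i - a (1 - i)"
  define \<beta> where "\<beta> = b j - b (1 - j)"
  have x: "xs d a i / xs d a (1 - i) = rconst (- 1) * qpar d powi \<alpha>"
    and y: "ys d b j / ys d b (1 - j) = rconst (- 1) * qpar d powi \<beta>"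
    unfolding \<alpha>_def \<beta>_def ys_xs using ij by (intro xs_ratio; simp)+
  have xyz: "(xs d a i / xs d a (1 - i)) * (ys d b j / ys d b (1 - j)) * (zs d c k / zs d c l)
      = rconst (zeta d ^ k / zeta d ^ l) * qpar d powi (\<alpha> + \<beta> + (c k - c l))" for l
    unfolding x y zs_ratio
    by (simp add: power_int_add[OF disjI1[OF qpar_nonzero]] rconst_uminus)
  have "growth (specialized_schur d a b c (Lin i j k))
      (\<mu> * \<alpha> + \<mu> * \<beta> + (\<Sum>l\<in>{..<d} - {k}. \<mu> * (c k - c l) + \<mu> * (\<alpha> + \<beta> + (c k - c l))))
      (\<mu> * \<bar>\<alpha>\<bar> + \<mu> * \<bar>\<beta>\<bar> + (\<Sum>l\<in>{..<d} - {k}. \<mu> * \<bar>c k - c l\<bar> + \<mu> * \<bar>\<alpha> + \<beta> + (c k - c l)\<bar>))"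
    unfolding specialized_schur_def schur_element.simps xyz unfolding x y zs_ratio \<mu>_def
    using k zeta_ratio_neq_1[of k d]
    by (intro growth_mult growth_prod growth_Phi1_qpar) auto
  moreover have "\<mu> * \<alpha> + \<mu> * \<beta> + (\<Sum>l\<in>{..<d} - {k}. \<mu> * (c k - c l) + \<mu> * (\<alpha> + \<beta> + (c k - c l)))
      = \<mu> * growth_sum d c (char_exponents a b c (Lin i j k))"
  proof -
    have "growth_sum d c (char_exponents a b c (Lin i j k))
        = (\<Sum>l<d. (c k - c l) + (\<alpha> + \<beta> + (c k - c l)))"
      unfolding growth_sum_def by (rule sum.cong) (simp_all add: \<alpha>_def \<beta>_def)
    also have "\<dots> = (\<alpha> + \<beta>) + (\<Sum>l\<in>{..<d} - {k}. (c k - c l) + (\<alpha> + \<beta> + (c k - c l)))"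
      using k by (subst sum.remove[of _ k]) auto
    finally show ?thesis by (simp only: distrib_left sum_distrib_left)
  qed
  moreover have "\<mu> * \<bar>\<alpha>\<bar> + \<mu> * \<bar>\<beta>\<bar> + (\<Sum>l\<in>{..<d} - {k}. \<mu> * \<bar>c k - c l\<bar> + \<mu> * \<bar>\<alpha> + \<beta> + (c k - c l)\<bar>)
      = \<mu> * growth_spread d a b c (char_exponents a b c (Lin i j k))"
  proof -
    have remove: "(\<Sum>l<d. \<bar>c k - c l\<bar> + \<bar>\<alpha> + \<beta> + (c k - c l)\<bar>)
        = \<bar>\<alpha> + \<beta>\<bar> + (\<Sum>l\<in>{..<d} - {k}. \<bar>c k - c l\<bar> + \<bar>\<alpha> + \<beta> + (c k - c l)\<bar>)"
      using k by (subst sum.remove[of _ k]) auto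
    have total: "(\<Sum>l<d. \<bar>c k - c l\<bar> + \<bar>\<alpha> + \<beta> + (c k - c l)\<bar>)
        = (\<Sum>m<d. \<bar>fst (char_exponents a b c (Lin i j k)) - c m\<bar> + \<bar>snd (char_exponents a b c (Lin i j k)) - c m\<bar>)"
      by (rule sum.cong) (simp_all add: \<alpha>_def \<beta>_def algebra_simps)
    have max: "max \<bar>(a 0 - a 1) + (b 0 - b 1)\<bar> \<bar>\<alpha> + \<beta>\<bar> + max \<bar>(a 0 - a 1) - (b 0 - b 1)\<bar> \<bar>\<alpha> + \<beta>\<bar>
        = \<bar>\<alpha> + \<beta>\<bar> + \<bar>\<alpha>\<bar> + \<bar>\<beta>\<bar>"
    proof -
      define A where "A = a 0 - a 1"
      define B where "B = b 0 - b 1"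
      consider "\<alpha> = A" "\<beta> = B" | "\<alpha> = A" "\<beta> = - B" | "\<alpha> = - A" "\<beta> = B" | "\<alpha> = - A" "\<beta> = - B"
        using ij unfolding \<alpha>_def \<beta>_def A_def B_def by fastforce
      then have "(\<bar>\<alpha> + \<beta>\<bar> = \<bar>A + B\<bar> \<or> \<bar>\<alpha> + \<beta>\<bar> = \<bar>A - B\<bar>) \<and> \<bar>\<alpha>\<bar> = \<bar>A\<bar> \<and> \<bar>\<beta>\<bar> = \<bar>B\<bar>"
      proof cases
        case 3
        then show ?thesis using abs_minus_commute[of A B] by simp
      next
        case 4
        then show ?thesis using abs_minus_cancel[of "A + B"] by simp
      qed simp_all
      then show ?thesis
        using max_abs_add_diff[of A B] unfolding A_def[symmetric] B_def[symmetric]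
        by (auto simp: max.commute)
    qed
    have gap: "\<bar>fst (char_exponents a b c (Lin i j k)) - snd (char_exponents a b c (Lin i j k))\<bar> = \<bar>\<alpha> + \<beta>\<bar>"
      by (simp add: \<alpha>_def \<beta>_def)
    have rearrange: "T + S - 2 * T + (T + p + q) = p + q + S" for T S p q :: int by simp
    have "growth_spread d a b c (char_exponents a b c (Lin i j k))
        = \<bar>\<alpha>\<bar> + \<bar>\<beta>\<bar> + (\<Sum>l\<in>{..<d} - {k}. \<bar>c k - c l\<bar> + \<bar>\<alpha> + \<beta> + (c k - c l)\<bar>)"
      unfolding growth_spread_def gap total[symmetric] remove add.assoc[of _ "max _ _"] max by (rule rearrange)
    then show ?thesis by (simp only: distrib_left sum_distrib_left)
  qed
  ultimately show ?thesis by simp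
qed


lemma root_ratio:
  assumes "i \<in> {0, 1}"
  obtains w where "xs_root d a i / xs_root d a (1 - i) = rconst w * qsqrt d powi (a i - a (1 - i))" "w\<^sup>2 = - 1"
proof
  have q: "qsqrt d \<noteq> 0" by (simp add: qsqrt_def)
  show "xs_root d a i / xs_root d a (1 - i) = rconst (\<i> ^ i / \<i> ^ (1 - i)) * qsqrt d powi (a i - a (1 - i))"
    by (simp add: xs_root_def rconst_divide[symmetric] power_int_diff q)
  show "(\<i> ^ i / \<i> ^ (1 - i))\<^sup>2 = (- 1 :: complex)"
    using assms by (auto simp: power_divide)
qed

text \<open>The factor is \<open>\<xi> y\<^sup>h\<^sup>m - 1\<close> where \<open>\<xi>\<^sup>2 = \<zeta>\<^sup>k\<^sup>-\<^sup>l \<noteq> 1\<close>, with \<open>\<zeta> = zeta d\<close>; so it does not vanish even for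
  \<open>m = 0\<close>.\<close>
lemma growth_quadratic_factor:
  fixes a b c :: "nat \<Rightarrow> int"
  assumes d: "d \<ge> 1" and i: "i \<in> {0, 1}" "j \<in> {0, 1}" and k: "k < d" "l < d" "k \<noteq> l" and \<epsilon>: "\<epsilon> = 1 \<or> \<epsilon> = - 1"
  defines "h \<equiv> int (card (cyc_mu d) div 2)"
    and "m \<equiv> (a i - a (1 - i)) + (b j - b (1 - j)) + (c k - c l)"
  shows "growth (Phi1 (of_int \<epsilon> * (xs_root d a i / xs_root d a (1 - i)) * (ys_root d b j / ys_root d b (1 - j))
    * (zs_root d c k / zs_root d c l))) (h * m) (h * \<bar>m\<bar>)"
proof -
  have q: "qsqrt d \<noteq> 0" by (simp add: qsqrt_def)
  obtain v where v: "xs_root d a i / xs_root d a (1 - i) = rconst v * qsqrt d powi (a i - a (1 - i))" "v\<^sup>2 = - 1"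
    using root_ratio[OF i(1)] by blast
  have ys: "ys_root d b = xs_root d b" by (simp add: fun_eq_iff ys_root_def xs_root_def)
  obtain v' where v': "ys_root d b j / ys_root d b (1 - j) = rconst v' * qsqrt d powi (b j - b (1 - j))" "v'\<^sup>2 = - 1"
    unfolding ys using root_ratio[OF i(2)] by blast
  define w where "w = zeta (2 * d) ^ k / zeta (2 * d) ^ l"
  have z: "zs_root d c k / zs_root d c l = rconst w * qsqrt d powi (c k - c l)"
    by (simp add: zs_root_def w_def rconst_divide[symmetric] power_int_diff q)
  have eps: "of_int \<epsilon> = rconst (of_int \<epsilon>)" using \<epsilon> by (auto simp: rconst_uminus)
  define \<xi> where "\<xi> = of_int \<epsilon> * v * v' * w"
  have "of_int \<epsilon> * (xs_root d a i / xs_root d a (1 - i)) * (ys_root d b j / ys_root d b (1 - j))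
      * (zs_root d c k / zs_root d c l) = rconst \<xi> * qsqrt d powi m"
    unfolding v v' z eps m_def \<xi>_def rconst_mult power_int_add[OF disjI1[OF q]] by (simp only: mult_ac)
  moreover have "\<xi>\<^sup>2 = zeta d ^ k / zeta d ^ l"
  proof -
    have "w\<^sup>2 = ((zeta (2 * d))\<^sup>2) ^ k / ((zeta (2 * d))\<^sup>2) ^ l"
      by (simp add: w_def power_divide flip: power_mult) (simp add: mult.commute)
    then show ?thesis using \<epsilon> v v' unfolding \<xi>_def power_mult_distrib zeta_double_square[OF d] by auto
  qed
  then have "\<xi> \<noteq> 0" "\<xi> \<noteq> 1" using zeta_ratio_neq_1[OF k] by auto
  ultimately show ?thesis unfolding h_def by (simp add: growth_Phi1_qsqrt)
qed

text \<open>The exponents of the last four factors add up to \<open>0\<close>. They are multiples of \<open>|\<mu>(K)|/2\<close>,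
  and the sum of their absolute values is found by pairing \<open>|p + q| + |p - q| = 2 max |p| |q|\<close>.\<close>
lemma growth_schur_quadratic:
  assumes irr: "hecke_irr d (Quad k l \<epsilon>)"
  defines "\<mu> \<equiv> int (card (cyc_mu d))"
  shows "growth (specialized_schur d a b c (Quad k l \<epsilon>))
    (\<mu> * growth_sum d c (char_exponents a b c (Quad k l \<epsilon>)))
    (\<mu> * growth_spread d a b c (char_exponents a b c (Quad k l \<epsilon>)))"
proof -
  have k: "k < d" "l < d" "k \<noteq> l" and \<epsilon>: "\<epsilon> = 1 \<or> \<epsilon> = - 1" and d: "d \<ge> 1" using irr by auto
  define h where "h = int (card (cyc_mu d) div 2)"
  have \<mu>: "\<mu> = 2 * h" using even_card_cyc_mu[of d] by (auto simp: \<mu>_def h_def elim!: evenE)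
  define \<alpha> where "\<alpha> = a 0 - a 1"
  define \<beta> where "\<beta> = b 0 - b 1"
  define \<gamma> where "\<gamma> = c k - c l"
  define S where "S = {..<d} - {k, l}"
  note f = growth_quadratic_factor[OF d _ _ _ _ _ \<epsilon>, folded h_def]
  have g: "growth (Phi1 (of_int \<epsilon> * (xs_root d a i / xs_root d a (1 - i)) * (ys_root d b i / ys_root d b (1 - i))
        * (zs_root d c k / zs_root d c l))
      * Phi1 (of_int \<epsilon> * (xs_root d a i / xs_root d a (1 - i)) * (ys_root d b (1 - i) / ys_root d b i)
        * (zs_root d c l / zs_root d c k)))
      (h * ((a i - a (1 - i)) + (b i - b (1 - i)) + \<gamma>) + h * ((a i - a (1 - i)) + (b (1 - i) - b i) + - \<gamma>))
      (h * \<bar>(a i - a (1 - i)) + (b i - b (1 - i)) + \<gamma>\<bar> + h * \<bar>(a i - a (1 - i)) + (b (1 - i) - b i) + - \<gamma>\<bar>)"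
    if "i \<in> {0, 1}" for i
  proof -
    have e: "1 - (1 - i) = i" "1 - i \<in> {0, 1}" "- \<gamma> = c l - c k" using that by (auto simp: \<gamma>_def)
    show ?thesis unfolding e(3) unfolding \<gamma>_def
      using f[where k = k and l = l and a = a and b = b and c = c, OF that that]
        f[where k = l and l = k and a = a and b = b and c = c, OF that e(2)] k unfolding e(1)
      by (intro growth_mult) auto
  qed
  have "rconst (- 2) = - 2"
  proof -
    have "rconst (- 2) = - rconst (1 + 1)" by (simp add: rconst_uminus)
    then show ?thesis unfolding rconst_add by simp
  qed
  then have two: "growth (- 2) 0 0" using growth_const[of "- 2"] by simp
  have "growth (specialized_schur d a b c (Quad k l \<epsilon>))
      (0 + (\<Sum>m\<in>S. \<mu> * (c k - c m) + \<mu> * (c l - c m))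
        + (\<Sum>i\<in>{0, 1}. h * ((a i - a (1 - i)) + (b i - b (1 - i)) + \<gamma>) + h * ((a i - a (1 - i)) + (b (1 - i) - b i) + - \<gamma>)))
      (0 + (\<Sum>m\<in>S. \<mu> * \<bar>c k - c m\<bar> + \<mu> * \<bar>c l - c m\<bar>)
        + (\<Sum>i\<in>{0, 1}. h * \<bar>(a i - a (1 - i)) + (b i - b (1 - i)) + \<gamma>\<bar> + h * \<bar>(a i - a (1 - i)) + (b (1 - i) - b i) + - \<gamma>\<bar>))"
    unfolding specialized_schur_def schur_element.simps S_def[symmetric]
  proof (rule growth_mult[OF growth_mult[OF two growth_prod] growth_prod[OF _ g]])
    fix m assume m: "m \<in> S"
    have "growth (Phi1 (zs d c k / zs d c m)) (\<mu> * (c k - c m)) (\<mu> * \<bar>c k - c m\<bar>)"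
      "growth (Phi1 (zs d c l / zs d c m)) (\<mu> * (c l - c m)) (\<mu> * \<bar>c l - c m\<bar>)"
      unfolding zs_ratio \<mu>_def using m k zeta_ratio_neq_1[of _ d m]
      by (auto intro!: growth_Phi1_qpar simp: S_def)
    then show "growth (Phi1 (zs d c k / zs d c m) * Phi1 (zs d c l / zs d c m))
        (\<mu> * (c k - c m) + \<mu> * (c l - c m)) (\<mu> * \<bar>c k - c m\<bar> + \<mu> * \<bar>c l - c m\<bar>)"
      by (rule growth_mult)
  qed (auto simp: S_def)
  moreover have split: "(\<Sum>m<d. t m) = t k + t l + (\<Sum>m\<in>S. t m)" for t :: "nat \<Rightarrow> int"
  proof -
    have e: "{..<d} = insert k (insert l S)" using k by (auto simp: S_def)
    have "finite S" "l \<notin> S" "k \<notin> insert l S" using k by (auto simp: S_def)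
    then show ?thesis unfolding e by simp
  qed
  have "0 + (\<Sum>m\<in>S. \<mu> * (c k - c m) + \<mu> * (c l - c m))
        + (\<Sum>i\<in>{0, 1}. h * ((a i - a (1 - i)) + (b i - b (1 - i)) + \<gamma>) + h * ((a i - a (1 - i)) + (b (1 - i) - b i) + - \<gamma>))
      = \<mu> * growth_sum d c (char_exponents a b c (Quad k l \<epsilon>))"
  proof -
    have "growth_sum d c (char_exponents a b c (Quad k l \<epsilon>)) = (\<Sum>m<d. (c k - c m) + (c l - c m))"
      unfolding growth_sum_def by (rule sum.cong) simp_all
    also have "\<dots> = (\<Sum>m\<in>S. (c k - c m) + (c l - c m))" unfolding split by simp
    finally have "\<mu> * growth_sum d c (char_exponents a b c (Quad k l \<epsilon>))
        = (\<Sum>m\<in>S. \<mu> * (c k - c m) + \<mu> * (c l - c m))" by (simp only: distrib_left sum_distrib_left)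
    then show ?thesis by (simp add: algebra_simps)
  qed
  moreover have "0 + (\<Sum>m\<in>S. \<mu> * \<bar>c k - c m\<bar> + \<mu> * \<bar>c l - c m\<bar>)
        + (\<Sum>i\<in>{0, 1}. h * \<bar>(a i - a (1 - i)) + (b i - b (1 - i)) + \<gamma>\<bar> + h * \<bar>(a i - a (1 - i)) + (b (1 - i) - b i) + - \<gamma>\<bar>)
      = \<mu> * growth_spread d a b c (char_exponents a b c (Quad k l \<epsilon>))"
  proof -
    have "\<bar>\<alpha> + \<beta> + \<gamma>\<bar> + \<bar>\<alpha> - \<beta> - \<gamma>\<bar> + (\<bar>- \<alpha> - \<beta> + \<gamma>\<bar> + \<bar>- \<alpha> + \<beta> - \<gamma>\<bar>)
      = 2 * (max \<bar>\<alpha> + \<beta>\<bar> \<bar>\<gamma>\<bar> + max \<bar>\<alpha> - \<beta>\<bar> \<bar>\<gamma>\<bar>)"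
    proof -
      have e: "\<bar>- \<alpha> - \<beta> + \<gamma>\<bar> = \<bar>\<alpha> + \<beta> - \<gamma>\<bar>" "\<bar>- \<alpha> + \<beta> - \<gamma>\<bar> = \<bar>\<alpha> - \<beta> + \<gamma>\<bar>"
        by linarith+
      have rearrange: "x + y = 2 * m \<Longrightarrow> z + w = 2 * m' \<Longrightarrow> x + w + (y + z) = 2 * (m + m')"
        for x y z w m m' :: int by simp
      show ?thesis unfolding e by (rule rearrange) (rule abs_add_abs_diff)+
    qed
    moreover have "(\<Sum>i\<in>{0, 1}. h * \<bar>(a i - a (1 - i)) + (b i - b (1 - i)) + \<gamma>\<bar> + h * \<bar>(a i - a (1 - i)) + (b (1 - i) - b i) + - \<gamma>\<bar>)
      = h * (\<bar>\<alpha> + \<beta> + \<gamma>\<bar> + \<bar>\<alpha> - \<beta> - \<gamma>\<bar> + (\<bar>- \<alpha> - \<beta> + \<gamma>\<bar> + \<bar>- \<alpha> + \<beta> - \<gamma>\<bar>))"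
      by (simp add: \<alpha>_def \<beta>_def distrib_left algebra_simps)
    ultimately have 1: "(\<Sum>i\<in>{0, 1}. h * \<bar>(a i - a (1 - i)) + (b i - b (1 - i)) + \<gamma>\<bar> + h * \<bar>(a i - a (1 - i)) + (b (1 - i) - b i) + - \<gamma>\<bar>)
      = \<mu> * (max \<bar>\<alpha> + \<beta>\<bar> \<bar>\<gamma>\<bar> + max \<bar>\<alpha> - \<beta>\<bar> \<bar>\<gamma>\<bar>)" by (simp only: \<mu>)
    have "(\<Sum>m<d. \<bar>c k - c m\<bar> + \<bar>c l - c m\<bar>) = 2 * \<bar>\<gamma>\<bar> + (\<Sum>m\<in>S. \<bar>c k - c m\<bar> + \<bar>c l - c m\<bar>)"
      unfolding split by (simp add: \<gamma>_def)
    then have "growth_spread d a b c (char_exponents a b c (Quad k l \<epsilon>))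
      = (\<Sum>m\<in>S. \<bar>c k - c m\<bar> + \<bar>c l - c m\<bar>) + (max \<bar>\<alpha> + \<beta>\<bar> \<bar>\<gamma>\<bar> + max \<bar>\<alpha> - \<beta>\<bar> \<bar>\<gamma>\<bar>)"
      by (simp add: growth_spread_def \<alpha>_def \<beta>_def \<gamma>_def)
    then show ?thesis unfolding 1 by (simp only: distrib_left sum_distrib_left)
  qed
  ultimately show ?thesis by simp
qed

lemma growth_schur:
  "hecke_irr d \<chi> \<Longrightarrow> growth (specialized_schur d a b c \<chi>)
    (int (card (cyc_mu d)) * growth_sum d c (char_exponents a b c \<chi>))
    (int (card (cyc_mu d)) * growth_spread d a b c (char_exponents a b c \<chi>))"
  by (cases \<chi>) (simp_all only: growth_schur_linear growth_schur_quadratic)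

lemma growth_invariants_swap:
  assumes "{fst p, snd p} = {fst p', snd p'}"
  shows "growth_sum d c p = growth_sum d c p'" "growth_spread d a b c p = growth_spread d a b c p'"
proof -
  have "p' = p \<or> p' = (snd p, fst p)"
    using assms by (cases p; cases p') (auto simp: doubleton_eq_iff)
  then show "growth_sum d c p = growth_sum d c p'" "growth_spread d a b c p = growth_spread d a b c p'"
    by (auto simp: growth_sum_def growth_spread_def add.commute abs_minus_commute)
qed

theorem proposition4p4:
  fixes d :: nat and a b c :: "nat \<Rightarrow> int"
    and \<chi> \<psi> :: hecke_char and f g :: "ratfun free set \<Rightarrow> ratfun"
  assumes "d \<ge> 1"
    and "specialized_char d a b c \<chi> f" and "specialized_char d a b c \<psi> g"
    and "same_rouquier_block d a b c f g"
  shows "a_value d a b c \<chi> = a_value d a b c \<psi> \<and> A_value d a b c \<chi> = A_value d a b c \<psi>"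
  \<comment> \<open>Both invariants are quotients by this cardinality, and a quotient by \<open>0\<close> is \<open>0\<close>.\<close>
proof (cases "card (cyc_mu d) = 0")
  case False
  have irr: "hecke_irr d \<chi>" "hecke_irr d \<psi>"
    using assms(2,3) unfolding specialized_char_def by (elim conjunct1)+
  have "{fst (char_exponents a b c \<chi>), snd (char_exponents a b c \<chi>)}
      = {fst (char_exponents a b c \<psi>), snd (char_exponents a b c \<psi>)}"
    using same_block_exponents[OF assms(1) _ assms(2-4)] False by simp
  note e = growth_invariants_swap[OF this]
  have "2 * val_y (specialized_schur d a b c \<chi>) = 2 * val_y (specialized_schur d a b c \<psi>)"
    "2 * deg_y (specialized_schur d a b c \<chi>) = 2 * deg_y (specialized_schur d a b c \<psi>)"
    using irr[THEN growth_schur, of a b c] unfolding growth_def e by simp_all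
  then show ?thesis unfolding a_value_def A_value_def by simp
qed (simp add: a_value_def A_value_def)

end
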